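(* Let $\mathcal{D}$ be a triangulated category with a split generator, let $F\colon\mathcal{D}\to\mathcal{D}$ be an endofunctor, and assume that $\mathcal{D}$ admits a Serre functor and a Bridgeland stability condition $\sigma$. Let $\phi_\sigma^\pm$ be the phase functions with respect to $\sigma$. Then for any split generator $G$ of $\mathcal{D}$ the following limits exist, are independent of the choice of split generator $G$, and coincide with the upper, respectively lower, shifting number of $F$: $$\lim_{n\to\infty}\frac{\phi^\pm_\sigma(F^nG)-\phi^\pm_\sigma(G)}{n}=\tau^\pm(F).$$
   Context: Conventions: $\mathbf{k}$ is a base field. All triangulated categories are $\mathbf{k}$-linear, $\mathbb{Z}$-graded, saturated, and of finite type, i.e. $\bigoplus_i\mathrm{Hom}_{\mathcal{D}}(E,E'[i])$ is finite-dimensional for all objects $E,E'$. All functors are $\mathbf{k}$-linear, triangulated, and not virtually zero (no power is the zero functor). An object $G$ of $\mathcal{D}$ is a split generator if for every object $E$ there are an object $E'$ and a sequence $0=A_0\to A_1\to\cdots\to A_m=E\oplus E'$ with $\mathrm{Cone}(A_{k-1}\to A_k)\cong G[n_k]$ for some integers $n_k$. Shifting numbers: with $\epsilon^+(E_1,E_2):=\max\{k:\mathrm{Hom}(E_1,E_2[-k])\neq0\}$ and $\epsilon^-(E_1,E_2):=\min\{k:\mathrm{Hom}(E_1,E_2[-k])\neq0\}$, the upper and lower shifting numbers are $\tau^\pm(F):=\lim_{n\to\infty}\epsilon^\pm(G,F^nG)/n$ (these limits exist in $\mathbb{R}$ and do not depend on the split generator $G$). Bridgeland stability condition: fix a group homomorphism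 $\mathrm{cl}\colon K_0(\mathcal{D})\to\Gamma$ to a free abelian group of finite rank. A stability condition $\sigma=(Z_\sigma,P_\sigma)$ consists of a group homomorphism $Z_\sigma\colon\Gamma\to\mathbb{C}$ and full additive subcategories $P_\sigma(\phi)\subseteq\mathcal{D}$, $\phi\in\mathbb{R}$ (semistable objects of phase $\phi$), such that: (i) $Z_\sigma(E):=Z_\sigma(\mathrm{cl}([E]))\in\mathbb{R}_{>0}e^{i\pi\phi}$ for $0\ne E\in P_\sigma(\phi)$; (ii) $P_\sigma(\phi+1)=P_\sigma(\phi)[1]$; (iii) $\mathrm{Hom}(E_1,E_2)=0$ if $E_i\in P_\sigma(\phi_i)$ and $\phi_1>\phi_2$; (iv) every nonzero $E\in\mathcal{D}$ has exact triangles $E_{i-1}\to E_i\to A_i\to E_{i-1}[1]$, $1\le i\le n$, with $E_0=0$, $E_n=E$, $0\neq A_i\in P_\sigma(\phi_i)$, $\phi_1>\cdots>\phi_n$ (Harder–Narasimhan filtration); (v) (support property) there are $C>0$ and a norm $\|\cdot\|$ on $\Gamma\otimes\mathbb{R}$ with $\|\mathrm{cl}([E])\|\le C|Z_\sigma(E)|$ for all nonzero semistable $E$. Set $\phi_\sigma^+(E):=\phi_1$ and $\phi_\sigma^-(E):=\phi_n$. *)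

theory Defs
  imports Complex_Main "HOL-Algebra.Free_Abelian_Groups"
begin

section \<open>Linear categories\<close>

text \<open>
  The base field is a type \<open>'k\<close> of class \<open>field\<close>, the objects of a category are the elements of a
  type \<open>'o\<close>, and all morphism spaces are linear subspaces of one ambient vector space \<open>'m\<close> (for a
  given category one may take the direct sum of all its Hom spaces). The locale below requires that
  a nonzero morphism determines its domain and codomain; this is why composition, and later the
  morphism part of a functor, carry no object indices.
\<close>

definition linear_on ::
  "('k \<Rightarrow> 'a \<Rightarrow> 'a) \<Rightarrow> ('k \<Rightarrow> 'b \<Rightarrow> 'b) \<Rightarrow> 'a set \<Rightarrow> ('a::ab_group_add \<Rightarrow> 'b::ab_group_add) \<Rightarrow> bool" where
  "linear_on s t V f \<longleftrightarrow>
     (\<forall>x\<in>V. \<forall>y\<in>V. f (x + y) = f x + f y) \<and> (\<forall>c. \<forall>x\<in>V. f (s c x) = t c (f x))"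

record ('k, 'o, 'm) lincat =
  smul :: "'k \<Rightarrow> 'm \<Rightarrow> 'm"
  Hom :: "'o \<Rightarrow> 'o \<Rightarrow> 'm set"
  compose :: "'m \<Rightarrow> 'm \<Rightarrow> 'm" (infixr "\<cdot>\<index>" 75)
  ident :: "'o \<Rightarrow> 'm"

locale linear_category =
  fixes D :: "('k::field, 'o, 'm::ab_group_add, 'z) lincat_scheme" (structure)
  assumes vector_space_smul: "vector_space (smul D)"
    and subspace_Hom: "module.subspace (smul D) (Hom D X Y)"
    and Hom_disjoint: "f \<in> Hom D X Y \<Longrightarrow> f \<in> Hom D X' Y' \<Longrightarrow> f \<noteq> 0 \<Longrightarrow> X = X' \<and> Y = Y'"
    and compose_closed: "f \<in> Hom D X Y \<Longrightarrow> g \<in> Hom D Y Z \<Longrightarrow> g \<cdot> f \<in> Hom D X Z"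
    and compose_assoc:
      "f \<in> Hom D W X \<Longrightarrow> g \<in> Hom D X Y \<Longrightarrow> h \<in> Hom D Y Z \<Longrightarrow> h \<cdot> (g \<cdot> f) = (h \<cdot> g) \<cdot> f"
    and ident_closed: "ident D X \<in> Hom D X X"
    and ident_right: "f \<in> Hom D X Y \<Longrightarrow> f \<cdot> ident D X = f"
    and ident_left: "f \<in> Hom D X Y \<Longrightarrow> ident D Y \<cdot> f = f"
    and compose_linear_right:
      "g \<in> Hom D Y Z \<Longrightarrow> linear_on (smul D) (smul D) (Hom D X Y) (\<lambda>f. g \<cdot> f)"
    and compose_linear_left:
      "f \<in> Hom D X Y \<Longrightarrow> linear_on (smul D) (smul D) (Hom D Y Z) (\<lambda>g. g \<cdot> f)"

definition is_iso_mor :: "('k, 'o, 'm, 'z) lincat_scheme \<Rightarrow> 'o \<Rightarrow> 'o \<Rightarrow> 'm \<Rightarrow> bool" where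
  "is_iso_mor D X Y f \<longleftrightarrow> f \<in> Hom D X Y \<and>
     (\<exists>g\<in>Hom D Y X. g \<cdot>\<^bsub>D\<^esub> f = ident D X \<and> f \<cdot>\<^bsub>D\<^esub> g = ident D Y)"

definition isomorphic :: "('k, 'o, 'm, 'z) lincat_scheme \<Rightarrow> 'o \<Rightarrow> 'o \<Rightarrow> bool" where
  "isomorphic D X Y \<longleftrightarrow> (\<exists>f. is_iso_mor D X Y f)"

definition is_zero_object :: "('k, 'o, 'm::ab_group_add, 'z) lincat_scheme \<Rightarrow> 'o \<Rightarrow> bool" where
  "is_zero_object D Z \<longleftrightarrow> (\<forall>X. Hom D Z X = {0} \<and> Hom D X Z = {0})"

definition is_biproduct ::
  "('k, 'o, 'm::ab_group_add, 'z) lincat_scheme \<Rightarrow> 'o \<Rightarrow> 'o \<Rightarrow> 'o \<Rightarrow> bool" where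
  "is_biproduct D X Y S \<longleftrightarrow>
     (\<exists>i\<in>Hom D X S. \<exists>j\<in>Hom D Y S. \<exists>p\<in>Hom D S X. \<exists>q\<in>Hom D S Y.
        p \<cdot>\<^bsub>D\<^esub> i = ident D X \<and> q \<cdot>\<^bsub>D\<^esub> j = ident D Y \<and> q \<cdot>\<^bsub>D\<^esub> i = 0 \<and> p \<cdot>\<^bsub>D\<^esub> j = 0 \<and>
        i \<cdot>\<^bsub>D\<^esub> p + j \<cdot>\<^bsub>D\<^esub> q = ident D S)"

definition idempotent_complete :: "('k, 'o, 'm, 'z) lincat_scheme \<Rightarrow> bool" where
  "idempotent_complete D \<longleftrightarrow>
     (\<forall>X. \<forall>e\<in>Hom D X X. e \<cdot>\<^bsub>D\<^esub> e = e \<longrightarrow>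
        (\<exists>Y. \<exists>p\<in>Hom D X Y. \<exists>i\<in>Hom D Y X. p \<cdot>\<^bsub>D\<^esub> i = ident D Y \<and> i \<cdot>\<^bsub>D\<^esub> p = e))"

locale additive_category = linear_category +
  assumes zero_object_exists: "\<exists>Z. is_zero_object D Z"
    and biproduct_exists: "\<exists>S. is_biproduct D X Y S"

definition linear_functor ::
  "('k, 'o, 'm::ab_group_add, 'z) lincat_scheme \<Rightarrow> ('o \<Rightarrow> 'o) \<Rightarrow> ('m \<Rightarrow> 'm) \<Rightarrow> bool" where
  "linear_functor D Fo Fm \<longleftrightarrow>
     (\<forall>X Y. \<forall>f\<in>Hom D X Y. Fm f \<in> Hom D (Fo X) (Fo Y)) \<and>
     (\<forall>X Y. linear_on (smul D) (smul D) (Hom D X Y) Fm) \<and>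
     (\<forall>X. Fm (ident D X) = ident D (Fo X)) \<and>
     (\<forall>X Y Z. \<forall>f\<in>Hom D X Y. \<forall>g\<in>Hom D Y Z. Fm (g \<cdot>\<^bsub>D\<^esub> f) = Fm g \<cdot>\<^bsub>D\<^esub> Fm f)"

definition linear_equivalence ::
  "('k, 'o, 'm::ab_group_add, 'z) lincat_scheme \<Rightarrow> ('o \<Rightarrow> 'o) \<Rightarrow> ('m \<Rightarrow> 'm) \<Rightarrow> bool" where
  "linear_equivalence D Fo Fm \<longleftrightarrow> linear_functor D Fo Fm \<and>
     (\<forall>X Y. bij_betw Fm (Hom D X Y) (Hom D (Fo X) (Fo Y))) \<and>
     (\<forall>Y. \<exists>X. isomorphic D (Fo X) Y)"


section \<open>Triangulated categories\<close>

text \<open>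
  The shift is an automorphism of the category; \<open>sho D n\<close> and \<open>shm D n\<close> are its \<open>n\<close>-th power
  \<open>[n]\<close> on objects and on morphisms.
\<close>

record ('k, 'o, 'm) tricat = "('k, 'o, 'm) lincat" +
  sho :: "int \<Rightarrow> 'o \<Rightarrow> 'o"
  shm :: "int \<Rightarrow> 'm \<Rightarrow> 'm"
  triangle :: "'o \<Rightarrow> 'o \<Rightarrow> 'o \<Rightarrow> 'm \<Rightarrow> 'm \<Rightarrow> 'm \<Rightarrow> bool"
    \<comment> \<open>\<open>triangle D X Y Z f g h\<close>: the triangle \<open>X \<rightarrow> Y \<rightarrow> Z \<rightarrow> X[1]\<close> is exact\<close>

locale triangulated_category =
  additive_category D for D :: "('k::field, 'o, 'm::ab_group_add, 'z) tricat_scheme" (structure) +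
  assumes shift_functor: "linear_functor D (sho D n) (shm D n)"
    and sho_0: "sho D 0 X = X"
    and sho_add: "sho D i (sho D j X) = sho D (i + j) X"
    and shm_0: "f \<in> Hom D X Y \<Longrightarrow> shm D 0 f = f"
    and shm_add: "f \<in> Hom D X Y \<Longrightarrow> shm D i (shm D j f) = shm D (i + j) f"
    and triangle_Hom: "triangle D X Y Z f g h \<Longrightarrow>
      f \<in> Hom D X Y \<and> g \<in> Hom D Y Z \<and> h \<in> Hom D Z (sho D 1 X)"
    and TR1_ident: "is_zero_object D Z \<Longrightarrow> triangle D X X Z (ident D X) 0 0"
    and TR1_iso: "triangle D X Y Z f g h \<Longrightarrow>
      is_iso_mor D X X' a \<Longrightarrow> is_iso_mor D Y Y' b \<Longrightarrow> is_iso_mor D Z Z' c \<Longrightarrow>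
      f' \<in> Hom D X' Y' \<Longrightarrow> g' \<in> Hom D Y' Z' \<Longrightarrow> h' \<in> Hom D Z' (sho D 1 X') \<Longrightarrow>
      f' \<cdot> a = b \<cdot> f \<Longrightarrow> g' \<cdot> b = c \<cdot> g \<Longrightarrow> h' \<cdot> c = shm D 1 a \<cdot> h \<Longrightarrow>
      triangle D X' Y' Z' f' g' h'"
    and TR1_complete: "f \<in> Hom D X Y \<Longrightarrow> \<exists>Z g h. triangle D X Y Z f g h"
    and TR2: "f \<in> Hom D X Y \<Longrightarrow> g \<in> Hom D Y Z \<Longrightarrow> h \<in> Hom D Z (sho D 1 X) \<Longrightarrow>
      triangle D X Y Z f g h \<longleftrightarrow> triangle D Y Z (sho D 1 X) g h (- shm D 1 f)"
    and TR3: "triangle D X Y Z f g h \<Longrightarrow> triangle D X' Y' Z' f' g' h' \<Longrightarrow>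
      a \<in> Hom D X X' \<Longrightarrow> b \<in> Hom D Y Y' \<Longrightarrow> f' \<cdot> a = b \<cdot> f \<Longrightarrow>
      \<exists>c\<in>Hom D Z Z'. g' \<cdot> b = c \<cdot> g \<and> h' \<cdot> c = shm D 1 a \<cdot> h"
    and TR4: "triangle D X Y Z' f a b \<Longrightarrow> triangle D Y Z X' g c d \<Longrightarrow>
      triangle D X Z Y' (g \<cdot> f) e k \<Longrightarrow>
      \<exists>u v. triangle D Z' Y' X' u v (shm D 1 a \<cdot> d) \<and>
        u \<cdot> a = e \<cdot> g \<and> k \<cdot> u = b \<and> v \<cdot> e = c \<and> d \<cdot> v = shm D 1 f \<cdot> k"

definition finite_type :: "('k::field, 'o, 'm::ab_group_add, 'z) tricat_scheme \<Rightarrow> bool" where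
  "finite_type D \<longleftrightarrow> (\<forall>E E'.
     finite {i. Hom D E (sho D i E') \<noteq> {0}} \<and>
     (\<forall>i. \<exists>B. finite B \<and> Hom D E (sho D i E') \<subseteq> module.span (smul D) B))"

definition triangulated_functor ::
  "('k, 'o, 'm::ab_group_add, 'z) tricat_scheme \<Rightarrow> ('o \<Rightarrow> 'o) \<Rightarrow> ('m \<Rightarrow> 'm) \<Rightarrow> bool" where
  "triangulated_functor D Fo Fm \<longleftrightarrow> linear_functor D Fo Fm \<and>
     (\<exists>\<eta>. (\<forall>X. is_iso_mor D (Fo (sho D 1 X)) (sho D 1 (Fo X)) (\<eta> X)) \<and>
          (\<forall>X Y. \<forall>f\<in>Hom D X Y. \<eta> Y \<cdot>\<^bsub>D\<^esub> Fm (shm D 1 f) = shm D 1 (Fm f) \<cdot>\<^bsub>D\<^esub> \<eta> X) \<and>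
          (\<forall>X Y Z f g h. triangle D X Y Z f g h \<longrightarrow>
             triangle D (Fo X) (Fo Y) (Fo Z) (Fm f) (Fm g) (\<eta> X \<cdot>\<^bsub>D\<^esub> Fm h)))"

definition virtually_zero ::
  "('k, 'o, 'm::ab_group_add, 'z) lincat_scheme \<Rightarrow> ('o \<Rightarrow> 'o) \<Rightarrow> bool" where
  "virtually_zero D Fo \<longleftrightarrow> (\<exists>n\<ge>1. \<forall>E. is_zero_object D ((Fo ^^ n) E))"

definition split_generator :: "('k, 'o, 'm::ab_group_add, 'z) tricat_scheme \<Rightarrow> 'o \<Rightarrow> bool" where
  "split_generator D G \<longleftrightarrow>
     (\<forall>E. \<exists>E' m. \<exists>A :: nat \<Rightarrow> 'o. \<exists>n :: nat \<Rightarrow> int.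
        is_zero_object D (A 0) \<and> is_biproduct D E E' (A m) \<and>
        (\<forall>k\<in>{1..m}. \<exists>C f g h. triangle D (A (k - 1)) (A k) C f g h \<and>
           isomorphic D C (sho D (n k) G)))"

text \<open>
  A Serre functor: a linear autoequivalence \<open>S\<close> with isomorphisms of \<open>Hom(X, Y)\<close> with the dual of
  \<open>Hom(Y, S X)\<close> that are natural in \<open>X\<close> and \<open>Y\<close>; \<open>\<kappa> X Y f\<close> is the functional belonging to \<open>f\<close>.
\<close>

definition serre_functor ::
  "('k::field, 'o, 'm::ab_group_add, 'z) lincat_scheme \<Rightarrow> ('o \<Rightarrow> 'o) \<Rightarrow> ('m \<Rightarrow> 'm) \<Rightarrow> bool" where
  "serre_functor D So Sm \<longleftrightarrow> linear_equivalence D So Sm \<and>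
     (\<exists>\<kappa> :: 'o \<Rightarrow> 'o \<Rightarrow> 'm \<Rightarrow> 'm \<Rightarrow> 'k.
        (\<forall>X Y. \<forall>f\<in>Hom D X Y. linear_on (smul D) (*) (Hom D Y (So X)) (\<kappa> X Y f)) \<and>
        (\<forall>X Y. \<forall>g\<in>Hom D Y (So X). linear_on (smul D) (*) (Hom D X Y) (\<lambda>f. \<kappa> X Y f g)) \<and>
        (\<forall>X Y l. linear_on (smul D) (*) (Hom D Y (So X)) l \<longrightarrow>
           (\<exists>!f. f \<in> Hom D X Y \<and> (\<forall>g\<in>Hom D Y (So X). \<kappa> X Y f g = l g))) \<and>
        (\<forall>X X' Y. \<forall>u\<in>Hom D X' X. \<forall>f\<in>Hom D X Y. \<forall>g\<in>Hom D Y (So X').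
           \<kappa> X' Y (f \<cdot>\<^bsub>D\<^esub> u) g = \<kappa> X Y f (Sm u \<cdot>\<^bsub>D\<^esub> g)) \<and>
        (\<forall>X Y Y'. \<forall>v\<in>Hom D Y Y'. \<forall>f\<in>Hom D X Y. \<forall>g\<in>Hom D Y' (So X).
           \<kappa> X Y' (v \<cdot>\<^bsub>D\<^esub> f) g = \<kappa> X Y f (g \<cdot>\<^bsub>D\<^esub> v)))"


section \<open>Saturated triangulated categories\<close>

text \<open>
  Saturated is understood in the sense of Kontsevich--Soibelman and Toen--Vaquie, as in the work of
  Dimitrov--Haiden--Katzarkov--Kontsevich on categorical entropy: the category is idempotent
  complete and has an enhancement by a smooth and proper pretriangulated dg category.
\<close>

subsection \<open>Dg categories\<close>

definition koszul :: "int \<Rightarrow> 'a::ab_group_add \<Rightarrow> 'a" where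
  "koszul i x = (if even i then x else - x)"

record ('k, 'e, 'c) dgcat =
  dsmul :: "'k \<Rightarrow> 'c \<Rightarrow> 'c"
  dHom :: "'e \<Rightarrow> 'e \<Rightarrow> int \<Rightarrow> 'c set"
  ddiff :: "'c \<Rightarrow> 'c"
  dcompose :: "'c \<Rightarrow> 'c \<Rightarrow> 'c" (infixr "\<odot>\<index>" 75)
  dident :: "'e \<Rightarrow> 'c"

locale dg_category =
  fixes C :: "('k::field, 'e, 'c::ab_group_add, 'z) dgcat_scheme" (structure)
  assumes vector_space_dsmul: "vector_space (dsmul C)"
    and subspace_dHom: "module.subspace (dsmul C) (dHom C X Y i)"
    and ddiff_closed: "f \<in> dHom C X Y i \<Longrightarrow> ddiff C f \<in> dHom C X Y (i + 1)"
    and ddiff_linear: "linear_on (dsmul C) (dsmul C) (dHom C X Y i) (ddiff C)"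
    and ddiff_ddiff: "f \<in> dHom C X Y i \<Longrightarrow> ddiff C (ddiff C f) = 0"
    and dcompose_closed:
      "f \<in> dHom C X Y i \<Longrightarrow> g \<in> dHom C Y Z j \<Longrightarrow> g \<odot> f \<in> dHom C X Z (j + i)"
    and dcompose_assoc: "f \<in> dHom C W X i \<Longrightarrow> g \<in> dHom C X Y j \<Longrightarrow> h \<in> dHom C Y Z l \<Longrightarrow>
      h \<odot> (g \<odot> f) = (h \<odot> g) \<odot> f"
    and dident_closed: "dident C X \<in> dHom C X X 0"
    and dident_right: "f \<in> dHom C X Y i \<Longrightarrow> f \<odot> dident C X = f"
    and dident_left: "f \<in> dHom C X Y i \<Longrightarrow> dident C Y \<odot> f = f"
    and dcompose_linear_right:
      "g \<in> dHom C Y Z j \<Longrightarrow> linear_on (dsmul C) (dsmul C) (dHom C X Y i) (\<lambda>f. g \<odot> f)"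
    and dcompose_linear_left:
      "f \<in> dHom C X Y i \<Longrightarrow> linear_on (dsmul C) (dsmul C) (dHom C Y Z j) (\<lambda>g. g \<odot> f)"
    and ddiff_dcompose: "f \<in> dHom C X Y i \<Longrightarrow> g \<in> dHom C Y Z j \<Longrightarrow>
      ddiff C (g \<odot> f) = ddiff C g \<odot> f + koszul j (g \<odot> ddiff C f)"

definition cocycles :: "('k, 'e, 'c::ab_group_add, 'z) dgcat_scheme \<Rightarrow> 'e \<Rightarrow> 'e \<Rightarrow> int \<Rightarrow> 'c set" where
  "cocycles C X Y i = {f \<in> dHom C X Y i. ddiff C f = 0}"

definition coboundaries :: "('k, 'e, 'c, 'z) dgcat_scheme \<Rightarrow> 'e \<Rightarrow> 'e \<Rightarrow> int \<Rightarrow> 'c set" where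
  "coboundaries C X Y i = ddiff C ` dHom C X Y (i - 1)"

text \<open>\<open>dg_shift C X X' s\<close>: the closed invertible element \<open>s\<close> of degree \<open>-1\<close> exhibits \<open>X'\<close> as \<open>X[1]\<close>.\<close>

definition dg_shift ::
  "('k, 'e, 'c::ab_group_add, 'z) dgcat_scheme \<Rightarrow> 'e \<Rightarrow> 'e \<Rightarrow> 'c \<Rightarrow> bool" where
  "dg_shift C X X' s \<longleftrightarrow> s \<in> cocycles C X X' (-1) \<and>
     (\<exists>t\<in>cocycles C X' X 1. t \<odot>\<^bsub>C\<^esub> s = dident C X \<and> s \<odot>\<^bsub>C\<^esub> t = dident C X')"

text \<open>
  \<open>dg_cone C X Y Z f iX iY pX pY\<close>: as a graded object, \<open>Z\<close> is the direct sum of \<open>X[1]\<close> and \<open>Y\<close> with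
  inclusions \<open>iX\<close>, \<open>iY\<close> and projections \<open>pX\<close>, \<open>pY\<close>, and its differential is the one of the cone of
  \<open>f\<close>. Here \<open>iX\<close> and \<open>pX\<close> have degrees \<open>-1\<close> and \<open>1\<close> because \<open>X\<close> appears shifted.
\<close>

definition dg_cone ::
  "('k, 'e, 'c::ab_group_add, 'z) dgcat_scheme \<Rightarrow> 'e \<Rightarrow> 'e \<Rightarrow> 'e \<Rightarrow> 'c \<Rightarrow> 'c \<Rightarrow> 'c \<Rightarrow> 'c \<Rightarrow> 'c \<Rightarrow> bool" where
  "dg_cone C X Y Z f iX iY pX pY \<longleftrightarrow>
     f \<in> cocycles C X Y 0 \<and>
     iX \<in> dHom C X Z (-1) \<and> iY \<in> dHom C Y Z 0 \<and> pX \<in> dHom C Z X 1 \<and> pY \<in> dHom C Z Y 0 \<and>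
     pX \<odot>\<^bsub>C\<^esub> iX = dident C X \<and> pY \<odot>\<^bsub>C\<^esub> iY = dident C Y \<and>
     pY \<odot>\<^bsub>C\<^esub> iX = 0 \<and> pX \<odot>\<^bsub>C\<^esub> iY = 0 \<and>
     iX \<odot>\<^bsub>C\<^esub> pX + iY \<odot>\<^bsub>C\<^esub> pY = dident C Z \<and>
     ddiff C iY = 0 \<and> ddiff C pX = 0 \<and>
     ddiff C iX = iY \<odot>\<^bsub>C\<^esub> f \<and> ddiff C pY = - (f \<odot>\<^bsub>C\<^esub> pX)"

text \<open>
  Shifts and cones exist strictly in the dg category. This is no restriction on the categories that
  admit an enhancement, since the dg category of one-sided twisted complexes has this property.
\<close>

definition pretriangulated :: "('k, 'e, 'c::ab_group_add, 'z) dgcat_scheme \<Rightarrow> bool" where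
  "pretriangulated C \<longleftrightarrow>
     (\<forall>X. \<exists>X' s. dg_shift C X X' s) \<and> (\<forall>X. \<exists>X' s. dg_shift C X' X s) \<and>
     (\<forall>X Y. \<forall>f\<in>cocycles C X Y 0. \<exists>Z iX iY pX pY. dg_cone C X Y Z f iX iY pX pY)"

text \<open>
  \<open>dg_enhancement C D \<Phi>o \<Phi>m\<close>: \<open>C\<close> is pretriangulated and \<open>(\<Phi>o, \<Phi>m)\<close> induces an exact equivalence
  from \<open>H\<^sup>0(C)\<close> to \<open>D\<close>. The map \<open>\<Phi>m\<close> is given on closed morphisms of degree \<open>0\<close>; \<open>\<theta>\<close> is the natural
  isomorphism from \<open>\<Phi>(X[1])\<close> to \<open>\<Phi>(X)[1]\<close>.
\<close>

definition dg_enhancement ::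
  "('k::field, 'e, 'c::ab_group_add, 'y) dgcat_scheme \<Rightarrow>
   ('k, 'o, 'm::ab_group_add, 'z) tricat_scheme \<Rightarrow> ('e \<Rightarrow> 'o) \<Rightarrow> ('c \<Rightarrow> 'm) \<Rightarrow> bool" where
  "dg_enhancement C D \<Phi>o \<Phi>m \<longleftrightarrow> dg_category C \<and> pretriangulated C \<and>
     (\<forall>X Y. linear_on (dsmul C) (smul D) (cocycles C X Y 0) \<Phi>m) \<and>
     (\<forall>X Y. \<Phi>m ` cocycles C X Y 0 = Hom D (\<Phi>o X) (\<Phi>o Y)) \<and>
     (\<forall>X Y. \<forall>f\<in>cocycles C X Y 0. \<Phi>m f = 0 \<longleftrightarrow> f \<in> coboundaries C X Y 0) \<and>
     (\<forall>X. \<Phi>m (dident C X) = ident D (\<Phi>o X)) \<and>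
     (\<forall>X Y Z. \<forall>f\<in>cocycles C X Y 0. \<forall>g\<in>cocycles C Y Z 0. \<Phi>m (g \<odot>\<^bsub>C\<^esub> f) = \<Phi>m g \<cdot>\<^bsub>D\<^esub> \<Phi>m f) \<and>
     (\<forall>E. \<exists>X. isomorphic D (\<Phi>o X) E) \<and>
     (\<exists>\<theta> :: 'e \<Rightarrow> 'e \<Rightarrow> 'c \<Rightarrow> 'm.
        (\<forall>X X' s. dg_shift C X X' s \<longrightarrow> is_iso_mor D (\<Phi>o X') (sho D 1 (\<Phi>o X)) (\<theta> X X' s)) \<and>
        (\<forall>X X' s Y Y' t. dg_shift C X X' s \<longrightarrow> dg_shift C Y Y' t \<longrightarrow>
           (\<forall>f\<in>cocycles C X Y 0. \<forall>f'\<in>cocycles C X' Y' 0. f' \<odot>\<^bsub>C\<^esub> s = t \<odot>\<^bsub>C\<^esub> f \<longrightarrow>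
              \<theta> Y Y' t \<cdot>\<^bsub>D\<^esub> \<Phi>m f' = shm D 1 (\<Phi>m f) \<cdot>\<^bsub>D\<^esub> \<theta> X X' s)) \<and>
        (\<forall>X Y Z f iX iY pX pY X' s. dg_cone C X Y Z f iX iY pX pY \<longrightarrow> dg_shift C X X' s \<longrightarrow>
           triangle D (\<Phi>o X) (\<Phi>o Y) (\<Phi>o Z) (\<Phi>m f) (\<Phi>m iY) (\<theta> X X' s \<cdot>\<^bsub>D\<^esub> \<Phi>m (s \<odot>\<^bsub>C\<^esub> pX))))"

definition dg_proper :: "('k::field, 'e, 'c::ab_group_add, 'z) dgcat_scheme \<Rightarrow> bool" where
  "dg_proper C \<longleftrightarrow> (\<forall>X Y.
     finite {i. cocycles C X Y i \<noteq> coboundaries C X Y i} \<and>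
     (\<forall>i. \<exists>B. finite B \<and> cocycles C X Y i \<subseteq> module.span (dsmul C) (B \<union> coboundaries C X Y i)))"


subsection \<open>Dg bimodules and smoothness\<close>

text \<open>
  In a dg bimodule \<open>M\<close> the complex \<open>bHom M X Y\<close> is contravariant in \<open>X\<close> and covariant in \<open>Y\<close>, like
  the morphism complexes themselves.
\<close>

record ('k, 'e, 'c, 'b) dgbimod =
  bsmul :: "'k \<Rightarrow> 'b \<Rightarrow> 'b"
  bHom :: "'e \<Rightarrow> 'e \<Rightarrow> int \<Rightarrow> 'b set"
  bdiff :: "'b \<Rightarrow> 'b"
  lact :: "'c \<Rightarrow> 'b \<Rightarrow> 'b"
  ract :: "'b \<Rightarrow> 'c \<Rightarrow> 'b"

locale dg_bimodule = dg_category C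
  for C :: "('k::field, 'e, 'c::ab_group_add, 'z) dgcat_scheme" (structure) +
  fixes M :: "('k, 'e, 'c, 'b::ab_group_add, 'y) dgbimod_scheme"
  assumes vector_space_bsmul: "vector_space (bsmul M)"
    and subspace_bHom: "module.subspace (bsmul M) (bHom M X Y i)"
    and bdiff_closed: "m \<in> bHom M X Y i \<Longrightarrow> bdiff M m \<in> bHom M X Y (i + 1)"
    and bdiff_linear: "linear_on (bsmul M) (bsmul M) (bHom M X Y i) (bdiff M)"
    and bdiff_bdiff: "m \<in> bHom M X Y i \<Longrightarrow> bdiff M (bdiff M m) = 0"
    and lact_closed:
      "m \<in> bHom M X Y i \<Longrightarrow> f \<in> dHom C Y Y' j \<Longrightarrow> lact M f m \<in> bHom M X Y' (j + i)"
    and ract_closed: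
      "m \<in> bHom M X Y i \<Longrightarrow> g \<in> dHom C X' X j \<Longrightarrow> ract M m g \<in> bHom M X' Y (i + j)"
    and lact_linear:
      "f \<in> dHom C Y Y' j \<Longrightarrow> linear_on (bsmul M) (bsmul M) (bHom M X Y i) (lact M f)"
    and lact_linear_scalar:
      "m \<in> bHom M X Y i \<Longrightarrow> linear_on (dsmul C) (bsmul M) (dHom C Y Y' j) (\<lambda>f. lact M f m)"
    and ract_linear:
      "g \<in> dHom C X' X j \<Longrightarrow> linear_on (bsmul M) (bsmul M) (bHom M X Y i) (\<lambda>m. ract M m g)"
    and ract_linear_scalar:
      "m \<in> bHom M X Y i \<Longrightarrow> linear_on (dsmul C) (bsmul M) (dHom C X' X j) (ract M m)"
    and lact_dident: "m \<in> bHom M X Y i \<Longrightarrow> lact M (dident C Y) m = m"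
    and ract_dident: "m \<in> bHom M X Y i \<Longrightarrow> ract M m (dident C X) = m"
    and lact_lact: "m \<in> bHom M X Y i \<Longrightarrow> f \<in> dHom C Y Y' j \<Longrightarrow> f' \<in> dHom C Y' Y'' l \<Longrightarrow>
      lact M f' (lact M f m) = lact M (f' \<odot> f) m"
    and ract_ract: "m \<in> bHom M X Y i \<Longrightarrow> g \<in> dHom C X' X j \<Longrightarrow> g' \<in> dHom C X'' X' l \<Longrightarrow>
      ract M (ract M m g) g' = ract M m (g \<odot> g')"
    and lact_ract: "m \<in> bHom M X Y i \<Longrightarrow> f \<in> dHom C Y Y' j \<Longrightarrow> g \<in> dHom C X' X l \<Longrightarrow>
      ract M (lact M f m) g = lact M f (ract M m g)"
    and bdiff_lact: "m \<in> bHom M X Y i \<Longrightarrow> f \<in> dHom C Y Y' j \<Longrightarrow>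
      bdiff M (lact M f m) = lact M (ddiff C f) m + koszul j (lact M f (bdiff M m))"
    and bdiff_ract: "m \<in> bHom M X Y i \<Longrightarrow> g \<in> dHom C X' X j \<Longrightarrow>
      bdiff M (ract M m g) = ract M (bdiff M m) g + koszul i (ract M m (ddiff C g))"

definition diagonal :: "('k, 'e, 'c, 'z) dgcat_scheme \<Rightarrow> ('k, 'e, 'c, 'c) dgbimod" where
  "diagonal C = \<lparr>bsmul = dsmul C, bHom = dHom C, bdiff = ddiff C,
                 lact = dcompose C, ract = dcompose C\<rparr>"

definition bimodule_map ::
  "('k, 'e, 'c, 'z) dgcat_scheme \<Rightarrow> ('k, 'e, 'c, 'a::ab_group_add, 'x) dgbimod_scheme \<Rightarrow>
   ('k, 'e, 'c, 'b::ab_group_add, 'y) dgbimod_scheme \<Rightarrow> ('a \<Rightarrow> 'b) \<Rightarrow> bool" where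
  "bimodule_map C M N \<phi> \<longleftrightarrow>
     (\<forall>X Y i. \<forall>m\<in>bHom M X Y i. \<phi> m \<in> bHom N X Y i \<and> \<phi> (bdiff M m) = bdiff N (\<phi> m)) \<and>
     (\<forall>X Y i. linear_on (bsmul M) (bsmul N) (bHom M X Y i) \<phi>) \<and>
     (\<forall>X Y Y' i j. \<forall>m\<in>bHom M X Y i. \<forall>f\<in>dHom C Y Y' j. \<phi> (lact M f m) = lact N f (\<phi> m)) \<and>
     (\<forall>X X' Y i j. \<forall>m\<in>bHom M X Y i. \<forall>g\<in>dHom C X' X j. \<phi> (ract M m g) = ract N (\<phi> m) g)"

definition bimodule_quasi_iso ::
  "('k, 'e, 'c, 'z) dgcat_scheme \<Rightarrow> ('k, 'e, 'c, 'a::ab_group_add, 'x) dgbimod_scheme \<Rightarrow>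
   ('k, 'e, 'c, 'b::ab_group_add, 'y) dgbimod_scheme \<Rightarrow> ('a \<Rightarrow> 'b) \<Rightarrow> bool" where
  "bimodule_quasi_iso C M N \<phi> \<longleftrightarrow> bimodule_map C M N \<phi> \<and>
     (\<forall>X Y i.
        (\<forall>m\<in>bHom M X Y i. bdiff M m = 0 \<longrightarrow> \<phi> m \<in> bdiff N ` bHom N X Y (i - 1) \<longrightarrow>
           m \<in> bdiff M ` bHom M X Y (i - 1)) \<and>
        (\<forall>n\<in>bHom N X Y i. bdiff N n = 0 \<longrightarrow>
           (\<exists>m\<in>bHom M X Y i. bdiff M m = 0 \<and> n - \<phi> m \<in> bdiff N ` bHom N X Y (i - 1))))"

text \<open>
  A finitely generated semi-free bimodule has generators \<open>w 0, \<dots>, w (r - 1)\<close>, with \<open>w k\<close> of degree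
  \<open>n k\<close> in \<open>bHom P (A k) (B k)\<close>, such that the differential of \<open>w k\<close> lies in the span of the earlier
  generators and such that, forgetting differentials, for all \<open>X\<close> and \<open>Y\<close> the map from the direct
  sum over \<open>k\<close> of \<open>dHom C (B k) Y \<otimes> dHom C X (A k)\<close> to \<open>bHom P X Y\<close> that sends \<open>f \<otimes> g\<close> in the
  \<open>k\<close>-th summand to \<open>f (w k) g\<close> is bijective. Every element of a tensor product \<open>V \<otimes> W\<close> is a sum of
  \<open>t \<otimes> \<gamma> t\<close> over a finite independent set of vectors \<open>t\<close> in \<open>V\<close>, and it vanishes only if all
  \<open>\<gamma> t\<close> do; the last clause is injectivity in this form.
\<close>

definition generated_by ::
  "('k, 'e, 'c, 'z) dgcat_scheme \<Rightarrow> ('k, 'e, 'c, 'b, 'y) dgbimod_scheme \<Rightarrow> (nat \<Rightarrow> 'e) \<Rightarrow>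
   (nat \<Rightarrow> 'e) \<Rightarrow> (nat \<Rightarrow> int) \<Rightarrow> (nat \<Rightarrow> 'b) \<Rightarrow> nat \<Rightarrow> 'e \<Rightarrow> 'e \<Rightarrow> int \<Rightarrow> 'b set" where
  "generated_by C P A B n w r X Y m =
     {lact P f (ract P (w k) g) | k f g i j.
        k < r \<and> f \<in> dHom C (B k) Y i \<and> g \<in> dHom C X (A k) j \<and> i + n k + j = m}"

definition fg_semifree ::
  "('k::field, 'e, 'c::ab_group_add, 'z) dgcat_scheme \<Rightarrow>
   ('k, 'e, 'c, 'b::ab_group_add, 'y) dgbimod_scheme \<Rightarrow> bool" where
  "fg_semifree C P \<longleftrightarrow> dg_bimodule C P \<and>
     (\<exists>r A B n w.
        (\<forall>k<r. w k \<in> bHom P (A k) (B k) (n k)) \<and>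
        (\<forall>k<r. bdiff P (w k) \<in>
           module.span (bsmul P) (generated_by C P A B n w k (A k) (B k) (n k + 1))) \<and>
        (\<forall>X Y m. bHom P X Y m \<subseteq> module.span (bsmul P) (generated_by C P A B n w r X Y m)) \<and>
        (\<forall>X Y m J T \<gamma>.
           finite J \<longrightarrow>
           (\<forall>k<r. \<forall>j\<in>J. finite (T k j) \<and> T k j \<subseteq> dHom C (B k) Y j \<and>
              \<not> module.dependent (dsmul C) (T k j)) \<longrightarrow>
           (\<forall>k<r. \<forall>j\<in>J. \<forall>t\<in>T k j. \<gamma> k j t \<in> dHom C X (A k) (m - n k - j)) \<longrightarrow>
           (\<Sum>k<r. \<Sum>j\<in>J. \<Sum>t\<in>T k j. lact P t (ract P (w k) (\<gamma> k j t))) = 0 \<longrightarrow>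
           (\<forall>k<r. \<forall>j\<in>J. \<forall>t\<in>T k j. \<gamma> k j t = 0)))"

text \<open>
  Smoothness: the diagonal bimodule is perfect, i.e. a direct summand, in the derived category of
  bimodules, of a finitely generated semi-free bimodule \<open>P\<close>. A morphism from the diagonal to \<open>P\<close> in
  the derived category is a roof whose left leg is a quasi-isomorphism from some \<open>R\<close>, and a left
  inverse can be taken to be an honest map since \<open>P\<close> is semi-free. The type argument is the type of
  the elements of \<open>P\<close> and \<open>R\<close>.
\<close>

definition dg_smooth ::
  "'b::ab_group_add itself \<Rightarrow> ('k::field, 'e, 'c::ab_group_add, 'z) dgcat_scheme \<Rightarrow> bool" where
  "dg_smooth _ C \<longleftrightarrow>
     (\<exists>(P :: ('k, 'e, 'c, 'b) dgbimod) (R :: ('k, 'e, 'c, 'b) dgbimod) s p.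
        fg_semifree C P \<and> dg_bimodule C R \<and>
        bimodule_map C R P s \<and> bimodule_map C P (diagonal C) p \<and>
        bimodule_quasi_iso C R (diagonal C) (p \<circ> s))"

text \<open>
  The type arguments are the types in which the enhancement and the bimodules witnessing smoothness
  are sought; as the types in an assumption are arbitrary, they impose no restriction.
\<close>

definition saturated ::
  "'e itself \<Rightarrow> 'c::ab_group_add itself \<Rightarrow> 'b::ab_group_add itself \<Rightarrow>
   ('k::field, 'o, 'm::ab_group_add, 'z) tricat_scheme \<Rightarrow> bool" where
  "saturated _ _ _ D \<longleftrightarrow> idempotent_complete D \<and>
     (\<exists>(C :: ('k, 'e, 'c) dgcat) \<Phi>o \<Phi>m.
        dg_enhancement C D \<Phi>o \<Phi>m \<and> dg_proper C \<and> dg_smooth TYPE('b) C)"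


section \<open>Shifting numbers\<close>

definition eps_upper :: "('k, 'o, 'm::ab_group_add, 'z) tricat_scheme \<Rightarrow> 'o \<Rightarrow> 'o \<Rightarrow> int" where
  "eps_upper D E1 E2 = Max {k. Hom D E1 (sho D (- k) E2) \<noteq> {0}}"

definition eps_lower :: "('k, 'o, 'm::ab_group_add, 'z) tricat_scheme \<Rightarrow> 'o \<Rightarrow> 'o \<Rightarrow> int" where
  "eps_lower D E1 E2 = Min {k. Hom D E1 (sho D (- k) E2) \<noteq> {0}}"

text \<open>The shifting numbers: the common value of the limits for all split generators \<open>G\<close>.\<close>

definition upper_shifting_number ::
  "('k, 'o, 'm::ab_group_add, 'z) tricat_scheme \<Rightarrow> ('o \<Rightarrow> 'o) \<Rightarrow> real" where
  "upper_shifting_number D Fo = (THE t. \<forall>G. split_generator D G \<longrightarrow>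
     (\<lambda>n. real_of_int (eps_upper D G ((Fo ^^ n) G)) / real n) \<longlonglongrightarrow> t)"

definition lower_shifting_number ::
  "('k, 'o, 'm::ab_group_add, 'z) tricat_scheme \<Rightarrow> ('o \<Rightarrow> 'o) \<Rightarrow> real" where
  "lower_shifting_number D Fo = (THE t. \<forall>G. split_generator D G \<longrightarrow>
     (\<lambda>n. real_of_int (eps_lower D G ((Fo ^^ n) G)) / real n) \<longlonglongrightarrow> t)"


section \<open>Grothendieck group and stability conditions\<close>

definition K0_relations :: "('k, 'o, 'm, 'z) tricat_scheme \<Rightarrow> ('o \<Rightarrow>\<^sub>0 int) set" where
  "K0_relations D = generate (free_Abelian_group UNIV)
     {frag_of Y - frag_of X - frag_of Z | X Y Z. \<exists>f g h. triangle D X Y Z f g h}"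

definition K0 :: "('k, 'o, 'm, 'z) tricat_scheme \<Rightarrow> ('o \<Rightarrow>\<^sub>0 int) set monoid" where
  "K0 D = free_Abelian_group UNIV Mod K0_relations D"

definition K0_class :: "('k, 'o, 'm, 'z) tricat_scheme \<Rightarrow> 'o \<Rightarrow> ('o \<Rightarrow>\<^sub>0 int) set" where
  "K0_class D E = K0_relations D #>\<^bsub>free_Abelian_group UNIV\<^esub> frag_of E"

text \<open>
  For \<open>\<Gamma>\<close> free of rank \<open>r\<close>, a basis of \<open>\<Gamma>\<close> identifies \<open>\<Gamma> \<otimes> \<real>\<close> with the real vectors indexed by
  \<open>{..<r}\<close>, here the functions on \<open>nat\<close> vanishing outside \<open>{..<r}\<close>; a basis is given as an
  isomorphism with the free abelian group on \<open>{..<r}\<close>.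
\<close>

definition real_vectors :: "nat \<Rightarrow> (nat \<Rightarrow> real) set" where
  "real_vectors r = {v. \<forall>i\<ge>r. v i = 0}"

definition norm_on :: "nat \<Rightarrow> ((nat \<Rightarrow> real) \<Rightarrow> real) \<Rightarrow> bool" where
  "norm_on r N \<longleftrightarrow>
     (\<forall>v\<in>real_vectors r. 0 \<le> N v \<and> (N v = 0 \<longleftrightarrow> v = (\<lambda>_. 0))) \<and>
     (\<forall>v\<in>real_vectors r. \<forall>c. N (\<lambda>i. c * v i) = \<bar>c\<bar> * N v) \<and>
     (\<forall>v\<in>real_vectors r. \<forall>w\<in>real_vectors r. N (\<lambda>i. v i + w i) \<le> N v + N w)"

definition to_real_vector :: "('g \<Rightarrow> nat \<Rightarrow>\<^sub>0 int) \<Rightarrow> 'g \<Rightarrow> nat \<Rightarrow> real" where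
  "to_real_vector b x = (\<lambda>i. real_of_int (Poly_Mapping.lookup (b x) i))"

definition free_of_finite_rank :: "'g monoid \<Rightarrow> bool" where
  "free_of_finite_rank \<Gamma> \<longleftrightarrow> comm_group \<Gamma> \<and> (\<exists>r::nat. \<Gamma> \<cong> free_Abelian_group {..<r})"

record ('g, 'o) stability =
  charge :: "'g \<Rightarrow> complex"
  slice :: "real \<Rightarrow> 'o set"

definition central_charge ::
  "('k, 'o, 'm, 'z) tricat_scheme \<Rightarrow> (('o \<Rightarrow>\<^sub>0 int) set \<Rightarrow> 'g) \<Rightarrow> ('g, 'o) stability \<Rightarrow> 'o \<Rightarrow> complex"
  where "central_charge D cl \<sigma> E = charge \<sigma> (cl (K0_class D E))"

definition HN_filtration ::
  "('k, 'o, 'm::ab_group_add, 'z) tricat_scheme \<Rightarrow> ('g, 'o) stability \<Rightarrow> 'o \<Rightarrow> nat \<Rightarrow>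
   (nat \<Rightarrow> 'o) \<Rightarrow> (nat \<Rightarrow> 'o) \<Rightarrow> (nat \<Rightarrow> real) \<Rightarrow> bool" where
  "HN_filtration D \<sigma> E n Es A \<phi> \<longleftrightarrow> 1 \<le> n \<and> is_zero_object D (Es 0) \<and> Es n = E \<and>
     (\<forall>i\<in>{1..n}. (\<exists>f g h. triangle D (Es (i - 1)) (Es i) (A i) f g h) \<and>
        \<not> is_zero_object D (A i) \<and> A i \<in> slice \<sigma> (\<phi> i)) \<and>
     (\<forall>i\<in>{1..<n}. \<phi> i > \<phi> (i + 1))"

text \<open>The slices need not be closed under isomorphism.\<close>

locale stability_condition = triangulated_category D
  for D :: "('k::field, 'o, 'm::ab_group_add, 'z) tricat_scheme" (structure) +
  fixes \<Gamma> :: "'g monoid" and cl :: "('o \<Rightarrow>\<^sub>0 int) set \<Rightarrow> 'g" and \<sigma> :: "('g, 'o) stability"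
  assumes charge_additive: "x \<in> carrier \<Gamma> \<Longrightarrow> y \<in> carrier \<Gamma> \<Longrightarrow>
      charge \<sigma> (x \<otimes>\<^bsub>\<Gamma>\<^esub> y) = charge \<sigma> x + charge \<sigma> y"
    and slice_zero: "\<exists>Z\<in>slice \<sigma> \<phi>. is_zero_object D Z"
    and slice_biproduct:
      "X \<in> slice \<sigma> \<phi> \<Longrightarrow> Y \<in> slice \<sigma> \<phi> \<Longrightarrow> \<exists>S\<in>slice \<sigma> \<phi>. is_biproduct D X Y S"
    and slice_charge: "E \<in> slice \<sigma> \<phi> \<Longrightarrow> \<not> is_zero_object D E \<Longrightarrow>
      \<exists>m>0. central_charge D cl \<sigma> E = complex_of_real m * cis (pi * \<phi>)"
    and slice_shift: "slice \<sigma> (\<phi> + 1) = sho D 1 ` slice \<sigma> \<phi>"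
    and slice_Hom: "E1 \<in> slice \<sigma> \<phi>1 \<Longrightarrow> E2 \<in> slice \<sigma> \<phi>2 \<Longrightarrow> \<phi>1 > \<phi>2 \<Longrightarrow> Hom D E1 E2 = {0}"
    and HN_filtration_exists:
      "\<not> is_zero_object D E \<Longrightarrow> \<exists>n Es A \<phi>. HN_filtration D \<sigma> E n Es A \<phi>"
    and support_property: "\<exists>r b N c. b \<in> iso \<Gamma> (free_Abelian_group {..<r::nat}) \<and> norm_on r N \<and> c > 0 \<and>
      (\<forall>\<phi>. \<forall>E\<in>slice \<sigma> \<phi>. \<not> is_zero_object D E \<longrightarrow>
         N (to_real_vector b (cl (K0_class D E))) \<le> c * cmod (central_charge D cl \<sigma> E))"

text \<open>The Harder--Narasimhan phases of a nonzero object do not depend on the filtration.\<close>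

definition phi_plus ::
  "('k, 'o, 'm::ab_group_add, 'z) tricat_scheme \<Rightarrow> ('g, 'o) stability \<Rightarrow> 'o \<Rightarrow> real" where
  "phi_plus D \<sigma> E = (THE x. \<exists>n Es A \<phi>. HN_filtration D \<sigma> E n Es A \<phi> \<and> x = \<phi> 1)"

definition phi_minus ::
  "('k, 'o, 'm::ab_group_add, 'z) tricat_scheme \<Rightarrow> ('g, 'o) stability \<Rightarrow> 'o \<Rightarrow> real" where
  "phi_minus D \<sigma> E = (THE x. \<exists>n Es A \<phi>. HN_filtration D \<sigma> E n Es A \<phi> \<and> x = \<phi> n)"

end

(*
  Smoothness of a dg enhancement C presents the diagonal bimodule as a retract of a semifree
  bimodule P with finitely many generators w_1, ..., w_r. A closed morphism of degree 0 that induces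
  zero on the cohomology of all C(B_k, -) is null-homotopic on each of these complexes, hence its
  action on cocycles of P lowers the filtration by the generators. A composite of r such morphisms
  is therefore zero, and consequently so is any composite of N maps that are zero on all
  Hom(G[j], -), for some N depending only on the split generator G.

  Attaching cells G[j] kills Hom(G[j], E) for all j at once, and iterating this N times gives a zero
  map out of E which is a composite of maps with fibres G[j], with j at most a constant outside of the
  interval from eps^-(G, E) to eps^+(G, E). Hence a nonzero map into F^n E comes from a nonzero map
  into some F^n G[j], and a nonzero map out of E restricts to a nonzero map out of some G[j].
  This shows that eps^+(G, F^n G) is subadditive and eps^-(G, F^n G) superadditive up to a constant,
  so that Fekete's lemma yields the limits, and that the phases phi^+ and phi^- differ from eps^+ and
  eps^- by bounded amounts, where the upper bound of phi^- uses Serre duality.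
*)
theory Submission
  imports Defs
begin


section \<open>Linear maps on subspaces\<close>

text \<open>For a single object E, a split generator alone bounds the number of ghosts whose
  composite vanishes on all maps out of E. But that bound is the length of a construction of E, and
  for E = F^n G it may grow with n; smoothness makes it uniform, and only then do the errors in the
  estimates stay bounded in n. A morphism \<phi> is recovered, up to coboundaries, from its action
  on a cocycle of P that lifts the identity, so pushing this cocycle out of the filtration kills
  \<phi>. The homotopies on the complexes C(B_k, -) ignore the differentials of the generators, so
  on P they are homotopies only modulo earlier generators: this costs one ghost per generator. The
  map that they induce on P is kept as a relation until freeness shows it to be single valued. Serre
  duality answers an asymmetry: a map G[k] -> E bounds phi^+(E) from below, whereas bounding
  phi^-(E) from above takes a map out of E. Fekete's lemma also needs linear bounds on the other
  side; eps^+ and eps^- provide them for each other.\<close>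

lemma linear_onD:
  assumes "linear_on s t V f"
  shows "x \<in> V \<Longrightarrow> y \<in> V \<Longrightarrow> f (x + y) = f x + f y"
    and "x \<in> V \<Longrightarrow> f (s c x) = t c (f x)"
  using assms unfolding linear_on_def by auto

lemma linear_on_zero:
  assumes "linear_on s t V f" "0 \<in> V"
  shows "f 0 = 0"
  using linear_onD(1)[OF assms(1,2,2)] by simp

lemma linear_on_minus:
  assumes "linear_on s t V f" "vector_space s" "module.subspace s V" "x \<in> V"
  shows "f (- x) = - f x"
proof -
  interpret s: vector_space s by fact
  have "f x + f (- x) = f (x + - x)"
    using assms by (intro linear_onD(1)[symmetric]) (auto intro: s.subspace_neg)
  also have "\<dots> = 0" using assms by (auto intro: linear_on_zero s.subspace_0)
  finally show ?thesis by (simp add: eq_neg_iff_add_eq_0 add.commute)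
qed

lemma linear_on_diff:
  assumes "linear_on s t V f" "vector_space s" "module.subspace s V" "x \<in> V" "y \<in> V"
  shows "f (x - y) = f x - f y"
proof -
  interpret s: vector_space s by fact
  have "f (x + - y) = f x + f (- y)"
    using assms by (intro linear_onD(1)) (auto intro: s.subspace_neg)
  then show ?thesis using linear_on_minus[OF assms(1-3,5)] by simp
qed

lemma linear_on_sum:
  assumes "linear_on s t V f" "vector_space s" "module.subspace s V" "\<And>i. i \<in> I \<Longrightarrow> x i \<in> V"
  shows "f (\<Sum>i\<in>I. x i) = (\<Sum>i\<in>I. f (x i))"
  using assms(4)
proof (induction I rule: infinite_finite_induct)
  interpret s: vector_space s by fact
  case (insert i I)
  then show ?case
    using linear_onD(1)[OF assms(1), of "x i" "sum x I"] s.subspace_sum[OF assms(3), of I x] by simp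
next
  interpret s: vector_space s by fact
  case empty
  then show ?case using linear_on_zero[OF assms(1)] s.subspace_0[OF assms(3)] by simp
next
  interpret s: vector_space s by fact
  case (infinite I)
  then show ?case using linear_on_zero[OF assms(1)] s.subspace_0[OF assms(3)] by simp
qed

text \<open>The structures ask for linearity only on Hom spaces, which are subspaces of an ambient
  space. Extending from a basis of \<open>V\<close> yields globally linear maps, to which the
  library applies.\<close>

lemma linear_on_extend:
  assumes "vector_space s" "vector_space t" "module.subspace s V" "linear_on s t V f"
  obtains g where "Vector_Spaces.linear s t g" "\<And>v. v \<in> V \<Longrightarrow> g v = f v"
proof -
  interpret vector_space_pair s t
    using assms(1,2) by (simp add: vector_space_pair_def)
  obtain B where B: "B \<subseteq> V" "\<not> module.dependent s B" "V \<subseteq> module.span s B"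
    using vs1.maximal_independent_subset[of V] by metis
  obtain g where g: "Vector_Spaces.linear s t g" "\<forall>x\<in>B. g x = f x"
    using linear_independent_extend[OF B(2)] by metis
  interpret g: Vector_Spaces.linear s t g by (rule g(1))
  have "v \<in> V \<and> g v = f v" if "v \<in> vs1.span B" for v
    using that
  proof (induction rule: vs1.span_induct_alt)
    case base
    then show ?case
      using vs1.subspace_0[OF assms(3)] linear_on_zero[OF assms(4)] g.zero by simp
  next
    case (step c x y)
    then have "x \<in> V" "s c x \<in> V" using B(1) vs1.subspace_scale[OF assms(3)] by auto
    then show ?case
      using step g(2) linear_onD[OF assms(4)] vs1.subspace_add[OF assms(3)] g.add g.scale by simp
  qed
  then show ?thesis using that g(1) B(3) by blast
qed

text \<open>Over a field every linear map splits over its image. The section takes values in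
  \<open>V\<close> even off the image, which spares side conditions; for the identity on a subspace
  it is a projection onto that subspace.\<close>

lemma linear_on_right_inverse:
  assumes "vector_space s" "vector_space t" "module.subspace s V" "linear_on s t V f"
  obtains g where "Vector_Spaces.linear t s g" "\<And>v. g v \<in> V" "\<And>v. v \<in> f ` V \<Longrightarrow> f (g v) = v"
proof -
  obtain f' where f': "Vector_Spaces.linear s t f'" "\<And>v. v \<in> V \<Longrightarrow> f' v = f v"
    using linear_on_extend[OF assms] by blast
  interpret vector_space_pair s t
    using assms(1,2) by (simp add: vector_space_pair_def)
  obtain g where g: "Vector_Spaces.linear t s g" "range g \<subseteq> V" "\<forall>v\<in>f' ` V. f' (g v) = v"
    using linear_exists_right_inverse_on[OF f'(1) assms(3)] by auto
  moreover have "f' ` V = f ` V" using f'(2) by auto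
  ultimately show ?thesis using that[of g] f'(2) by (metis range_subsetD)
qed

section \<open>Null-homotopies of complexes over a field\<close>

context dg_category
begin

sublocale dg: vector_space "dsmul C"
  by (rule vector_space_dsmul)

lemma dHom_zero [simp]: "0 \<in> dHom C X Y i"
  by (rule dg.subspace_0[OF subspace_dHom])

lemma dHom_add: "f \<in> dHom C X Y i \<Longrightarrow> g \<in> dHom C X Y i \<Longrightarrow> f + g \<in> dHom C X Y i"
  by (rule dg.subspace_add[OF subspace_dHom])

lemma dHom_diff: "f \<in> dHom C X Y i \<Longrightarrow> g \<in> dHom C X Y i \<Longrightarrow> f - g \<in> dHom C X Y i"
  by (rule dg.subspace_diff[OF subspace_dHom])

lemma dHom_scale: "f \<in> dHom C X Y i \<Longrightarrow> dsmul C c f \<in> dHom C X Y i"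
  by (rule dg.subspace_scale[OF subspace_dHom])

lemma ddiff_zero [simp]: "ddiff C 0 = 0"
  using linear_on_zero[OF ddiff_linear] dHom_zero by blast

lemma ddiff_dcompose_closed_left:
  assumes "f \<in> dHom C X Y i" "g \<in> dHom C Y Z 0" "ddiff C g = 0"
  shows "ddiff C (g \<odot> f) = g \<odot> ddiff C f"
proof -
  have "0 \<odot> f = 0" using linear_on_zero[OF dcompose_linear_left[OF assms(1)]] dHom_zero by blast
  then show ?thesis using ddiff_dcompose[OF assms(1,2)] assms(3) by (simp add: koszul_def)
qed

text \<open>
  In terms of linear sections \<open>s\<close>, \<open>s'\<close> of the differentials, a projection \<open>\<beta>\<close> onto the coboundaries
  and \<open>z = u - s (d u)\<close>, the homotopy is \<open>u \<mapsto> s' (\<phi> (z - \<beta> z)) + \<phi> (s (\<beta> z))\<close>.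
\<close>

lemma null_homotopy:
  assumes "\<phi> \<in> dHom C Y Y' 0" "ddiff C \<phi> = 0"
    and van: "\<And>j b. b \<in> cocycles C B Y j \<Longrightarrow> \<phi> \<odot> b \<in> coboundaries C B Y' j"
  obtains h where "\<And>j. Vector_Spaces.linear (dsmul C) (dsmul C) (h j)"
    and "\<And>j u. u \<in> dHom C B Y j \<Longrightarrow> h j u \<in> dHom C B Y' (j - 1)"
    and "\<And>j u. u \<in> dHom C B Y j \<Longrightarrow> \<phi> \<odot> u = ddiff C (h j u) + h (j + 1) (ddiff C u)"
proof -
  note ext = linear_on_extend[OF vector_space_dsmul vector_space_dsmul subspace_dHom]
  note rinv = linear_on_right_inverse[OF vector_space_dsmul vector_space_dsmul subspace_dHom ddiff_linear]
  let ?lin = "Vector_Spaces.linear (dsmul C) (dsmul C)"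
  \<comment> \<open>\<open>s\<close> and \<open>s'\<close> split the differentials of the complexes
    of maps from \<open>B\<close> to \<open>Y\<close> and to \<open>Y'\<close>;
    \<open>\<delta>\<close> and \<open>p\<close> extend the differential and composition with
    \<open>\<phi>\<close> to the ambient space, so that \<open>h\<close> becomes globally
    linear.\<close>
  have "\<exists>s. \<forall>j. ?lin (s j) \<and> (\<forall>v. s j v \<in> dHom C B Y j) \<and>
      (\<forall>v\<in>ddiff C ` dHom C B Y j. ddiff C (s j v) = v)"
    by (intro choice allI, rule rinv) blast
  then obtain s where s: "\<And>j. ?lin (s j)" "\<And>j v. s j v \<in> dHom C B Y j"
      "\<And>j v. v \<in> ddiff C ` dHom C B Y j \<Longrightarrow> ddiff C (s j v) = v" by metis
  have "\<exists>s. \<forall>j. ?lin (s j) \<and> (\<forall>v. s j v \<in> dHom C B Y' j) \<and>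
      (\<forall>v\<in>ddiff C ` dHom C B Y' j. ddiff C (s j v) = v)"
    by (intro choice allI, rule rinv) blast
  then obtain s' where s': "\<And>j. ?lin (s' j)" "\<And>j v. s' j v \<in> dHom C B Y' j"
      "\<And>j v. v \<in> ddiff C ` dHom C B Y' j \<Longrightarrow> ddiff C (s' j v) = v" by metis
  have "\<exists>\<delta>. \<forall>j. ?lin (\<delta> j) \<and> (\<forall>v\<in>dHom C B Y j. \<delta> j v = ddiff C v)"
    by (intro choice allI, rule ext[OF ddiff_linear]) blast
  then obtain \<delta> where \<delta>: "\<And>j. ?lin (\<delta> j)" "\<And>j v. v \<in> dHom C B Y j \<Longrightarrow> \<delta> j v = ddiff C v"
    by metis
  have "\<exists>p. \<forall>j. ?lin (p j) \<and> (\<forall>v\<in>dHom C B Y j. p j v = \<phi> \<odot> v)"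
    by (intro choice allI, rule ext[OF dcompose_linear_right[OF assms(1)]]) blast
  then obtain p where p: "\<And>j. ?lin (p j)" "\<And>j v. v \<in> dHom C B Y j \<Longrightarrow> p j v = \<phi> \<odot> v"
    by metis
  have sub: "dg.subspace (ddiff C ` dHom C B Y j)" for j
  proof -
    interpret \<delta>: Vector_Spaces.linear "dsmul C" "dsmul C" "\<delta> j" by (rule \<delta>)
    have "ddiff C ` dHom C B Y j = \<delta> j ` dHom C B Y j" using \<delta>(2) by (simp cong: image_cong)
    then show ?thesis using \<delta>.subspace_image[OF subspace_dHom] by simp
  qed
  have "\<exists>\<beta>. \<forall>j. ?lin (\<beta> j) \<and> (\<forall>v. \<beta> j v \<in> ddiff C ` dHom C B Y (j - 1)) \<and>
      (\<forall>v\<in>ddiff C ` dHom C B Y (j - 1). \<beta> j v = v)"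
  proof (intro choice allI)
    fix j
    have "linear_on (dsmul C) (dsmul C) (ddiff C ` dHom C B Y (j - 1)) (\<lambda>x. x)"
      by (simp add: linear_on_def)
    then show "\<exists>\<beta>. ?lin \<beta> \<and> (\<forall>v. \<beta> v \<in> ddiff C ` dHom C B Y (j - 1)) \<and>
      (\<forall>v\<in>ddiff C ` dHom C B Y (j - 1). \<beta> v = v)"
      by (rule linear_on_right_inverse[OF vector_space_dsmul vector_space_dsmul sub])
        (unfold image_ident, blast)
  qed
  then obtain \<beta> where \<beta>: "\<And>j. ?lin (\<beta> j)" "\<And>j v. \<beta> j v \<in> ddiff C ` dHom C B Y (j - 1)"
      "\<And>j v. v \<in> ddiff C ` dHom C B Y (j - 1) \<Longrightarrow> \<beta> j v = v" by metis
  define z where "z j u = u - s j (\<delta> j u)" for j u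
  define h where "h j u = s' (j - 1) (p j (z j u - \<beta> j (z j u))) + p (j - 1) (s (j - 1) (\<beta> j (z j u)))"
    for j u
  have pair: "vector_space_pair (dsmul C) (dsmul C)"
    by (simp add: vector_space_pair_def vector_space_dsmul)
  note lsub = vector_space_pair.linear_compose_sub[OF pair]
  have z_lin: "?lin (z j)" for j
    using lsub[OF dg.linear_ident Vector_Spaces.linear_compose[OF \<delta>(1) s(1)]]
    by (simp add: z_def[abs_def] o_def)
  have "?lin (h j)" for j
  proof -
    have "?lin (\<lambda>u. z j u - \<beta> j (z j u))"
      using lsub[OF z_lin Vector_Spaces.linear_compose[OF z_lin \<beta>(1)]] by (simp add: o_def)
    from Vector_Spaces.linear_compose[OF Vector_Spaces.linear_compose[OF this p(1)] s'(1)]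
      Vector_Spaces.linear_compose[OF Vector_Spaces.linear_compose[OF Vector_Spaces.linear_compose[OF z_lin \<beta>(1)] s(1)] p(1)]
    have "?lin (\<lambda>u. s' (j - 1) (p j (z j u - \<beta> j (z j u))))"
      "?lin (\<lambda>u. p (j - 1) (s (j - 1) (\<beta> j (z j u))))"
      by (simp_all add: o_def)
    from vector_space_pair.linear_compose_add[OF pair this] show ?thesis
      unfolding h_def .
  qed
  moreover have h_mem: "h j u \<in> dHom C B Y' (j - 1)" if "u \<in> dHom C B Y j" for j u
    unfolding h_def using s'(2) s(2) p(2) dcompose_closed[OF s(2) assms(1)] by (auto intro: dHom_add)
  moreover have "\<phi> \<odot> u = ddiff C (h j u) + h (j + 1) (ddiff C u)" if u: "u \<in> dHom C B Y j" for j u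
  proof -
    let ?z = "z j u"
    let ?w = "?z - \<beta> j ?z"
    have du: "ddiff C u \<in> dHom C B Y (j + 1)" by (rule ddiff_closed[OF u])
    have z_eq: "?z = u - s j (ddiff C u)" by (simp add: z_def \<delta>(2)[OF u])
    have z_mem: "?z \<in> dHom C B Y j" unfolding z_eq by (intro dHom_diff u s(2))
    have z_closed: "ddiff C ?z = 0"
      unfolding z_eq using linear_on_diff[OF ddiff_linear vector_space_dsmul subspace_dHom u s(2)] s(3) u
      by auto
    obtain e where e: "e \<in> dHom C B Y (j - 1)" "\<beta> j ?z = ddiff C e" using \<beta>(2) by auto
    have b_mem: "\<beta> j ?z \<in> dHom C B Y j" using ddiff_closed[OF e(1)] e(2) by simp
    have b_closed: "ddiff C (\<beta> j ?z) = 0" using ddiff_ddiff[OF e(1)] e(2) by simp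
    \<comment> \<open>The two parts of the cocycle \<open>?z\<close> are contracted differently:
      \<open>\<phi> \<odot> ?w\<close> is a coboundary by hypothesis and is lifted by
      \<open>s'\<close>, while \<open>\<beta> j ?z\<close> is a coboundary before
      \<open>\<phi>\<close> is applied and is lifted by \<open>s\<close>.\<close>
    have w: "?w \<in> cocycles C B Y j"
      using z_mem b_mem z_closed b_closed linear_on_diff[OF ddiff_linear vector_space_dsmul subspace_dHom z_mem b_mem]
      by (auto simp: cocycles_def intro: dHom_diff)
    then have w_mem: "?w \<in> dHom C B Y j" by (simp add: cocycles_def)
    have dw: "ddiff C (s' (j - 1) (p j ?w)) = \<phi> \<odot> ?w"
      using s'(3) van[OF w] p(2)[OF w_mem] by (simp add: coboundaries_def)
    have "ddiff C (p (j - 1) (s (j - 1) (\<beta> j ?z))) = \<phi> \<odot> ddiff C (s (j - 1) (\<beta> j ?z))"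
      using p(2)[OF s(2)] ddiff_dcompose_closed_left[OF s(2) assms(1,2)] by simp
    also have "\<dots> = \<phi> \<odot> \<beta> j ?z" using s(3) \<beta>(2) by auto
    finally have db: "ddiff C (p (j - 1) (s (j - 1) (\<beta> j ?z))) = \<phi> \<odot> \<beta> j ?z" .
    have "ddiff C (h j u) = \<phi> \<odot> ?w + \<phi> \<odot> \<beta> j ?z"
      unfolding h_def dw[symmetric] db[symmetric]
      by (rule linear_onD(1)[OF ddiff_linear[of B Y' "j - 1"]])
        (use s'(2) p(2) s(2) dcompose_closed[OF s(2) assms(1)] in auto)
    also have "\<dots> = \<phi> \<odot> ?z"
      using linear_onD(1)[OF dcompose_linear_right[OF assms(1)] w_mem b_mem] by simp
    finally have 1: "ddiff C (h j u) = \<phi> \<odot> ?z" .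
    \<comment> \<open>On a coboundary both \<open>z\<close> and \<open>\<beta>\<close> act as the
      identity, so only the second summand of \<open>h\<close> survives. It returns the part
      \<open>s j (ddiff C u)\<close> of \<open>u\<close> that \<open>z\<close> discards.\<close>
    have 2: "z (j + 1) (ddiff C u) = ddiff C u"
      using \<delta>(2)[OF du] ddiff_ddiff[OF u] vector_space_pair.linear_0[OF pair s(1)]
      by (simp add: z_def)
    have 3: "\<beta> (j + 1) (ddiff C u) = ddiff C u" using \<beta>(3)[of "ddiff C u" "j + 1"] u by simp
    have 4: "p (j + 1) 0 = 0" "s' j 0 = 0"
      using vector_space_pair.linear_0[OF pair p(1)] vector_space_pair.linear_0[OF pair s'(1)] by blast+
    have "h (j + 1) (ddiff C u) = \<phi> \<odot> s j (ddiff C u)"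
      unfolding h_def using 2 3 4 p(2)[OF s(2)] by simp
    with 1 have "ddiff C (h j u) + h (j + 1) (ddiff C u) = \<phi> \<odot> ?z + \<phi> \<odot> s j (ddiff C u)" by simp
    also have "\<dots> = \<phi> \<odot> (?z + s j (ddiff C u))"
      by (rule linear_onD(1)[OF dcompose_linear_right[OF assms(1)], symmetric]) (fact z_mem s(2))+
    finally show ?thesis by (simp add: z_eq)
  qed
  ultimately show thesis by (rule that)
qed

end


section \<open>Semifree bimodules\<close>

context dg_bimodule
begin

sublocale bm: vector_space "bsmul M"
  by (rule vector_space_bsmul)

lemma bHom_zero [simp]: "0 \<in> bHom M X Y i"
  by (rule bm.subspace_0[OF subspace_bHom])

lemma bHom_add: "p \<in> bHom M X Y i \<Longrightarrow> q \<in> bHom M X Y i \<Longrightarrow> p + q \<in> bHom M X Y i"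
  by (rule bm.subspace_add[OF subspace_bHom])

lemma bHom_diff: "p \<in> bHom M X Y i \<Longrightarrow> q \<in> bHom M X Y i \<Longrightarrow> p - q \<in> bHom M X Y i"
  by (rule bm.subspace_diff[OF subspace_bHom])

lemma bHom_scale: "p \<in> bHom M X Y i \<Longrightarrow> bsmul M c p \<in> bHom M X Y i"
  by (rule bm.subspace_scale[OF subspace_bHom])

lemma bdiff_zero [simp]: "bdiff M 0 = 0"
  using linear_on_zero[OF bdiff_linear] bHom_zero by blast

lemma bdiff_add:
  "p \<in> bHom M X Y i \<Longrightarrow> q \<in> bHom M X Y i \<Longrightarrow> bdiff M (p + q) = bdiff M p + bdiff M q"
  by (rule linear_onD(1)[OF bdiff_linear])

lemma bdiff_diff:
  "p \<in> bHom M X Y i \<Longrightarrow> q \<in> bHom M X Y i \<Longrightarrow> bdiff M (p - q) = bdiff M p - bdiff M q"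
  by (rule linear_on_diff[OF bdiff_linear vector_space_bsmul subspace_bHom])

lemma lact_zero: "f \<in> dHom C Y Y' j \<Longrightarrow> lact M f 0 = 0"
  using linear_on_zero[OF lact_linear] bHom_zero by blast

lemma lact_add:
  "f \<in> dHom C Y Y' j \<Longrightarrow> p \<in> bHom M X Y i \<Longrightarrow> q \<in> bHom M X Y i \<Longrightarrow>
    lact M f (p + q) = lact M f p + lact M f q"
  by (rule linear_onD(1)[OF lact_linear])

lemma lact_diff:
  "f \<in> dHom C Y Y' j \<Longrightarrow> p \<in> bHom M X Y i \<Longrightarrow> q \<in> bHom M X Y i \<Longrightarrow>
    lact M f (p - q) = lact M f p - lact M f q"
  by (rule linear_on_diff[OF lact_linear vector_space_bsmul subspace_bHom])

lemma lact_scale: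
  "f \<in> dHom C Y Y' j \<Longrightarrow> p \<in> bHom M X Y i \<Longrightarrow> lact M f (bsmul M c p) = bsmul M c (lact M f p)"
  by (rule linear_onD(2)[OF lact_linear])

lemma lact_add_scalar:
  "p \<in> bHom M X Y i \<Longrightarrow> f \<in> dHom C Y Y' j \<Longrightarrow> g \<in> dHom C Y Y' j \<Longrightarrow>
    lact M (f + g) p = lact M f p + lact M g p"
  by (rule linear_onD(1)[OF lact_linear_scalar])

lemma lact_diff_scalar:
  "p \<in> bHom M X Y i \<Longrightarrow> f \<in> dHom C Y Y' j \<Longrightarrow> g \<in> dHom C Y Y' j \<Longrightarrow>
    lact M (f - g) p = lact M f p - lact M g p"
  by (rule linear_on_diff[OF lact_linear_scalar vector_space_dsmul subspace_dHom])

lemma lact_scale_scalar: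
  "p \<in> bHom M X Y i \<Longrightarrow> f \<in> dHom C Y Y' j \<Longrightarrow> lact M (dsmul C c f) p = bsmul M c (lact M f p)"
  by (rule linear_onD(2)[OF lact_linear_scalar])

lemma ract_zero: "g \<in> dHom C X' X j \<Longrightarrow> ract M 0 g = 0"
  using linear_on_zero[OF ract_linear] bHom_zero by blast

lemma ract_add:
  "g \<in> dHom C X' X j \<Longrightarrow> p \<in> bHom M X Y i \<Longrightarrow> q \<in> bHom M X Y i \<Longrightarrow>
    ract M (p + q) g = ract M p g + ract M q g"
  by (rule linear_onD(1)[OF ract_linear])

lemma ract_scale:
  "g \<in> dHom C X' X j \<Longrightarrow> p \<in> bHom M X Y i \<Longrightarrow> ract M (bsmul M c p) g = bsmul M c (ract M p g)"
  by (rule linear_onD(2)[OF ract_linear])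

lemma ract_add_scalar:
  "p \<in> bHom M X Y i \<Longrightarrow> f \<in> dHom C X' X j \<Longrightarrow> g \<in> dHom C X' X j \<Longrightarrow>
    ract M p (f + g) = ract M p f + ract M p g"
  by (rule linear_onD(1)[OF ract_linear_scalar])

lemma ract_scale_scalar:
  "p \<in> bHom M X Y i \<Longrightarrow> f \<in> dHom C X' X j \<Longrightarrow> ract M p (dsmul C c f) = bsmul M c (ract M p f)"
  by (rule linear_onD(2)[OF ract_linear_scalar])

lemma ract_zero_scalar: "p \<in> bHom M X Y i \<Longrightarrow> ract M p 0 = 0"
  using linear_on_zero[OF ract_linear_scalar] dHom_zero by blast

lemma bdiff_lact_closed:
  assumes "p \<in> bHom M X Y i" "f \<in> dHom C Y Y' 0" "ddiff C f = 0"
  shows "bdiff M (lact M f p) = lact M f (bdiff M p)"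
proof -
  have "lact M 0 p = 0" using linear_on_zero[OF lact_linear_scalar[OF assms(1)]] dHom_zero by blast
  then show ?thesis using bdiff_lact[OF assms(1,2)] assms(3) by (simp add: koszul_def)
qed

end

text \<open>The witnesses in \<open>fg_semifree\<close> become parameters, so that the filtration
  which they define can be named.\<close>

locale semifree_bimodule = dg_bimodule C M
  for C :: "('k::field, 'e, 'c::ab_group_add, 'z) dgcat_scheme" (structure)
    and M :: "('k, 'e, 'c, 'b::ab_group_add, 'y) dgbimod_scheme" +
  fixes r :: nat and A B :: "nat \<Rightarrow> 'e" and n :: "nat \<Rightarrow> int" and w :: "nat \<Rightarrow> 'b"
  assumes gen_mem: "k < r \<Longrightarrow> w k \<in> bHom M (A k) (B k) (n k)"
    and gen_diff: "k < r \<Longrightarrow>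
      bdiff M (w k) \<in> module.span (bsmul M) (generated_by C M A B n w k (A k) (B k) (n k + 1))"
    and gen_span: "bHom M X Y m \<subseteq> module.span (bsmul M) (generated_by C M A B n w r X Y m)"
    and gen_free: "finite J \<Longrightarrow>
      (\<And>k j. k < r \<Longrightarrow> j \<in> J \<Longrightarrow> finite (T k j) \<and> T k j \<subseteq> dHom C (B k) Y j \<and>
         \<not> module.dependent (dsmul C) (T k j)) \<Longrightarrow>
      (\<And>k j t. k < r \<Longrightarrow> j \<in> J \<Longrightarrow> t \<in> T k j \<Longrightarrow> \<gamma> k j t \<in> dHom C X (A k) (m - n k - j)) \<Longrightarrow>
      (\<Sum>k<r. \<Sum>j\<in>J. \<Sum>t\<in>T k j. lact M t (ract M (w k) (\<gamma> k j t))) = 0 \<Longrightarrow>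
      k < r \<Longrightarrow> j \<in> J \<Longrightarrow> t \<in> T k j \<Longrightarrow> \<gamma> k j t = 0"
begin

text \<open>By \<open>gen_diff\<close> the differential preserves every step with k \<le> r, so this
  is the filtration of \<open>M\<close> by dg sub-bimodules whose successive quotients are free on
  one generator.\<close>

definition fil :: "nat \<Rightarrow> 'e \<Rightarrow> 'e \<Rightarrow> int \<Rightarrow> 'b set" where
  "fil k X Y m = bm.span (generated_by C M A B n w k X Y m)"

lemma ract_gen: "k < r \<Longrightarrow> g \<in> dHom C X (A k) j \<Longrightarrow> ract M (w k) g \<in> bHom M X (B k) (n k + j)"
  by (rule ract_closed[OF gen_mem])

lemma gen_mem_bHom:
  assumes "k < r" "f \<in> dHom C (B k) Y i" "g \<in> dHom C X (A k) j" "i + n k + j = m"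
  shows "lact M f (ract M (w k) g) \<in> bHom M X Y m"
  using lact_closed[OF ract_gen[OF assms(1,3)] assms(2)] assms(4) by (simp add: add.assoc)

lemma gen_mem_fil:
  assumes "k < K" "f \<in> dHom C (B k) Y i" "g \<in> dHom C X (A k) j" "i + n k + j = m"
  shows "lact M f (ract M (w k) g) \<in> fil K X Y m"
  unfolding fil_def generated_by_def using assms by (intro bm.span_base) blast

lemma fil_zero [simp]: "0 \<in> fil k X Y m"
  and fil_add: "p \<in> fil k X Y m \<Longrightarrow> q \<in> fil k X Y m \<Longrightarrow> p + q \<in> fil k X Y m"
  and fil_diff: "p \<in> fil k X Y m \<Longrightarrow> q \<in> fil k X Y m \<Longrightarrow> p - q \<in> fil k X Y m"
  and fil_uminus: "p \<in> fil k X Y m \<Longrightarrow> - p \<in> fil k X Y m"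
  and fil_scale: "p \<in> fil k X Y m \<Longrightarrow> bsmul M c p \<in> fil k X Y m"
  unfolding fil_def by (auto intro: bm.span_zero bm.span_add bm.span_diff bm.span_neg bm.span_scale)

lemma fil_koszul: "p \<in> fil k X Y m \<Longrightarrow> koszul i p \<in> fil k X Y m"
  by (auto simp: koszul_def intro: fil_uminus)

lemma fil_bottom: "fil 0 X Y m = {0}"
  unfolding fil_def generated_by_def by simp

lemma fil_mono: "k \<le> l \<Longrightarrow> fil k X Y m \<subseteq> fil l X Y m"
  unfolding fil_def generated_by_def by (intro bm.span_mono) force

lemma fil_sub_bHom:
  assumes "k \<le> r"
  shows "fil k X Y m \<subseteq> bHom M X Y m"
  unfolding fil_def using assms
  by (intro bm.span_minimal subspace_bHom) (auto simp: generated_by_def intro!: gen_mem_bHom)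

lemma fil_top: "fil r X Y m = bHom M X Y m"
  using fil_sub_bHom[of r] gen_span unfolding fil_def by (meson order.refl subset_antisym)

text \<open>Membership of the partial sum is carried along because additivity of the actions and the
  differential is available only on the components \<open>bHom\<close>.\<close>

lemma fil_induct [consumes 1, case_names zero step]:
  assumes "p \<in> fil K X Y m" "Q 0"
    and "\<And>k f g i j c p. k < K \<Longrightarrow> f \<in> dHom C (B k) Y i \<Longrightarrow> g \<in> dHom C X (A k) j \<Longrightarrow> i + n k + j = m \<Longrightarrow>
      p \<in> fil K X Y m \<Longrightarrow> Q p \<Longrightarrow> Q (bsmul M c (lact M f (ract M (w k) g)) + p)"
  shows "Q p"
proof -
  have "p \<in> fil K X Y m \<and> Q p"
    using assms(1) unfolding fil_def
  proof (induction rule: bm.span_induct_alt)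
    case base
    then show ?case using assms(2) bm.span_zero by blast
  next
    case (step c x y)
    then obtain k f g i j where x: "x = lact M f (ract M (w k) g)" "k < K"
        "f \<in> dHom C (B k) Y i" "g \<in> dHom C X (A k) j" "i + n k + j = m"
      unfolding generated_by_def by blast
    with step show ?case
      using assms(3) by (auto simp: fil_def intro: bm.span_add bm.span_scale bm.span_base)
  qed
  then show ?thesis ..
qed

lemma lact_fil:
  assumes "K \<le> r" "p \<in> fil K X Y m" "f \<in> dHom C Y Y' i"
  shows "lact M f p \<in> fil K X Y' (i + m)"
  using assms(2)
proof (induction rule: fil_induct)
  case zero
  then show ?case using lact_zero[OF assms(3)] by simp
next
  case (step k g h i' j c p)
  have k: "k < r" using step assms(1) by simp
  have gm: "lact M g (ract M (w k) h) \<in> bHom M X Y m" by (rule gen_mem_bHom) (use step k in auto)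
  have pm: "p \<in> bHom M X Y m" using fil_sub_bHom[OF assms(1)] step by blast
  have "lact M f (bsmul M c (lact M g (ract M (w k) h)) + p)
      = bsmul M c (lact M (f \<odot> g) (ract M (w k) h)) + lact M f p"
    using lact_add[OF assms(3) bHom_scale[OF gm] pm] lact_scale[OF assms(3) gm]
      lact_lact[OF ract_gen[OF k step(3)] step(2) assms(3)] by simp
  moreover have "lact M (f \<odot> g) (ract M (w k) h) \<in> fil K X Y' (i + m)"
    using step dcompose_closed[OF step(2) assms(3)] by (intro gen_mem_fil) auto
  ultimately show ?case using step by (auto intro: fil_add fil_scale)
qed

lemma ract_fil:
  assumes "K \<le> r" "p \<in> fil K X Y m" "g \<in> dHom C X' X i"
  shows "ract M p g \<in> fil K X' Y (m + i)"
  using assms(2)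
proof (induction rule: fil_induct)
  case zero
  then show ?case using ract_zero[OF assms(3)] by simp
next
  case (step k f h i' j c p)
  have k: "k < r" using step assms(1) by simp
  have gm: "lact M f (ract M (w k) h) \<in> bHom M X Y m" by (rule gen_mem_bHom) (use step k in auto)
  have pm: "p \<in> bHom M X Y m" using fil_sub_bHom[OF assms(1)] step by blast
  have "ract M (bsmul M c (lact M f (ract M (w k) h)) + p) g
      = bsmul M c (lact M f (ract M (w k) (h \<odot> g))) + ract M p g"
    using ract_add[OF assms(3) bHom_scale[OF gm] pm] ract_scale[OF assms(3) gm]
      lact_ract[OF ract_gen[OF k step(3)] step(2) assms(3)] ract_ract[OF gen_mem[OF k] step(3) assms(3)]
    by simp
  moreover have "lact M f (ract M (w k) (h \<odot> g)) \<in> fil K X' Y (m + i)"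
    using step dcompose_closed[OF assms(3) step(3)] by (intro gen_mem_fil) auto
  ultimately show ?case using step by (auto intro: fil_add fil_scale)
qed

text \<open>
  The graph of the map \<open>f (w k) g \<mapsto> h k i f (w k) g\<close> (\<open>f\<close> of degree \<open>i\<close>) on the span of the first
  \<open>K\<close> generators.
\<close>

inductive hrel :: "(nat \<Rightarrow> int \<Rightarrow> 'c \<Rightarrow> 'c) \<Rightarrow> nat \<Rightarrow> 'e \<Rightarrow> 'e \<Rightarrow> int \<Rightarrow> 'b \<Rightarrow> 'b \<Rightarrow> bool"
  for h K X Y m where
  hrel_zero: "hrel h K X Y m 0 0"
| hrel_step: "k < K \<Longrightarrow> f \<in> dHom C (B k) Y i \<Longrightarrow> g \<in> dHom C X (A k) j \<Longrightarrow> i + n k + j = m \<Longrightarrow>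
    hrel h K X Y m q q' \<Longrightarrow>
    hrel h K X Y m (lact M f (ract M (w k) g) + q) (lact M (h k i f) (ract M (w k) g) + q')"

lemma hrel_gen:
  assumes "k < K" "f \<in> dHom C (B k) Y i" "g \<in> dHom C X (A k) j" "i + n k + j = m"
  shows "hrel h K X Y m (lact M f (ract M (w k) g)) (lact M (h k i f) (ract M (w k) g))"
  using hrel_step[OF assms hrel_zero] by simp

lemma hrel_add:
  assumes "hrel h K X Y m p p'" "hrel h K X Y m q q'"
  shows "hrel h K X Y m (p + q) (p' + q')"
  using assms by (induction rule: hrel.induct) (auto simp: add.assoc intro: hrel_step)

lemma hrel_mono:
  assumes "hrel h K X Y m p p'" "K \<le> L"
  shows "hrel h L X Y m p p'"
  using assms by (induction rule: hrel.induct) (auto intro: hrel_step hrel_zero)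

section \<open>Extending maps of degree -1 on the complexes \<open>dHom C (B k) Y\<close> to the
  bimodule\<close>

context
  fixes h :: "nat \<Rightarrow> int \<Rightarrow> 'c \<Rightarrow> 'c" and Y Y' :: 'e and \<phi> :: 'c
  assumes h_linear: "\<And>k i. k < r \<Longrightarrow> Vector_Spaces.linear (dsmul C) (dsmul C) (h k i)"
    and h_mem: "\<And>k i u. k < r \<Longrightarrow> u \<in> dHom C (B k) Y i \<Longrightarrow> h k i u \<in> dHom C (B k) Y' (i - 1)"
begin

text \<open>The scalar is moved into the left factor of each summand, where \<open>h k i\<close> is
  linear. Domain and range are read off in the same induction.\<close>

lemma hrel_scale:
  assumes "K \<le> r" "hrel h K X Y m p p'"
  shows "hrel h K X Y m (bsmul M c p) (bsmul M c p') \<and> p \<in> fil K X Y m \<and> p' \<in> fil K X Y' (m - 1)"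
  using assms(2)
proof (induction rule: hrel.induct)
  case hrel_zero
  then show ?case by (simp add: hrel.hrel_zero)
next
  case (hrel_step k f i g j q q')
  have k: "k < r" using hrel_step assms(1) by simp
  interpret h: Vector_Spaces.linear "dsmul C" "dsmul C" "h k i" by (rule h_linear[OF k])
  have *: "lact M (dsmul C c f) (ract M (w k) g) = bsmul M c (lact M f (ract M (w k) g))"
    "lact M (h k i (dsmul C c f)) (ract M (w k) g) = bsmul M c (lact M (h k i f) (ract M (w k) g))"
    using lact_scale_scalar[OF ract_gen[OF k hrel_step(3)] hrel_step(2)]
      lact_scale_scalar[OF ract_gen[OF k hrel_step(3)] h_mem[OF k hrel_step(2)]]
    by (auto simp: h.scale)
  have "hrel h K X Y m (bsmul M c (lact M f (ract M (w k) g))) (bsmul M c (lact M (h k i f) (ract M (w k) g)))"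
    using hrel_gen[OF hrel_step(1) dHom_scale[OF hrel_step(2)] hrel_step(3,4), of h c]
    unfolding * .
  moreover have "lact M f (ract M (w k) g) \<in> fil K X Y m"
    by (rule gen_mem_fil[OF hrel_step(1-4)])
  moreover have "lact M (h k i f) (ract M (w k) g) \<in> fil K X Y' (m - 1)"
    using hrel_step(4) by (intro gen_mem_fil[OF hrel_step(1) h_mem[OF k hrel_step(2)] hrel_step(3)]) simp
  ultimately show ?case
    using hrel_step by (auto simp: bm.scale_right_distrib intro: hrel_add fil_add)
qed

lemma hrel_dom: "K \<le> r \<Longrightarrow> hrel h K X Y m p p' \<Longrightarrow> p \<in> fil K X Y m"
  and hrel_ran: "K \<le> r \<Longrightarrow> hrel h K X Y m p p' \<Longrightarrow> p' \<in> fil K X Y' (m - 1)"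
  using hrel_scale by blast+

lemma hrel_uminus: "K \<le> r \<Longrightarrow> hrel h K X Y m p p' \<Longrightarrow> hrel h K X Y m (- p) (- p')"
  using hrel_scale[of K X m p p' "-1"] by simp

lemma hrel_koszul: "K \<le> r \<Longrightarrow> hrel h K X Y m p p' \<Longrightarrow> hrel h K X Y m (koszul i p) (koszul i p')"
  using hrel_uminus by (simp add: koszul_def)

lemma hrel_total:
  assumes "K \<le> r" "p \<in> fil K X Y m"
  obtains p' where "hrel h K X Y m p p'"
proof -
  have "\<exists>p'. hrel h K X Y m p p'"
    using assms(2)
  proof (induction rule: fil_induct)
    case zero
    then show ?case using hrel_zero by blast
  next
    case (step k f g i j c p)
    then show ?case using hrel_scale[OF assms(1) hrel_gen[OF step(1-4), of h]] hrel_add by blast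
  qed
  then show ?thesis using that by blast
qed

text \<open>Left factors come from bases \<open>\<B> k i\<close>, as \<open>gen_free\<close>
  demands, and \<open>\<gamma>\<close> vanishes off \<open>I\<close>, so that two forms add over the
  union of their index sets. The image \<open>q'\<close> is recorded with the same
  coefficients.\<close>

definition normal_form :: "(nat \<Rightarrow> int \<Rightarrow> 'c set) \<Rightarrow> 'e \<Rightarrow> int \<Rightarrow> 'b \<Rightarrow> 'b \<Rightarrow> bool" where
  "normal_form \<B> X m q q' \<longleftrightarrow> (\<exists>I \<gamma>. finite I \<and>
     (\<forall>k i t. (k, i, t) \<in> I \<longrightarrow> k < r \<and> t \<in> \<B> k i) \<and>
     (\<forall>k i t. \<gamma> (k, i, t) \<in> dHom C X (A k) (m - n k - i)) \<and> (\<forall>x. x \<notin> I \<longrightarrow> \<gamma> x = 0) \<and>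
     q = (\<Sum>(k, i, t)\<in>I. lact M t (ract M (w k) (\<gamma> (k, i, t)))) \<and>
     q' = (\<Sum>(k, i, t)\<in>I. lact M (h k i t) (ract M (w k) (\<gamma> (k, i, t)))))"

lemma normal_form_add:
  assumes \<B>: "\<And>k i. k < r \<Longrightarrow> \<B> k i \<subseteq> dHom C (B k) Y i"
    and "normal_form \<B> X m p p'" "normal_form \<B> X m q q'"
  shows "normal_form \<B> X m (p + q) (p' + q')"
proof -
  obtain I \<gamma> where 1: "finite I" "\<And>k i t. (k, i, t) \<in> I \<Longrightarrow> k < r \<and> t \<in> \<B> k i"
      "\<And>k i t. \<gamma> (k, i, t) \<in> dHom C X (A k) (m - n k - i)" "\<And>x. x \<notin> I \<Longrightarrow> \<gamma> x = 0"
      "p = (\<Sum>(k, i, t)\<in>I. lact M t (ract M (w k) (\<gamma> (k, i, t))))"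
      "p' = (\<Sum>(k, i, t)\<in>I. lact M (h k i t) (ract M (w k) (\<gamma> (k, i, t))))"
    using assms(2) unfolding normal_form_def by blast
  obtain J \<delta> where 2: "finite J" "\<And>k i t. (k, i, t) \<in> J \<Longrightarrow> k < r \<and> t \<in> \<B> k i"
      "\<And>k i t. \<delta> (k, i, t) \<in> dHom C X (A k) (m - n k - i)" "\<And>x. x \<notin> J \<Longrightarrow> \<delta> x = 0"
      "q = (\<Sum>(k, i, t)\<in>J. lact M t (ract M (w k) (\<delta> (k, i, t))))"
      "q' = (\<Sum>(k, i, t)\<in>J. lact M (h k i t) (ract M (w k) (\<delta> (k, i, t))))"
    using assms(3) unfolding normal_form_def by blast
  \<comment> \<open>A general \<open>F\<close> serves both coordinates: the basis vectors themselves
    (degree change 0) and their images under \<open>h\<close> (degree change -1).\<close>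
  have eq: "(\<Sum>(k, i, t)\<in>I. lact M (F k i t) (ract M (w k) (\<gamma> (k, i, t)))) +
      (\<Sum>(k, i, t)\<in>J. lact M (F k i t) (ract M (w k) (\<delta> (k, i, t)))) =
      (\<Sum>(k, i, t)\<in>I \<union> J. lact M (F k i t) (ract M (w k) (\<gamma> (k, i, t) + \<delta> (k, i, t))))"
    if F: "\<And>k i t. k < r \<Longrightarrow> t \<in> \<B> k i \<Longrightarrow> F k i t \<in> dHom C (B k) Z (i + d)" for F Z d
  proof -
    have IJ: "k < r" "t \<in> \<B> k i" if "(k, i, t) \<in> I \<union> J" for k i t
      using that 1(2) 2(2) by auto
    have 0: "lact M (F k i t) (ract M (w k) 0) = 0" if "(k, i, t) \<in> I \<union> J" for k i t
      using lact_zero[OF F[OF IJ[OF that]]] ract_zero_scalar[OF gen_mem[OF IJ(1)[OF that]]] by simp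
    have "(\<Sum>(k, i, t)\<in>I. lact M (F k i t) (ract M (w k) (\<gamma> (k, i, t)))) =
        (\<Sum>(k, i, t)\<in>I \<union> J. lact M (F k i t) (ract M (w k) (\<gamma> (k, i, t))))"
      using 1(1,4) 2(1) 0 by (intro sum.mono_neutral_left) auto
    moreover have "(\<Sum>(k, i, t)\<in>J. lact M (F k i t) (ract M (w k) (\<delta> (k, i, t)))) =
        (\<Sum>(k, i, t)\<in>I \<union> J. lact M (F k i t) (ract M (w k) (\<delta> (k, i, t))))"
      using 1(1) 2(1,4) 0 by (intro sum.mono_neutral_left) auto
    moreover have "lact M (F k i t) (ract M (w k) (\<gamma> (k, i, t) + \<delta> (k, i, t))) =
        lact M (F k i t) (ract M (w k) (\<gamma> (k, i, t))) + lact M (F k i t) (ract M (w k) (\<delta> (k, i, t)))"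
      if x: "(k, i, t) \<in> I \<union> J" for k i t
      using ract_add_scalar[OF gen_mem[OF IJ(1)[OF x]] 1(3) 2(3)]
        lact_add[OF F[OF IJ[OF x]] ract_gen[OF IJ(1)[OF x] 1(3)] ract_gen[OF IJ(1)[OF x] 2(3)]]
      by simp
    ultimately show ?thesis
      by (simp add: sum.distrib[symmetric] split_def cong: sum.cong) (intro sum.cong, auto)
  qed
  show ?thesis
    unfolding normal_form_def
  proof (intro exI conjI allI impI)
    show "p + q = (\<Sum>(k, i, t)\<in>I \<union> J. lact M t (ract M (w k) ((\<lambda>x. \<gamma> x + \<delta> x) (k, i, t))))"
      unfolding 1(5) 2(5) using \<B> by (subst eq[of "\<lambda>k i t. t" Y 0]) auto
    show "p' + q' = (\<Sum>(k, i, t)\<in>I \<union> J. lact M (h k i t) (ract M (w k) ((\<lambda>x. \<gamma> x + \<delta> x) (k, i, t))))"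
      unfolding 1(6) 2(6) using h_mem[OF _ subsetD[OF \<B>]] by (subst eq[of h Y' "-1"]) simp_all
  qed (use 1(1-4) 2(1-4) in \<open>auto intro: dHom_add\<close>)
qed

text \<open>Expand each left factor in the basis and slide the coefficients over to the right
  factor. As \<open>h\<close> is linear, the same coefficients describe the image.\<close>

lemma hrel_normal_form:
  assumes "K \<le> r" and \<B>: "\<And>k i. k < r \<Longrightarrow> \<B> k i \<subseteq> dHom C (B k) Y i"
    and span: "\<And>k i. k < r \<Longrightarrow> dHom C (B k) Y i \<subseteq> dg.span (\<B> k i)"
    and "hrel h K X Y m p p'"
  shows "normal_form \<B> X m p p'"
  using assms(4)
proof (induction rule: hrel.induct)
  case hrel_zero
  show ?case
    unfolding normal_form_def by (rule exI[of _ "{}"], rule exI[of _ "\<lambda>_. 0"]) simp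
next
  case (hrel_step k f i g j q q')
  have k: "k < r" using hrel_step assms(1) by simp
  interpret h: Vector_Spaces.linear "dsmul C" "dsmul C" "h k i" by (rule h_linear[OF k])
  obtain T c where T: "finite T" "T \<subseteq> \<B> k i" "f = (\<Sum>t\<in>T. dsmul C (c t) t)"
    using span[OF k, of i] hrel_step(2) unfolding dg.span_explicit by blast
  let ?x = "ract M (w k) g"
  have x: "?x \<in> bHom M X (B k) (n k + j)" by (rule ract_gen[OF k hrel_step(3)])
  have slide: "lact M (dsmul C a u) ?x = lact M u (ract M (w k) (dsmul C a g))"
    if "u \<in> dHom C (B k) Z l" for a u Z l
    using lact_scale_scalar[OF x that] lact_scale[OF that x]
      ract_scale_scalar[OF gen_mem[OF k] hrel_step(3)] by simp
  have Tm: "t \<in> dHom C (B k) Y i" if "t \<in> T" for t using that T(2) \<B>[OF k] by blast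
  let ?I = "(\<lambda>t. (k, i, t)) ` T"
  let ?\<gamma> = "\<lambda>(k', i', t). if (k', i', t) \<in> ?I then dsmul C (c t) g else 0"
  have inj: "inj_on (\<lambda>t. (k, i, t)) T" by (auto intro: inj_onI)
  have "normal_form \<B> X m (lact M f ?x) (lact M (h k i f) ?x)"
    unfolding normal_form_def
  proof (intro exI conjI allI impI)
    show "lact M f ?x = (\<Sum>(k, i, t)\<in>?I. lact M t (ract M (w k) (?\<gamma> (k, i, t))))"
    proof -
      have "lact M f ?x = (\<Sum>t\<in>T. lact M (dsmul C (c t) t) ?x)"
        unfolding T(3)
        by (rule linear_on_sum[OF lact_linear_scalar[OF x] vector_space_dsmul subspace_dHom])
          (use Tm dHom_scale in blast)
      also have "\<dots> = (\<Sum>t\<in>T. lact M t (ract M (w k) (dsmul C (c t) g)))"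
        using slide[OF Tm] by simp
      finally show ?thesis by (simp add: sum.reindex[OF inj])
    qed
    show "lact M (h k i f) ?x = (\<Sum>(k, i, t)\<in>?I. lact M (h k i t) (ract M (w k) (?\<gamma> (k, i, t))))"
    proof -
      have "lact M (h k i f) ?x = lact M (\<Sum>t\<in>T. dsmul C (c t) (h k i t)) ?x"
        unfolding T(3) by (simp add: h.sum h.scale)
      also have "\<dots> = (\<Sum>t\<in>T. lact M (dsmul C (c t) (h k i t)) ?x)"
        by (rule linear_on_sum[OF lact_linear_scalar[OF x] vector_space_dsmul subspace_dHom])
          (use Tm h_mem[OF k] dHom_scale in blast)
      also have "\<dots> = (\<Sum>t\<in>T. lact M (h k i t) (ract M (w k) (dsmul C (c t) g)))"
        using slide[OF h_mem[OF k Tm]] by simp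
      finally show ?thesis by (simp add: sum.reindex[OF inj])
    qed
    have "m - n k - i = j" using hrel_step(4) by simp
    then show "?\<gamma> (k', i', t) \<in> dHom C X (A k') (m - n k' - i')" for k' i' t
      using dHom_scale[OF hrel_step(3)] by auto
  qed (use T k in auto)
  then show ?case using normal_form_add[OF \<B>] hrel_step.IH by blast
qed

text \<open>This is where freeness of the generators is used.\<close>

lemma hrel_functional:
  assumes "K \<le> r" "hrel h K X Y m 0 p'"
  shows "p' = 0"
proof -
  have "\<exists>\<B>. \<B> \<subseteq> dHom C (B k) Y i \<and> \<not> dg.dependent \<B> \<and> dHom C (B k) Y i \<subseteq> dg.span \<B>" for k i
    by (rule dg.maximal_independent_subset[of "dHom C (B k) Y i"]) blast
  then obtain \<B> where \<B>: "\<And>k i. \<B> k i \<subseteq> dHom C (B k) Y i" "\<And>k i. \<not> dg.dependent (\<B> k i)"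
      "\<And>k i. dHom C (B k) Y i \<subseteq> dg.span (\<B> k i)" by metis
  have "normal_form \<B> X m 0 p'" by (rule hrel_normal_form[OF assms(1) \<B>(1,3) assms(2)])
  then obtain I \<gamma> where I: "finite I" "\<And>k i t. (k, i, t) \<in> I \<Longrightarrow> k < r \<and> t \<in> \<B> k i"
      "\<And>k i t. \<gamma> (k, i, t) \<in> dHom C X (A k) (m - n k - i)"
      "0 = (\<Sum>(k, i, t)\<in>I. lact M t (ract M (w k) (\<gamma> (k, i, t))))"
      "p' = (\<Sum>(k, i, t)\<in>I. lact M (h k i t) (ract M (w k) (\<gamma> (k, i, t))))"
    unfolding normal_form_def by blast
  define J where "J = (\<lambda>(k, i, t). i) ` I"
  define T where "T k i = {t. (k, i, t) \<in> I}" for k i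
  have T_sub: "T k i \<subseteq> \<B> k i" for k i using I(2) by (auto simp: T_def)
  have T_fin: "finite (T k i)" for k i
  proof -
    have "T k i \<subseteq> (\<lambda>(k, i, t). t) ` I" by (force simp: T_def)
    then show ?thesis using I(1) finite_surj by blast
  qed
  have J_fin: "finite J" using I(1) by (simp add: J_def)
  \<comment> \<open>\<open>gen_free\<close> expects a sum over all generators and a common finite
    set of degrees, with a finite set of vectors at each place; fibring \<open>I\<close> over its
    degrees \<open>J\<close> gives this shape.\<close>
  have I_eq: "I = Sigma {..<r} (\<lambda>k. Sigma J (\<lambda>j. T k j))"
    using I(2) by (force simp: J_def T_def)
  have "(\<Sum>k<r. \<Sum>j\<in>J. \<Sum>t\<in>T k j. lact M t (ract M (w k) (\<gamma> (k, j, t)))) = 0"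
    using I(4) J_fin T_fin by (simp add: sum.Sigma I_eq[symmetric])
  then have "\<gamma> (k, j, t) = 0" if "k < r" "j \<in> J" "t \<in> T k j" for k j t
    using that I(3) T_fin T_sub \<B>(1) dg.independent_mono[OF \<B>(2) T_sub] J_fin
    by (intro gen_free[of J T Y "\<lambda>k j t. \<gamma> (k, j, t)" X m]) (auto simp: subset_iff)
  then have \<gamma>0: "\<gamma> (k, j, t) = 0" if "(k, j, t) \<in> I" for k j t
    using that unfolding I_eq by blast
  have "lact M (h k i t) (ract M (w k) (\<gamma> (k, i, t))) = 0" if "(k, i, t) \<in> I" for k i t
    using \<gamma>0[OF that] I(2)[OF that] \<B>(1)[of k i] lact_zero[OF h_mem[of k t i]]
      ract_zero_scalar[OF gen_mem[of k]] by auto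
  then show ?thesis unfolding I(5) by (intro sum.neutral) auto
qed

text \<open>
  The map with graph \<^const>\<open>hrel\<close> is a homotopy for the action of \<open>\<phi>\<close> on the associated graded
  bimodule.
\<close>

lemma hrel_homotopy:
  assumes "K < r" and \<phi>: "\<phi> \<in> dHom C Y Y' 0"
    and homotopy: "\<And>k i u. k < r \<Longrightarrow> u \<in> dHom C (B k) Y i \<Longrightarrow>
      \<phi> \<odot> u = ddiff C (h k i u) + h k (i + 1) (ddiff C u)"
    and "hrel h (Suc K) X Y m q q'"
  shows "\<exists>q''. hrel h (Suc K) X Y (m + 1) (bdiff M q) q'' \<and>
    lact M \<phi> q - bdiff M q' - q'' \<in> fil K X Y' m"
  using assms(4)
proof (induction rule: hrel.induct)
  case hrel_zero
  then show ?case using hrel.hrel_zero lact_zero[OF \<phi>] by force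
next
  case (hrel_step k f i g j q q')
  have SK: "Suc K \<le> r" using assms(1) by simp
  have k: "k < r" "k \<le> K" "k \<le> r" using hrel_step assms(1) by auto
  let ?x = "ract M (w k) g"
  let ?dx = "ract M (bdiff M (w k)) g"
  let ?y = "ract M (w k) (ddiff C g)"
  note f = hrel_step(2) and g = hrel_step(3)
  note hf = h_mem[OF k(1) f]
  note df = ddiff_closed[OF f] and dg = ddiff_closed[OF g]
  have hdf: "h k (i + 1) (ddiff C f) \<in> dHom C (B k) Y' i" using h_mem[OF k(1) df] by simp
  have x: "?x \<in> bHom M X (B k) (n k + j)" by (rule ract_gen[OF k(1) g])
  have y: "?y \<in> bHom M X (B k) (n k + j + 1)" using ract_gen[OF k(1) dg] by (simp add: add.assoc)
  \<comment> \<open>The differential of \<open>w k\<close> involves only generators before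
    \<open>w k\<close>, so this term lies strictly lower than the others.\<close>
  have dx: "?dx \<in> fil k X (B k) (n k + j + 1)"
    using ract_fil[OF k(3) gen_diff[OF k(1), folded fil_def] g] by (simp add: algebra_simps)
  then have dx': "?dx \<in> bHom M X (B k) (n k + j + 1)" using fil_sub_bHom[OF k(3)] by blast
  have ky: "koszul (n k) ?y \<in> bHom M X (B k) (n k + j + 1)"
    using y bm.subspace_neg[OF subspace_bHom y] by (simp add: koszul_def)
  have bx: "bdiff M ?x = ?dx + koszul (n k) ?y" by (rule bdiff_ract[OF gen_mem[OF k(1)] g])
  have lact_koszul: "lact M u (koszul a ?y) = koszul a (lact M u ?y)" if "u \<in> dHom C (B k) Z l" for u a Z l
    using linear_on_minus[OF lact_linear[OF that] vector_space_bsmul subspace_bHom y]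
    by (simp add: koszul_def)
  have lx: "lact M u (bdiff M ?x) = lact M u ?dx + koszul (n k) (lact M u ?y)"
    if "u \<in> dHom C (B k) Z l" for u Z l
    unfolding bx using lact_add[OF that dx' ky] lact_koszul[OF that] by simp
  have q3: "lact M f ?dx \<in> fil k X Y (m + 1)"
    using lact_fil[OF k(3) dx f] hrel_step(4) by (simp add: algebra_simps)
  obtain q3' where q3': "hrel h k X Y (m + 1) (lact M f ?dx) q3'"
    using hrel_total[OF k(3) q3] .
  have q3'_mem: "q3' \<in> fil k X Y' m" using hrel_ran[OF k(3) q3'] by simp
  \<comment> \<open>The image of the differential of \<open>lact M f ?x\<close> under the extended
    map, term by term after the Leibniz rule.\<close>
  define z where "z = lact M (h k (i + 1) (ddiff C f)) ?x + koszul i (q3' + koszul (n k) (lact M (h k i f) ?y))"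
  have 1: "hrel h (Suc K) X Y (m + 1) (bdiff M (lact M f ?x)) z"
  proof -
    have "hrel h (Suc K) X Y (m + 1) (lact M (ddiff C f) ?x) (lact M (h k (i + 1) (ddiff C f)) ?x)"
      by (rule hrel_gen[OF hrel_step(1) df g]) (use hrel_step(4) in simp)
    moreover have "hrel h (Suc K) X Y (m + 1) (lact M f ?y) (lact M (h k i f) ?y)"
      by (rule hrel_gen[OF hrel_step(1) f dg]) (use hrel_step(4) in simp)
    moreover have "hrel h (Suc K) X Y (m + 1) (lact M f ?dx) q3'"
      using hrel_mono[OF q3'] k(2) by simp
    moreover have "bdiff M (lact M f ?x) =
        lact M (ddiff C f) ?x + koszul i (lact M f ?dx + koszul (n k) (lact M f ?y))"
      using bdiff_lact[OF x f] lx[OF f] by simp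
    ultimately show ?thesis
      unfolding z_def using hrel_add hrel_koszul[OF SK] by simp
  qed
  have 2: "lact M \<phi> (lact M f ?x) - bdiff M (lact M (h k i f) ?x) - z \<in> fil K X Y' m"
  proof -
    have "lact M \<phi> (lact M f ?x) = lact M (ddiff C (h k i f) + h k (i + 1) (ddiff C f)) ?x"
      using lact_lact[OF x f \<phi>] homotopy[OF k(1) f] by simp
    also have "\<dots> = lact M (ddiff C (h k i f)) ?x + lact M (h k (i + 1) (ddiff C f)) ?x"
      using lact_add_scalar[OF x _ hdf] ddiff_closed[OF hf] by simp
    finally have e1: "lact M \<phi> (lact M f ?x) = \<dots>" .
    have e2: "bdiff M (lact M (h k i f) ?x) = lact M (ddiff C (h k i f)) ?x +
        koszul (i - 1) (lact M (h k i f) ?dx + koszul (n k) (lact M (h k i f) ?y))"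
      using bdiff_lact[OF x hf] lx[OF hf] by simp
    \<comment> \<open>Because \<open>h\<close> lowers the degree of \<open>f\<close> by one, the
      Leibniz signs for i and i - 1 are opposite and the terms with \<open>ddiff C g\<close> cancel.
      What remains comes from the differential of \<open>w k\<close> alone.\<close>
    have "lact M \<phi> (lact M f ?x) - bdiff M (lact M (h k i f) ?x) - z =
        koszul i (lact M (h k i f) ?dx - q3')"
      unfolding e1 e2 z_def by (simp add: koszul_def)
    moreover have "lact M (h k i f) ?dx \<in> fil k X Y' m"
      using lact_fil[OF k(3) dx hf] hrel_step(4) by (simp add: algebra_simps)
    ultimately show ?thesis
      using q3'_mem fil_mono[OF k(2)] by (auto intro!: fil_koszul fil_diff)
  qed
  obtain q'' where q'': "hrel h (Suc K) X Y (m + 1) (bdiff M q) q''"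
      "lact M \<phi> q - bdiff M q' - q'' \<in> fil K X Y' m" using hrel_step.IH by blast
  have gm: "lact M f ?x \<in> bHom M X Y m" by (rule gen_mem_bHom[OF k(1) f g hrel_step(4)])
  have hgm: "lact M (h k i f) ?x \<in> bHom M X Y' (m - 1)"
    by (rule gen_mem_bHom[OF k(1) hf g]) (use hrel_step(4) in simp)
  have qm: "q \<in> bHom M X Y m" "q' \<in> bHom M X Y' (m - 1)"
    using hrel_dom[OF SK hrel_step(5)] hrel_ran[OF SK hrel_step(5)] fil_sub_bHom[OF SK] by blast+
  have "hrel h (Suc K) X Y (m + 1) (bdiff M (lact M f ?x + q)) (z + q'')"
    using hrel_add[OF 1 q''(1)] bdiff_add[OF gm qm(1)] by simp
  moreover have "lact M \<phi> (lact M f ?x + q) - bdiff M (lact M (h k i f) ?x + q') - (z + q'') =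
      (lact M \<phi> (lact M f ?x) - bdiff M (lact M (h k i f) ?x) - z) + (lact M \<phi> q - bdiff M q' - q'')"
    using bdiff_add[OF hgm qm(2)] lact_add[OF \<phi> gm qm(1)] by simp
  ultimately show ?case using fil_add[OF 2 q''(2)] by metis
qed

end

text \<open>The null-homotopies on the complexes at \<open>B k\<close> induce a homotopy on
  \<open>M\<close> modulo \<open>fil K\<close>. Its term at the differential of \<open>q\<close> is
  an image of 0, hence 0 by \<open>hrel_functional\<close>, and the homotopy identity becomes the
  claim.\<close>

lemma ghost_lowers_filtration:
  assumes "K < r" and \<phi>: "\<phi> \<in> dHom C Y Y' 0" "ddiff C \<phi> = 0"
    and van: "\<And>k j b. k < r \<Longrightarrow> b \<in> cocycles C (B k) Y j \<Longrightarrow> \<phi> \<odot> b \<in> coboundaries C (B k) Y' j"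
    and q: "q \<in> fil (Suc K) X Y m" "bdiff M q = 0"
  obtains q' where "q' \<in> bHom M X Y' (m - 1)" "lact M \<phi> q - bdiff M q' \<in> fil K X Y' m"
proof -
  have "\<exists>h. (\<forall>i. Vector_Spaces.linear (dsmul C) (dsmul C) (h i)) \<and>
      (\<forall>i. \<forall>u\<in>dHom C (B k) Y i. h i u \<in> dHom C (B k) Y' (i - 1)) \<and>
      (\<forall>i. \<forall>u\<in>dHom C (B k) Y i. \<phi> \<odot> u = ddiff C (h i u) + h (i + 1) (ddiff C u))" if "k < r" for k
    by (rule null_homotopy[OF \<phi> van[OF that]]) blast+
  then obtain h where h: "\<And>k i. k < r \<Longrightarrow> Vector_Spaces.linear (dsmul C) (dsmul C) (h k i)"
      "\<And>k i u. k < r \<Longrightarrow> u \<in> dHom C (B k) Y i \<Longrightarrow> h k i u \<in> dHom C (B k) Y' (i - 1)"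
      "\<And>k i u. k < r \<Longrightarrow> u \<in> dHom C (B k) Y i \<Longrightarrow>
        \<phi> \<odot> u = ddiff C (h k i u) + h k (i + 1) (ddiff C u)"
    by metis
  have SK: "Suc K \<le> r" using assms(1) by simp
  obtain q' where q': "hrel h (Suc K) X Y m q q'"
    using hrel_total[OF h(1,2) SK q(1)] by blast
  obtain q'' where q'': "hrel h (Suc K) X Y (m + 1) (bdiff M q) q''"
      "lact M \<phi> q - bdiff M q' - q'' \<in> fil K X Y' m"
    using hrel_homotopy[OF h(1,2) assms(1) \<phi>(1) h(3) q'] by blast
  have "q'' = 0" using hrel_functional[OF h(1,2) SK] q''(1) q(2) by simp
  moreover have "q' \<in> bHom M X Y' (m - 1)"
    using hrel_ran[OF h(1,2) SK q'] fil_sub_bHom[OF SK] by blast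
  ultimately show thesis using that q''(2) by simp
qed

end


section \<open>Ghosts and cells in a triangulated category\<close>

context linear_category
begin

sublocale hm: vector_space "smul D"
  by (rule vector_space_smul)

lemma Hom_zero [simp]: "0 \<in> Hom D X Y"
  by (rule hm.subspace_0[OF subspace_Hom])

lemma compose_zero_right: "g \<in> Hom D Y Z \<Longrightarrow> g \<cdot> 0 = 0"
  using linear_on_zero[OF compose_linear_right] Hom_zero by blast

lemma compose_zero_left: "f \<in> Hom D X Y \<Longrightarrow> 0 \<cdot> f = 0"
  using linear_on_zero[OF compose_linear_left] Hom_zero by blast

lemma compose_uminus_left: "f \<in> Hom D X Y \<Longrightarrow> g \<in> Hom D Y Z \<Longrightarrow> (- g) \<cdot> f = - (g \<cdot> f)"
  by (rule linear_on_minus[OF compose_linear_left vector_space_smul subspace_Hom])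

lemma compose_uminus_right: "f \<in> Hom D X Y \<Longrightarrow> g \<in> Hom D Y Z \<Longrightarrow> g \<cdot> (- f) = - (g \<cdot> f)"
  by (rule linear_on_minus[OF compose_linear_right vector_space_smul subspace_Hom])

lemma compose_add_right:
  "f \<in> Hom D X Y \<Longrightarrow> f' \<in> Hom D X Y \<Longrightarrow> g \<in> Hom D Y Z \<Longrightarrow> g \<cdot> (f + f') = g \<cdot> f + g \<cdot> f'"
  by (rule linear_onD(1)[OF compose_linear_right])

definition nonzero_Hom :: "'o \<Rightarrow> 'o \<Rightarrow> bool" where
  "nonzero_Hom X Y \<longleftrightarrow> Hom D X Y \<noteq> {0}"

lemma nonzero_HomI: "f \<in> Hom D X Y \<Longrightarrow> f \<noteq> 0 \<Longrightarrow> nonzero_Hom X Y"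
  unfolding nonzero_Hom_def by blast

lemma nonzero_HomE:
  assumes "nonzero_Hom X Y"
  obtains f where "f \<in> Hom D X Y" "f \<noteq> 0"
  using assms Hom_zero unfolding nonzero_Hom_def by blast

lemma isomorphicE:
  assumes "isomorphic D X Y"
  obtains f g where "f \<in> Hom D X Y" "g \<in> Hom D Y X" "g \<cdot> f = ident D X" "f \<cdot> g = ident D Y"
  using assms unfolding isomorphic_def is_iso_mor_def by blast

lemma isomorphicI:
  "f \<in> Hom D X Y \<Longrightarrow> g \<in> Hom D Y X \<Longrightarrow> g \<cdot> f = ident D X \<Longrightarrow> f \<cdot> g = ident D Y \<Longrightarrow> isomorphic D X Y"
  unfolding isomorphic_def is_iso_mor_def by blast

lemma isomorphic_refl: "isomorphic D X X"
  by (rule isomorphicI[OF ident_closed ident_closed]) (simp_all add: ident_left[OF ident_closed])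

lemma isomorphic_sym: "isomorphic D X Y \<Longrightarrow> isomorphic D Y X"
  by (elim isomorphicE) (rule isomorphicI)

lemma isomorphic_trans:
  assumes "isomorphic D X Y" "isomorphic D Y Z"
  shows "isomorphic D X Z"
proof -
  obtain f g where 1: "f \<in> Hom D X Y" "g \<in> Hom D Y X" "g \<cdot> f = ident D X" "f \<cdot> g = ident D Y"
    using isomorphicE[OF assms(1)] .
  obtain h k where 2: "h \<in> Hom D Y Z" "k \<in> Hom D Z Y" "k \<cdot> h = ident D Y" "h \<cdot> k = ident D Z"
    using isomorphicE[OF assms(2)] .
  show ?thesis
  proof (rule isomorphicI)
    show hf: "h \<cdot> f \<in> Hom D X Z" and gk: "g \<cdot> k \<in> Hom D Z X"
      using 1 2 compose_closed by blast+
    have "(g \<cdot> k) \<cdot> (h \<cdot> f) = g \<cdot> ((k \<cdot> h) \<cdot> f)"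
      using compose_assoc[OF hf 2(2) 1(2)] compose_assoc[OF 1(1) 2(1,2)] by simp
    then show "(g \<cdot> k) \<cdot> (h \<cdot> f) = ident D X" using 1 2 ident_left by simp
    have "(h \<cdot> f) \<cdot> (g \<cdot> k) = h \<cdot> ((f \<cdot> g) \<cdot> k)"
      using compose_assoc[OF gk 1(1) 2(1)] compose_assoc[OF 2(2) 1(2,1)] by simp
    then show "(h \<cdot> f) \<cdot> (g \<cdot> k) = ident D Z" using 1 2 ident_left by simp
  qed
qed

lemma nonzero_Hom_iso_right:
  assumes "nonzero_Hom T X" "isomorphic D X Y"
  shows "nonzero_Hom T Y"
proof -
  obtain f g where iso: "f \<in> Hom D X Y" "g \<in> Hom D Y X" "g \<cdot> f = ident D X"
    using isomorphicE[OF assms(2)] by metis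
  obtain u where u: "u \<in> Hom D T X" "u \<noteq> 0" using nonzero_HomE[OF assms(1)] .
  have "g \<cdot> (f \<cdot> u) = u" using compose_assoc[OF u(1) iso(1,2)] iso(3) ident_left[OF u(1)] by simp
  then have "f \<cdot> u \<noteq> 0" using u(2) compose_zero_right[OF iso(2)] by auto
  then show ?thesis using nonzero_HomI compose_closed[OF u(1) iso(1)] by blast
qed

lemma zero_objectD: "is_zero_object D Z \<Longrightarrow> \<not> nonzero_Hom Z X \<and> \<not> nonzero_Hom X Z"
  unfolding is_zero_object_def nonzero_Hom_def by blast

lemma zero_object_iff: "is_zero_object D X \<longleftrightarrow> ident D X = 0"
proof
  assume "is_zero_object D X"
  then show "ident D X = 0" using ident_closed unfolding is_zero_object_def by blast
next
  assume 0: "ident D X = 0"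
  have "f = 0" if "f \<in> Hom D X Y" for f Y
    using ident_right[OF that] compose_zero_right[OF that] 0 by simp
  moreover have "f = 0" if "f \<in> Hom D Y X" for f Y
    using ident_left[OF that] compose_zero_left[OF that] 0 by simp
  ultimately show "is_zero_object D X"
    unfolding is_zero_object_def using Hom_zero by blast
qed

lemma nonzero_objectD: "\<not> is_zero_object D X \<Longrightarrow> nonzero_Hom X X"
  using zero_object_iff ident_closed nonzero_HomI by blast

lemma biproduct_inclusion:
  assumes "is_biproduct D X Y S"
  obtains i p where "i \<in> Hom D X S" "p \<in> Hom D S X" "p \<cdot> i = ident D X"
  using assms unfolding is_biproduct_def by blast

lemma linear_functorD:
  assumes "linear_functor D Fo Fm"
  shows "f \<in> Hom D X Y \<Longrightarrow> Fm f \<in> Hom D (Fo X) (Fo Y)"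
    and "linear_on (smul D) (smul D) (Hom D X Y) Fm"
    and "Fm (ident D X) = ident D (Fo X)"
    and "f \<in> Hom D X Y \<Longrightarrow> g \<in> Hom D Y Z \<Longrightarrow> Fm (g \<cdot> f) = Fm g \<cdot> Fm f"
    and "Fm 0 = 0"
proof -
  show lin: "linear_on (smul D) (smul D) (Hom D X Y) Fm" for X Y
    using assms unfolding linear_functor_def by blast
  show "Fm 0 = 0" by (rule linear_on_zero[OF lin]) (rule Hom_zero)
qed (use assms in \<open>auto simp: linear_functor_def\<close>)

lemma linear_functor_isomorphic:
  assumes F: "linear_functor D Fo Fm" and "isomorphic D X Y"
  shows "isomorphic D (Fo X) (Fo Y)"
proof -
  obtain f g where 1: "f \<in> Hom D X Y" "g \<in> Hom D Y X" "g \<cdot> f = ident D X" "f \<cdot> g = ident D Y"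
    using isomorphicE[OF assms(2)] .
  show ?thesis
    using linear_functorD(1)[OF F 1(1)] linear_functorD(1)[OF F 1(2)]
      linear_functorD(4)[OF F 1(1,2)] linear_functorD(4)[OF F 1(2,1)] 1(3,4) linear_functorD(3)[OF F]
    by (intro isomorphicI) auto
qed

lemma linear_functor_compose:
  assumes F: "linear_functor D Fo Fm" and G: "linear_functor D Go Gm"
  shows "linear_functor D (Fo \<circ> Go) (Fm \<circ> Gm)"
proof -
  have "linear_on (smul D) (smul D) (Hom D X Y) (Fm \<circ> Gm)" for X Y
    using linear_functorD(1)[OF G] linear_onD[OF linear_functorD(2)[OF G, of X Y]]
      linear_onD[OF linear_functorD(2)[OF F, of "Go X" "Go Y"]]
    unfolding linear_on_def by simp
  then show ?thesis
    unfolding linear_functor_def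
    using linear_functorD(1,3)[OF F] linear_functorD(1,3)[OF G] linear_functorD(4)[OF G]
      linear_functorD(4)[OF F linear_functorD(1)[OF G] linear_functorD(1)[OF G]]
    by simp
qed

lemma linear_functor_id: "linear_functor D id id"
  unfolding linear_functor_def linear_on_def by simp

end

section \<open>Shifts and exactness of Hom on triangles\<close>

context triangulated_category
begin

lemma shm_closed: "f \<in> Hom D X Y \<Longrightarrow> shm D k f \<in> Hom D (sho D k X) (sho D k Y)"
  by (rule linear_functorD(1)[OF shift_functor])

lemma shm_compose: "f \<in> Hom D X Y \<Longrightarrow> g \<in> Hom D Y Z \<Longrightarrow> shm D k (g \<cdot> f) = shm D k g \<cdot> shm D k f"
  by (rule linear_functorD(4)[OF shift_functor])

lemma shm_zero [simp]: "shm D k 0 = 0"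
  by (rule linear_functorD(5)[OF shift_functor])

lemma shm_inverse: "f \<in> Hom D X Y \<Longrightarrow> shm D (- k) (shm D k f) = f"
  by (simp add: shm_add shm_0)

lemma sho_inverse [simp]: "sho D (- k) (sho D k X) = X" "sho D k (sho D (- k) X) = X"
  by (simp_all add: sho_add sho_0)

lemma shm_eq_0: "f \<in> Hom D X Y \<Longrightarrow> shm D k f = 0 \<longleftrightarrow> f = 0"
  using shm_inverse shm_zero by metis

lemma nonzero_Hom_shift: "nonzero_Hom (sho D k X) (sho D k Y) \<longleftrightarrow> nonzero_Hom X Y"
proof -
  have *: "nonzero_Hom (sho D k X) (sho D k Y)" if "nonzero_Hom X Y" for k X Y
    using that shm_closed shm_eq_0 by (elim nonzero_HomE) (metis nonzero_HomI)
  show ?thesis using *[of X Y k] *[of "sho D k X" "sho D k Y" "- k"] by auto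
qed

lemma nonzero_Hom_shift_left: "nonzero_Hom (sho D k X) Y \<longleftrightarrow> nonzero_Hom X (sho D (- k) Y)"
  using nonzero_Hom_shift[of "- k" "sho D k X" Y] by simp

lemma zero_object_shift: "is_zero_object D (sho D k X) \<longleftrightarrow> is_zero_object D X"
  using shm_eq_0[OF ident_closed, of k X] linear_functorD(3)[OF shift_functor, of k X]
  unfolding zero_object_iff by simp

lemma isomorphic_shift: "isomorphic D X Y \<Longrightarrow> isomorphic D (sho D k X) (sho D k Y)"
  by (rule linear_functor_isomorphic[OF shift_functor])

text \<open>Mapping the trivial triangle on \<open>X\<close> to the given one makes the composite
  factor through a zero object.\<close>

lemma triangle_compose_zero:
  assumes "triangle D X Y Z f g h"
  shows "g \<cdot> f = 0"
proof -
  obtain N where N: "is_zero_object D N" using zero_object_exists by blast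
  note H = triangle_Hom[OF assms]
  have "ident D X \<in> Hom D X X" "f \<in> Hom D X Y" "f \<cdot> ident D X = f \<cdot> ident D X"
    using H ident_closed by auto
  from TR3[OF TR1_ident[OF N] assms this] obtain c where "c \<in> Hom D N Z" "g \<cdot> f = c \<cdot> 0" by blast
  then show ?thesis using compose_zero_right by simp
qed

lemma triangle_rotate: "triangle D X Y Z f g h \<Longrightarrow> triangle D Y Z (sho D 1 X) g h (- shm D 1 f)"
  using TR2 triangle_Hom by blast

text \<open>TR3 only produces a map between third vertices, so both triangles are rotated until the
  wanted lift sits there; it is then shifted back, and the two signs from the rotations
  cancel.\<close>

lemma exact_covariant:
  assumes "triangle D X Y Z f g h" "u \<in> Hom D T Y" "g \<cdot> u = 0"
  obtains v where "v \<in> Hom D T X" "u = f \<cdot> v"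
proof -
  obtain N where N: "is_zero_object D N" using zero_object_exists by blast
  note H = triangle_Hom[OF assms(1)]
  have "triangle D T N (sho D 1 T) 0 0 (- shm D 1 (ident D T))"
    by (rule triangle_rotate[OF TR1_ident[OF N]])
  moreover have "g \<cdot> u = 0 \<cdot> 0" using assms(3) compose_zero_left[OF Hom_zero] by simp
  ultimately obtain c where c: "c \<in> Hom D (sho D 1 T) (sho D 1 X)"
      "(- shm D 1 f) \<cdot> c = shm D 1 u \<cdot> (- shm D 1 (ident D T))"
    using TR3[OF _ triangle_rotate[OF assms(1)] assms(2) Hom_zero] by blast
  have "- (shm D 1 f \<cdot> c) = - shm D 1 u"
    using c(2) compose_uminus_left[OF c(1) shm_closed[of f X Y 1]] H
      compose_uminus_right[OF shm_closed[OF ident_closed] shm_closed[OF assms(2)]]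
      shm_compose[OF ident_closed assms(2), of 1] ident_right[OF assms(2)] by simp
  then have e: "shm D 1 u = shm D 1 f \<cdot> c" by simp
  let ?v = "shm D (- 1) c"
  have v: "?v \<in> Hom D T X" using shm_closed[OF c(1), of "- 1"] by simp
  have "u = shm D (- 1) (shm D 1 f \<cdot> c)" using e shm_inverse[OF assms(2), of 1] by simp
  also have "\<dots> = f \<cdot> ?v" using shm_compose[OF c(1) shm_closed] shm_inverse H by metis
  finally show thesis using that v by blast
qed

text \<open>TR3 is applied to a map into the triangle N[-1] -> T -> T with \<open>N\<close> zero,
  obtained from the trivial triangle by rotating backwards.\<close>

lemma exact_contravariant:
  assumes "triangle D X Y Z f g h" "v \<in> Hom D Y T" "v \<cdot> f = 0"
  obtains u where "u \<in> Hom D Z T" "v = u \<cdot> g"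
proof -
  obtain N where N: "is_zero_object D N" using zero_object_exists by blast
  have "triangle D (sho D (- 1) N) T T 0 (ident D T) 0"
    using TR2[of 0 "sho D (- 1) N" T "ident D T" T 0] TR1_ident[OF N] ident_closed by simp
  moreover have "0 \<cdot> 0 = v \<cdot> f" using assms(3) compose_zero_left[OF Hom_zero] by simp
  ultimately obtain c where "c \<in> Hom D Z T" "ident D T \<cdot> v = c \<cdot> g"
    using TR3[OF assms(1) _ Hom_zero assms(2)] by blast
  then show thesis using that ident_left[OF assms(2)] by simp
qed

lemma nonzero_Hom_fiber:
  assumes "triangle D X Y Z f g h" "u \<in> Hom D T Y" "u \<noteq> 0" "g \<cdot> u = 0"
  shows "nonzero_Hom T X"
proof -
  obtain v where "v \<in> Hom D T X" "u = f \<cdot> v" using exact_covariant[OF assms(1,2,4)] .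
  then show ?thesis using nonzero_HomI compose_zero_right triangle_Hom[OF assms(1)] assms(3) by metis
qed

lemma nonzero_Hom_middle:
  assumes "triangle D X Y Z f g h" "nonzero_Hom T Y"
  shows "nonzero_Hom T X \<or> nonzero_Hom T Z"
proof -
  obtain u where u: "u \<in> Hom D T Y" "u \<noteq> 0" using nonzero_HomE[OF assms(2)] .
  show ?thesis
    using nonzero_Hom_fiber[OF assms(1) u] compose_closed[OF u(1)] triangle_Hom[OF assms(1)] nonzero_HomI
    by blast
qed

lemma nonzero_Hom_middle_left:
  assumes "triangle D X Y Z f g h" "nonzero_Hom Y T"
  shows "nonzero_Hom X T \<or> nonzero_Hom Z T"
proof -
  obtain u where u: "u \<in> Hom D Y T" "u \<noteq> 0" using nonzero_HomE[OF assms(2)] .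
  note H = triangle_Hom[OF assms(1)]
  show ?thesis
  proof (cases "u \<cdot> f = 0")
    case True
    then obtain v where "v \<in> Hom D Z T" "u = v \<cdot> g" using exact_contravariant[OF assms(1) u(1)] by blast
    then show ?thesis using nonzero_HomI compose_zero_left H u(2) by metis
  next
    case False
    then show ?thesis using compose_closed[of f X Y u T] u H nonzero_HomI by blast
  qed
qed

lemma nonzero_Hom_cone:
  assumes "triangle D X Y Z f g h" "nonzero_Hom T Z"
  shows "nonzero_Hom T Y \<or> nonzero_Hom T (sho D 1 X)"
  using nonzero_Hom_middle[OF triangle_rotate[OF assms(1)] assms(2)] .

text \<open>The parameter is a set because two families of test objects are compared: a split
  generator alone, and the finitely many objects at which the generators of a semifree bimodule
  sit.\<close>

definition ghost :: "'o set \<Rightarrow> 'o \<Rightarrow> 'o \<Rightarrow> 'm \<Rightarrow> bool" where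
  "ghost S X Y f \<longleftrightarrow> f \<in> Hom D X Y \<and> (\<forall>G\<in>S. \<forall>j. \<forall>u\<in>Hom D (sho D j G) X. f \<cdot> u = 0)"

text \<open>The innermost map of the composite is arbitrary, so \<open>n\<close> is only a lower bound on the number of ghosts.\<close>

inductive ghosts :: "'o set \<Rightarrow> nat \<Rightarrow> 'o \<Rightarrow> 'o \<Rightarrow> 'm \<Rightarrow> bool" for S where
  ghosts_0: "f \<in> Hom D X Y \<Longrightarrow> ghosts S 0 X Y f"
| ghosts_Suc: "ghosts S n X Y f \<Longrightarrow> ghost S Y Z g \<Longrightarrow> ghosts S (Suc n) X Z (g \<cdot> f)"

lemma ghost_closed: "ghost S X Y f \<Longrightarrow> f \<in> Hom D X Y"
  by (simp add: ghost_def)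

lemma ghosts_closed: "ghosts S n X Y f \<Longrightarrow> f \<in> Hom D X Y"
  by (induction rule: ghosts.induct) (auto simp: ghost_def intro: compose_closed)

lemma ghost_shift:
  assumes "ghost S X Y f"
  shows "ghost S (sho D k X) (sho D k Y) (shm D k f)"
  unfolding ghost_def
proof (intro conjI ballI allI)
  have f: "f \<in> Hom D X Y" using assms by (simp add: ghost_def)
  then show "shm D k f \<in> Hom D (sho D k X) (sho D k Y)" by (rule shm_closed)
  fix G j u assume G: "G \<in> S" and u: "u \<in> Hom D (sho D j G) (sho D k X)"
  have u': "shm D (- k) u \<in> Hom D (sho D (- k + j) G) X"
    using shm_closed[OF u, of "- k"] by (simp add: sho_add sho_0)
  then have "f \<cdot> shm D (- k) u = 0" using assms G unfolding ghost_def by blast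
  then have "shm D k (f \<cdot> shm D (- k) u) = 0" by simp
  then show "shm D k f \<cdot> u = 0"
    using shm_compose[OF u' f, of k] shm_add[OF u, of k "- k"] shm_0[OF u] by simp
qed

lemma ghosts_shift: "ghosts S n X Y f \<Longrightarrow> ghosts S n (sho D k X) (sho D k Y) (shm D k f)"
proof (induction rule: ghosts.induct)
  case (ghosts_0 f X Y)
  then show ?case by (intro ghosts.ghosts_0 shm_closed)
next
  case (ghosts_Suc n X Y f Z g)
  then show ?case
    using ghosts.ghosts_Suc[OF ghosts_Suc.IH ghost_shift[OF ghosts_Suc(2)]]
      shm_compose[OF ghosts_closed[OF ghosts_Suc(1)] ghost_closed[OF ghosts_Suc(2)]] by simp
qed

lemma ghosts_mono:
  assumes "ghosts S n X Y f" "m \<le> n"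
  shows "ghosts S m X Y f"
  using assms
proof (induction arbitrary: m rule: ghosts.induct)
  case (ghosts_0 f X Y)
  then show ?case by (simp add: ghosts.ghosts_0)
next
  case (ghosts_Suc n X Y f Z g)
  have gh: "ghosts S (Suc n) X Z (g \<cdot> f)" by (rule ghosts.ghosts_Suc) fact+
  show ?case
  proof (cases m)
    case 0
    then show ?thesis using ghosts.ghosts_0[OF ghosts_closed[OF gh]] by simp
  next
    case (Suc m')
    then show ?thesis
      using ghosts.ghosts_Suc[OF ghosts_Suc.IH[of m'] ghosts_Suc(2)] ghosts_Suc.prems by simp
  qed
qed

lemma ghosts_split:
  assumes "ghosts S (m + n) X Z h"
  obtains Y f g where "ghosts S n X Y f" "ghosts S m Y Z g" "h = g \<cdot> f"
proof -
  have "\<exists>Y f g. ghosts S n X Y f \<and> ghosts S m Y Z g \<and> h = g \<cdot> f"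
    using assms
  proof (induction m arbitrary: Z h)
    case 0
    then show ?case
      using ghosts.ghosts_0[OF ident_closed] ident_left[OF ghosts_closed[OF 0]] by force
  next
    case (Suc m)
    then have "ghosts S (Suc (m + n)) X Z h" by simp
    then obtain W h' k where k: "ghosts S (m + n) X W h'" "ghost S W Z k" "h = k \<cdot> h'"
      by cases blast
    obtain Y f g where *: "ghosts S n X Y f" "ghosts S m Y W g" "h' = g \<cdot> f" using Suc.IH[OF k(1)] by blast
    then show ?case
      using ghosts.ghosts_Suc[OF *(2) k(2)] k(2,3)
        compose_assoc[OF ghosts_closed[OF *(1)] ghosts_closed[OF *(2)]] unfolding ghost_def by metis
  qed
  then show thesis using that by blast
qed

text \<open>The classical ghost lemma: once the first \<open>l\<close> ghosts kill the restriction
  to \<open>A l\<close>, the map on \<open>A (Suc l)\<close> factors through a shift of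
  \<open>G\<close>, and the next ghost kills it.\<close>

lemma ghosts_vanish:
  assumes A0: "is_zero_object D (A 0)"
    and A: "\<And>k. k \<in> {1..m} \<Longrightarrow> \<exists>C f g h. triangle D (A (k - 1)) (A k) C f g h \<and> isomorphic D C (sho D (n k) G)"
    and "l \<le> m" "ghosts {G} l X Y f" "u \<in> Hom D (A l) X"
  shows "f \<cdot> u = 0"
  using assms(3-5)
proof (induction l arbitrary: Y f u)
  case 0
  then have "u = 0" using A0 unfolding is_zero_object_def by blast
  then show ?case using compose_zero_right ghosts_closed[OF 0(2)] by simp
next
  case (Suc l)
  from Suc.prems(2) obtain W f1 f2 where f: "ghosts {G} l X W f1" "ghost {G} W Y f2" "f = f2 \<cdot> f1"
    by cases blast
  have f1: "f1 \<in> Hom D X W" and f2: "f2 \<in> Hom D W Y"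
    using ghosts_closed[OF f(1)] f(2) by (auto simp: ghost_def)
  obtain C a b c where t: "triangle D (A l) (A (Suc l)) C a b c" and iso: "isomorphic D C (sho D (n (Suc l)) G)"
    using A[of "Suc l"] Suc.prems(1) by auto
  note H = triangle_Hom[OF t]
  have fu: "f1 \<cdot> u \<in> Hom D (A (Suc l)) W" by (rule compose_closed[OF Suc.prems(3) f1])
  have a: "a \<in> Hom D (A l) (A (Suc l))" and b: "b \<in> Hom D (A (Suc l)) C" using H by blast+
  have "(f1 \<cdot> u) \<cdot> a = f1 \<cdot> (u \<cdot> a)" using compose_assoc[OF a Suc.prems(3) f1] by simp
  also have "\<dots> = 0" using Suc.IH[OF _ f(1) compose_closed[OF a Suc.prems(3)]] Suc.prems(1) by simp
  finally obtain v where v: "v \<in> Hom D C W" "f1 \<cdot> u = v \<cdot> b" using exact_contravariant[OF t fu] by blast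
  obtain p q where pq: "p \<in> Hom D C (sho D (n (Suc l)) G)" "q \<in> Hom D (sho D (n (Suc l)) G) C" "q \<cdot> p = ident D C"
    using isomorphicE[OF iso] by metis
  have "f2 \<cdot> v = f2 \<cdot> ((v \<cdot> q) \<cdot> p)"
    using compose_assoc[OF pq(1,2) v(1)] pq(3) ident_right[OF v(1)] by simp
  also have "\<dots> = (f2 \<cdot> (v \<cdot> q)) \<cdot> p"
    by (rule compose_assoc[OF pq(1) compose_closed[OF pq(2) v(1)] f2])
  also have "\<dots> = 0"
    using f(2) compose_closed[OF pq(2) v(1)] compose_zero_left[OF pq(1)] unfolding ghost_def by simp
  finally have "f2 \<cdot> v = 0" .
  then have "f2 \<cdot> (v \<cdot> b) = 0" using compose_assoc[OF b v(1) f2] compose_zero_left[OF b] by simp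
  then show ?case using f(3) v(2) compose_assoc[OF Suc.prems(3) f1 f2] by simp
qed

text \<open>\<open>ghosts_vanish\<close> passes to direct summands, and to shifts of
  \<open>E\<close> by shifting the ghosts instead. The number \<open>m\<close> depends on
  \<open>E\<close>, but not on the maps.\<close>

lemma split_generator_ghosts:
  assumes "split_generator D G"
  obtains m where "\<And>X Y f j u. ghosts {G} m X Y f \<Longrightarrow> u \<in> Hom D (sho D j E) X \<Longrightarrow> f \<cdot> u = 0"
proof -
  obtain E' m and A :: "nat \<Rightarrow> 'o" and n where A: "is_zero_object D (A 0)" "is_biproduct D E E' (A m)"
      "\<And>k. k \<in> {1..m} \<Longrightarrow> \<exists>C f g h. triangle D (A (k - 1)) (A k) C f g h \<and> isomorphic D C (sho D (n k) G)"
    using assms[unfolded split_generator_def, rule_format, of E]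
    by (elim exE conjE) (rule that, assumption, assumption, erule bspec)
  obtain i p where ip: "i \<in> Hom D E (A m)" "p \<in> Hom D (A m) E" "p \<cdot> i = ident D E"
    using biproduct_inclusion[OF A(2)] .
  have 0: "f \<cdot> u = 0" if f: "ghosts {G} m X Y f" and u: "u \<in> Hom D E X" for X Y f u
  proof -
    have up: "u \<cdot> p \<in> Hom D (A m) X" by (rule compose_closed[OF ip(2) u])
    have "f \<cdot> u = f \<cdot> ((u \<cdot> p) \<cdot> i)" using compose_assoc[OF ip(1,2) u] ip(3) ident_right[OF u] by simp
    also have "\<dots> = (f \<cdot> (u \<cdot> p)) \<cdot> i" by (rule compose_assoc[OF ip(1) up ghosts_closed[OF f]])
    also have "\<dots> = 0" using ghosts_vanish[OF A(1,3) order.refl f up] compose_zero_left[OF ip(1)] by simp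
    finally show ?thesis .
  qed
  have "f \<cdot> u = 0" if f: "ghosts {G} m X Y f" and u: "u \<in> Hom D (sho D j E) X" for X Y f j u
  proof -
    have u': "shm D (- j) u \<in> Hom D E (sho D (- j) X)" using shm_closed[OF u, of "- j"] by simp
    have "shm D (- j) (f \<cdot> u) = 0"
      using 0[OF ghosts_shift[OF f] u'] shm_compose[OF u ghosts_closed[OF f]] by simp
    then show ?thesis using shm_eq_0[OF compose_closed[OF u ghosts_closed[OF f]]] by simp
  qed
  then show thesis using that by blast
qed

text \<open>Cell attachment as for CW complexes: each step is the map to the cone of a morphism from
  a cell \<open>sho D j G\<close>, so the cell is the fibre of the step.\<close>

inductive cell_map :: "'o \<Rightarrow> int set \<Rightarrow> 'o \<Rightarrow> 'o \<Rightarrow> 'm \<Rightarrow> bool" for G J E where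
  cell_map_ident: "cell_map G J E E (ident D E)"
| cell_map_step: "cell_map G J E E' f \<Longrightarrow> j \<in> J \<Longrightarrow> triangle D (sho D j G) E' E'' x y z \<Longrightarrow>
    cell_map G J E E'' (y \<cdot> f)"

lemma cell_map_closed: "cell_map G J E E' f \<Longrightarrow> f \<in> Hom D E E'"
  by (induction rule: cell_map.induct) (auto intro: ident_closed compose_closed dest: triangle_Hom)

lemma cell_map_mono: "cell_map G J E E' f \<Longrightarrow> J \<subseteq> J' \<Longrightarrow> cell_map G J' E E' f"
  by (induction rule: cell_map.induct) (auto intro: cell_map.intros)

lemma cell_map_compose:
  assumes "cell_map G J E' E'' g" "cell_map G J E E' f"
  shows "cell_map G J E E'' (g \<cdot> f)"
  using assms
proof (induction rule: cell_map.induct)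
  case cell_map_ident
  then show ?case using ident_left[OF cell_map_closed[OF cell_map_ident]] by simp
next
  case (cell_map_step E1 g j E2 x y z)
  then have "cell_map G J E E1 (g \<cdot> f)" by simp
  from cell_map.cell_map_step[OF this cell_map_step(2,3)]
  show ?case
    using compose_assoc[OF cell_map_closed[OF cell_map_step(5)] cell_map_closed[OF cell_map_step(1)]]
      triangle_Hom[OF cell_map_step(3)] by metis
qed

text \<open>Attaching a cell of degree \<open>j\<close> can create new maps only through
  \<open>sho D (j + 1) G\<close>, the next vertex of the rotated triangle.\<close>

lemma cell_map_nonzero_Hom:
  assumes "cell_map G J E E' f" "nonzero_Hom T E'"
  shows "nonzero_Hom T E \<or> (\<exists>j\<in>J. nonzero_Hom T (sho D (j + 1) G))"
  using assms
proof (induction rule: cell_map.induct)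
  case (cell_map_step E1 f j E2 x y z)
  then show ?case
    using nonzero_Hom_cone[OF cell_map_step(3,5)] by (auto simp: sho_add add.commute)
qed simp

text \<open>Morphisms are coned off one at a time; those already killed stay killed, since later
  steps only compose on the left.\<close>

lemma cell_map_kills_finite:
  assumes "finite S" "\<And>j u. (j, u) \<in> S \<Longrightarrow> j \<in> J \<and> u \<in> Hom D (sho D j G) E"
  shows "\<exists>E' f. cell_map G J E E' f \<and> (\<forall>(j, u)\<in>S. f \<cdot> u = 0)"
  using assms
proof (induction S rule: finite_induct)
  case empty
  then show ?case using cell_map_ident by blast
next
  case (insert x S)
  obtain j u where x: "x = (j, u)" by (cases x)
  have ju: "j \<in> J" "u \<in> Hom D (sho D j G) E" using insert.prems x by auto
  obtain E' f where f: "cell_map G J E E' f" "\<forall>(j, u)\<in>S. f \<cdot> u = 0"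
    using insert.IH insert.prems by blast
  note fm = cell_map_closed[OF f(1)]
  obtain E'' g h where t: "triangle D (sho D j G) E' E'' (f \<cdot> u) g h"
    using TR1_complete[OF compose_closed[OF ju(2) fm]] by blast
  have g: "g \<in> Hom D E' E''" using triangle_Hom[OF t] by blast
  have "(g \<cdot> f) \<cdot> u = 0"
    using triangle_compose_zero[OF t] compose_assoc[OF ju(2) fm g] by simp
  moreover have "(g \<cdot> f) \<cdot> u' = 0" if "(j', u') \<in> S" for j' u'
  proof -
    have "f \<cdot> u' = 0" using f(2) that by blast
    moreover have "u' \<in> Hom D (sho D j' G) E" using insert.prems that by blast
    ultimately show ?thesis using compose_assoc[OF _ fm g, of u' "sho D j' G"] compose_zero_right[OF g] by simp
  qed
  ultimately show ?case using cell_map_step[OF f(1) ju(1) t] x by blast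
qed

lemma finite_nonzero_Hom:
  assumes "finite_type D"
  shows "finite {k. nonzero_Hom (sho D k G) E}"
proof -
  have "{k. nonzero_Hom (sho D k G) E} \<subseteq> uminus ` {i. Hom D G (sho D i E) \<noteq> {0}}"
  proof
    fix k assume "k \<in> {k. nonzero_Hom (sho D k G) E}"
    then have "- k \<in> {i. Hom D G (sho D i E) \<noteq> {0}}"
      using nonzero_Hom_shift_left unfolding nonzero_Hom_def by blast
    then show "k \<in> uminus ` {i. Hom D G (sho D i E) \<noteq> {0}}" by (metis image_eqI minus_minus)
  qed
  then show ?thesis using assms unfolding finite_type_def by (meson finite_imageI finite_subset)
qed

text \<open>Finite type leaves finitely many degrees and a finite basis in each, and killing the
  bases kills everything by linearity.\<close>

lemma ghost_cell_map_exists: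
  assumes "finite_type D" "\<And>j. nonzero_Hom (sho D j G) E \<Longrightarrow> j \<in> J"
  obtains E' f where "cell_map G J E E' f" "ghost {G} E E' f"
proof -
  let ?J = "{j. nonzero_Hom (sho D j G) E}"
  have finJ: "finite ?J" by (rule finite_nonzero_Hom[OF assms(1)])
  \<comment> \<open>\<open>finite_type\<close> provides a finite spanning set that need not lie in
    the Hom space, so a basis inside that space is chosen and bounded by it.\<close>
  have fd: "\<exists>B. finite B \<and> B \<subseteq> Hom D (sho D j G) E \<and> Hom D (sho D j G) E \<subseteq> hm.span B" for j
  proof -
    obtain B0 where B0: "finite B0" "Hom D (sho D j G) (sho D 0 E) \<subseteq> hm.span B0"
      using assms(1) unfolding finite_type_def by metis
    obtain B where B: "B \<subseteq> Hom D (sho D j G) E" "\<not> hm.dependent B" "Hom D (sho D j G) E \<subseteq> hm.span B"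
      using hm.maximal_independent_subset[of "Hom D (sho D j G) E"] by metis
    then have "finite B" using hm.independent_span_bound[OF B0(1) B(2)] B0(2) by (auto simp: sho_0)
    then show ?thesis using B by blast
  qed
  then obtain B where B: "\<And>j. finite (B j)" "\<And>j. B j \<subseteq> Hom D (sho D j G) E"
      "\<And>j. Hom D (sho D j G) E \<subseteq> hm.span (B j)" by metis
  have "finite (Sigma ?J B)" using finJ B(1) by blast
  then obtain E' f where f: "cell_map G J E E' f" "\<forall>(j, u)\<in>Sigma ?J B. f \<cdot> u = 0"
    using cell_map_kills_finite[of "Sigma ?J B" J G E] assms(2) B(2) by blast
  note fm = cell_map_closed[OF f(1)]
  have "f \<cdot> u = 0" if u: "u \<in> Hom D (sho D j G) E" for j u
  proof (cases "u = 0")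
    case True
    then show ?thesis using compose_zero_right[OF fm] by simp
  next
    case False
    then have j: "j \<in> ?J" using nonzero_HomI[OF u] by simp
    have "u \<in> hm.span (B j)" using B(3) u by blast
    then have "u \<in> Hom D (sho D j G) E \<and> f \<cdot> u = 0"
    proof (induction rule: hm.span_induct_alt)
      case base
      then show ?case using compose_zero_right[OF fm] by simp
    next
      case (step c x y)
      then have x: "x \<in> Hom D (sho D j G) E" "f \<cdot> x = 0" using B(2) f(2) j by auto
      have cx: "smul D c x \<in> Hom D (sho D j G) E" by (rule hm.subspace_scale[OF subspace_Hom x(1)])
      have "f \<cdot> smul D c x = 0" using linear_onD(2)[OF compose_linear_right[OF fm] x(1)] x(2) by simp
      then show ?case
        using compose_add_right[OF cx _ fm] step hm.subspace_add[OF subspace_Hom cx] by simp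
    qed
    then show ?thesis by blast
  qed
  then have "ghost {G} E E' f" unfolding ghost_def using fm by simp
  then show thesis using that f(1) by blast
qed

text \<open>Each round attaches cells in degrees still to be killed and may create new ones: a cell
  of degree i contributes Hom(G[j], G[i + 1]). These are at distance at most \<open>c\<close> from
  i, because \<open>c\<close> bounds the degrees of shifted self-maps of \<open>G\<close> plus one
  for the cone.\<close>

lemma ghosts_cell_map_exists:
  assumes ft: "finite_type D" and c: "\<And>j. nonzero_Hom (sho D j G) G \<Longrightarrow> \<bar>j\<bar> + 1 \<le> c" "0 \<le> c"
    and "\<And>j. nonzero_Hom (sho D j G) E \<Longrightarrow> j \<in> {a..b}"
  shows "\<exists>E' f. cell_map G {a - int m * c..b + int m * c} E E' f \<and> ghosts {G} m E E' f \<and>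
    (\<forall>j. nonzero_Hom (sho D j G) E' \<longrightarrow> j \<in> {a - int m * c..b + int m * c})"
proof (induction m)
  case 0
  then show ?case using cell_map_ident[of G "{a..b}" E] ghosts_0[OF ident_closed] assms(4) by force
next
  case (Suc m)
  let ?J = "{a - int m * c..b + int m * c}"
  let ?J' = "{a - int (Suc m) * c..b + int (Suc m) * c}"
  have sub: "?J \<subseteq> ?J'" using c(2) by (auto simp: algebra_simps)
  obtain E1 f where f: "cell_map G ?J E E1 f" "ghosts {G} m E E1 f"
      "\<And>j. nonzero_Hom (sho D j G) E1 \<Longrightarrow> j \<in> ?J" using Suc by blast
  obtain E2 g where g: "cell_map G ?J E1 E2 g" "ghost {G} E1 E2 g"
    using ghost_cell_map_exists[OF ft f(3)] by blast
  have "j \<in> ?J'" if "nonzero_Hom (sho D j G) E2" for j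
  proof -
    have "j \<in> ?J \<or> (\<exists>i\<in>?J. nonzero_Hom (sho D j G) (sho D (i + 1) G))"
      using cell_map_nonzero_Hom[OF g(1) that] f(3) by blast
    then show ?thesis
    proof
      assume "\<exists>i\<in>?J. nonzero_Hom (sho D j G) (sho D (i + 1) G)"
      then obtain i where i: "i \<in> ?J" "nonzero_Hom (sho D j G) (sho D (i + 1) G)" by blast
      then have "nonzero_Hom (sho D (j - (i + 1)) G) G"
        using nonzero_Hom_shift[of "- (i + 1)" "sho D j G" "sho D (i + 1) G"] by (simp add: sho_add sho_0 algebra_simps)
      from c(1)[OF this] i(1) show ?thesis by (auto simp: algebra_simps)
    qed (use sub in blast)
  qed
  then show ?case
    using cell_map_mono[OF cell_map_compose[OF g(1) f(1)] sub] ghosts_Suc[OF f(2) g(2)] by blast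
qed

text \<open>
  Nothing is required of the third morphism \<open>h'\<close>, so that exactness passes to powers at once.
\<close>

definition exact_functor :: "('o \<Rightarrow> 'o) \<Rightarrow> ('m \<Rightarrow> 'm) \<Rightarrow> bool" where
  "exact_functor Fo Fm \<longleftrightarrow> linear_functor D Fo Fm \<and>
     (\<forall>X Y Z f g h. triangle D X Y Z f g h \<longrightarrow>
        (\<exists>h'. triangle D (Fo X) (Fo Y) (Fo Z) (Fm f) (Fm g) h')) \<and>
     (\<forall>X. isomorphic D (Fo (sho D 1 X)) (sho D 1 (Fo X)))"

lemma triangulated_functor_exact: "triangulated_functor D Fo Fm \<Longrightarrow> exact_functor Fo Fm"
  unfolding triangulated_functor_def exact_functor_def isomorphic_def by blast

lemma exact_functor_id: "exact_functor id id"
  unfolding exact_functor_def using linear_functor_id isomorphic_refl by auto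

lemma exact_functor_compose:
  assumes F: "exact_functor Fo Fm" and G: "exact_functor Go Gm"
  shows "exact_functor (Fo \<circ> Go) (Fm \<circ> Gm)"
  unfolding exact_functor_def
proof (intro conjI allI impI)
  show "linear_functor D (Fo \<circ> Go) (Fm \<circ> Gm)"
    using F G linear_functor_compose unfolding exact_functor_def by blast
  show "\<exists>h'. triangle D ((Fo \<circ> Go) X) ((Fo \<circ> Go) Y) ((Fo \<circ> Go) Z) ((Fm \<circ> Gm) f) ((Fm \<circ> Gm) g) h'"
    if "triangle D X Y Z f g h" for X Y Z f g h
    using that F G unfolding exact_functor_def by fastforce
  show "isomorphic D ((Fo \<circ> Go) (sho D 1 X)) (sho D 1 ((Fo \<circ> Go) X))" for X
  proof -
    have "isomorphic D (Fo (Go (sho D 1 X))) (Fo (sho D 1 (Go X)))"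
      using F G linear_functor_isomorphic unfolding exact_functor_def by blast
    moreover have "isomorphic D (Fo (sho D 1 (Go X))) (sho D 1 (Fo (Go X)))"
      using F unfolding exact_functor_def by blast
    ultimately show ?thesis using isomorphic_trans by auto
  qed
qed

lemma exact_functor_power: "exact_functor Fo Fm \<Longrightarrow> exact_functor (Fo ^^ n) (Fm ^^ n)"
  by (induction n) (auto intro: exact_functor_id exact_functor_compose)

lemma exact_functor_shift:
  assumes F: "exact_functor Fo Fm"
  shows "isomorphic D (Fo (sho D j X)) (sho D j (Fo X))"
proof (induction j arbitrary: X rule: int_induct[where k = 0])
  case base
  then show ?case by (simp add: sho_0 isomorphic_refl)
next
  case (step1 i)
  have "isomorphic D (Fo (sho D 1 (sho D i X))) (sho D 1 (Fo (sho D i X)))"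
    using F unfolding exact_functor_def by blast
  from isomorphic_trans[OF this isomorphic_shift[OF step1(2), of 1]]
  show ?case by (simp add: sho_add add.commute)
next
  case (step2 i)
  have "isomorphic D (Fo (sho D 1 (sho D (i - 1) X))) (sho D 1 (Fo (sho D (i - 1) X)))"
    using F unfolding exact_functor_def by blast
  then have "isomorphic D (sho D 1 (Fo (sho D (i - 1) X))) (sho D i (Fo X))"
    using isomorphic_trans[OF isomorphic_sym step2(2)] by (simp add: sho_add)
  from isomorphic_shift[OF this, of "- 1"] show ?case by (simp add: sho_add sho_0)
qed

text \<open>Along the cells the image of \<open>u\<close> becomes zero at some step; just before, it
  is nonzero and therefore lifts to a nonzero map into the fibre \<open>Fo (sho D j G)\<close> of
  that step.\<close>

lemma cell_map_detects:
  assumes F: "exact_functor Fo Fm"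
    and "cell_map G J E E' f" "u \<in> Hom D T (Fo E)" "u \<noteq> 0" "Fm f \<cdot> u = 0"
  shows "\<exists>j\<in>J. nonzero_Hom (sho D (- j) T) (Fo G)"
  using assms(2,5)
proof (induction rule: cell_map.induct)
  have lf: "linear_functor D Fo Fm" using F unfolding exact_functor_def by blast
  {
    case cell_map_ident
    then show ?case using assms(3,4) linear_functorD(3)[OF lf] ident_left by simp
  next
    case (cell_map_step E1 f j E2 x y z)
    note H = triangle_Hom[OF cell_map_step(3)]
    note f = cell_map_closed[OF cell_map_step(1)]
    have Fu: "Fm f \<cdot> u \<in> Hom D T (Fo E1)"
      by (rule compose_closed[OF assms(3) linear_functorD(1)[OF lf f]])
    show ?case
    proof (cases "Fm f \<cdot> u = 0")
      case True
      then show ?thesis using cell_map_step.IH by blast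
    next
      case False
      obtain h' where t: "triangle D (Fo (sho D j G)) (Fo E1) (Fo E2) (Fm x) (Fm y) h'"
        using F cell_map_step(3) unfolding exact_functor_def by blast
      have "Fm y \<cdot> (Fm f \<cdot> u) = 0"
        using cell_map_step(5) linear_functorD(4)[OF lf f] H
          compose_assoc[OF assms(3) linear_functorD(1)[OF lf f] linear_functorD(1)[OF lf]] by metis
      then have "nonzero_Hom T (Fo (sho D j G))" using nonzero_Hom_fiber[OF t Fu False] by blast
      then have "nonzero_Hom T (sho D j (Fo G))"
        using nonzero_Hom_iso_right exact_functor_shift[OF F] by blast
      then show ?thesis using cell_map_step(2) nonzero_Hom_shift_left[of "- j" T "Fo G"] by auto
    qed
  }
qed

text \<open>Extend \<open>v\<close> over one cell after another. The first obstruction is a nonzero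
  map from some \<open>sho D j G\<close>; without obstruction \<open>v\<close> would factor through
  \<open>f\<close>. The condition \<open>f = 0\<close> stays separate so that the induction runs
  over all cell maps.\<close>

lemma cell_map_detects_left:
  assumes "cell_map G J E E' f" "v \<in> Hom D E T" "v \<noteq> 0" "f = 0"
  shows "\<exists>j\<in>J. nonzero_Hom (sho D j G) T"
proof -
  have "(\<exists>j\<in>J. nonzero_Hom (sho D j G) T) \<or> (\<exists>v'\<in>Hom D E' T. v = v' \<cdot> f)"
    using assms(1)
  proof (induction rule: cell_map.induct)
    case cell_map_ident
    then show ?case using assms(2) ident_right[OF assms(2)] by metis
  next
    case (cell_map_step E1 f j E2 x y z)
    note H = triangle_Hom[OF cell_map_step(3)]
    note f = cell_map_closed[OF cell_map_step(1)]
    from cell_map_step.IH show ?case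
    proof
      assume "\<exists>v'\<in>Hom D E1 T. v = v' \<cdot> f"
      then obtain v' where v': "v' \<in> Hom D E1 T" "v = v' \<cdot> f" by blast
      show ?thesis
      proof (cases "v' \<cdot> x = 0")
        case True
        then obtain v'' where "v'' \<in> Hom D E2 T" "v' = v'' \<cdot> y"
          using exact_contravariant[OF cell_map_step(3) v'(1)] by blast
        then show ?thesis using v'(2) compose_assoc[OF f] H by metis
      next
        case False
        then show ?thesis using compose_closed[OF _ v'(1)] H nonzero_HomI cell_map_step(2) by blast
      qed
    qed blast
  qed
  then show ?thesis using assms(3,4) compose_zero_right by auto
qed

end


section \<open>The ghost lemma for saturated categories\<close>

context dg_category
begin

lemma dident_cocycle: "dident C X \<in> cocycles C X X 0"
proof -
  note d = ddiff_closed[OF dident_closed, of X]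
  have "ddiff C (dident C X) = ddiff C (dident C X) + ddiff C (dident C X)"
    using ddiff_dcompose[OF dident_closed dident_closed, of X]
      dident_right[OF d] dident_left[OF d] dident_left[OF dident_closed, of X]
    by (simp add: koszul_def)
  then show ?thesis using dident_closed by (simp add: cocycles_def)
qed

lemma cocycles_compose:
  assumes "f \<in> cocycles C X Y i" "g \<in> cocycles C Y Z j"
  shows "g \<odot> f \<in> cocycles C X Z (j + i)"
proof -
  have f: "f \<in> dHom C X Y i" "ddiff C f = 0" and g: "g \<in> dHom C Y Z j" "ddiff C g = 0"
    using assms by (auto simp: cocycles_def)
  have "0 \<odot> f = 0" using linear_on_zero[OF dcompose_linear_left[OF f(1)]] dHom_zero by blast
  moreover have "g \<odot> 0 = 0" using linear_on_zero[OF dcompose_linear_right[OF g(1)]] dHom_zero by blast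
  ultimately show ?thesis
    using dcompose_closed[OF f(1) g(1)] ddiff_dcompose[OF f(1) g(1)] f(2) g(2)
    by (simp add: cocycles_def koszul_def)
qed

lemma coboundaries_compose:
  assumes "f \<in> cocycles C X Y i" "g \<in> coboundaries C Y Z j"
  shows "g \<odot> f \<in> coboundaries C X Z (j + i)"
proof -
  have f: "f \<in> dHom C X Y i" "ddiff C f = 0" using assms by (auto simp: cocycles_def)
  obtain e where e: "e \<in> dHom C Y Z (j - 1)" "g = ddiff C e" using assms(2) by (auto simp: coboundaries_def)
  have "e \<odot> 0 = 0" using linear_on_zero[OF dcompose_linear_right[OF e(1)]] dHom_zero by blast
  then have "g \<odot> f = ddiff C (e \<odot> f)"
    using ddiff_dcompose[OF f(1) e(1)] f(2) e(2) by (simp add: koszul_def)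
  moreover have "e \<odot> f \<in> dHom C X Z (j + i - 1)"
    using dcompose_closed[OF f(1) e(1)] by (simp add: algebra_simps)
  ultimately show ?thesis by (auto simp: coboundaries_def)
qed

end

lemma fg_semifree_bimodule:
  assumes "fg_semifree C P"
  obtains r A B n w where "semifree_bimodule C P r A B n w"
proof -
  have P: "dg_bimodule C P" using assms unfolding fg_semifree_def by blast
  obtain r :: nat and A B n w where
      1: "\<forall>k<r. w k \<in> bHom P (A k) (B k) (n k)"
    and 2: "\<forall>k<r. bdiff P (w k) \<in> module.span (bsmul P) (generated_by C P A B n w k (A k) (B k) (n k + 1))"
    and 3: "\<forall>X Y m. bHom P X Y m \<subseteq> module.span (bsmul P) (generated_by C P A B n w r X Y m)"
    and 4: "\<forall>X Y m J T \<gamma>.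
           finite J \<longrightarrow>
           (\<forall>k<r. \<forall>j\<in>J. finite (T k j) \<and> T k j \<subseteq> dHom C (B k) Y j \<and>
              \<not> module.dependent (dsmul C) (T k j)) \<longrightarrow>
           (\<forall>k<r. \<forall>j\<in>J. \<forall>t\<in>T k j. \<gamma> k j t \<in> dHom C X (A k) (m - n k - j)) \<longrightarrow>
           (\<Sum>k<r. \<Sum>j\<in>J. \<Sum>t\<in>T k j. lact P t (ract P (w k) (\<gamma> k j t))) = 0 \<longrightarrow>
           (\<forall>k<r. \<forall>j\<in>J. \<forall>t\<in>T k j. \<gamma> k j t = 0)"
    using assms unfolding fg_semifree_def by (elim conjE exE) (rule that, assumption+)
  have "semifree_bimodule C P r A B n w"
  proof (rule semifree_bimodule.intro[OF P], rule semifree_bimodule_axioms.intro)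
    show "bHom P X Y m \<subseteq> module.span (bsmul P) (generated_by C P A B n w r X Y m)" for X Y m
      using 3 by blast
    fix J T Y \<gamma> X m k j t
    assume "finite J"
      "\<And>k j. k < r \<Longrightarrow> j \<in> J \<Longrightarrow> finite (T k j) \<and> T k j \<subseteq> dHom C (B k) Y j \<and>
        \<not> module.dependent (dsmul C) (T k j)"
      "\<And>k j t. k < r \<Longrightarrow> j \<in> J \<Longrightarrow> t \<in> T k j \<Longrightarrow> \<gamma> k j t \<in> dHom C X (A k) (m - n k - j)"
      "(\<Sum>k<r. \<Sum>j\<in>J. \<Sum>t\<in>T k j. lact P t (ract P (w k) (\<gamma> k j t))) = 0"
    then have "\<forall>k<r. \<forall>j\<in>J. \<forall>t\<in>T k j. \<gamma> k j t = 0"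
      by (intro 4[THEN spec, THEN spec, THEN spec, THEN spec, THEN spec, THEN spec,
        THEN mp, THEN mp, THEN mp, THEN mp]) auto
    then show "k < r \<Longrightarrow> j \<in> J \<Longrightarrow> t \<in> T k j \<Longrightarrow> \<gamma> k j t = 0" by blast
  qed (use 1 2 in auto)
  then show thesis by (rule that)
qed

section \<open>Translating ghosts into cocycles of a dg enhancement\<close>

locale enhanced_triangulated_category = triangulated_category D
  for D :: "('k::field, 'o, 'm::ab_group_add, 'z) tricat_scheme" (structure) +
  fixes C :: "('k, 'e, 'c::ab_group_add, 'y) dgcat_scheme" and \<Phi>o :: "'e \<Rightarrow> 'o" and \<Phi>m :: "'c \<Rightarrow> 'm"
  assumes enhancement: "dg_enhancement C D \<Phi>o \<Phi>m"
begin

sublocale dg_category C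
  using enhancement unfolding dg_enhancement_def by blast

lemma enhancement_facts:
  shows "pretriangulated C"
    and "\<forall>X Y. linear_on (dsmul C) (smul D) (cocycles C X Y 0) \<Phi>m"
    and "\<forall>X Y. \<Phi>m ` cocycles C X Y 0 = Hom D (\<Phi>o X) (\<Phi>o Y)"
    and "\<forall>X Y. \<forall>f\<in>cocycles C X Y 0. \<Phi>m f = 0 \<longleftrightarrow> f \<in> coboundaries C X Y 0"
    and "\<forall>X Y Z. \<forall>f\<in>cocycles C X Y 0. \<forall>g\<in>cocycles C Y Z 0. \<Phi>m (g \<odot>\<^bsub>C\<^esub> f) = \<Phi>m g \<cdot> \<Phi>m f"
    and "\<forall>E. \<exists>X. isomorphic D (\<Phi>o X) E"
    and "\<exists>\<theta>. \<forall>X X' s. dg_shift C X X' s \<longrightarrow> is_iso_mor D (\<Phi>o X') (sho D 1 (\<Phi>o X)) (\<theta> X X' s)"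
proof -
  note e = enhancement[unfolded dg_enhancement_def, THEN conjunct2]
  show "pretriangulated C" by (rule e[THEN conjunct1])
  note e = e[THEN conjunct2]
  show "\<forall>X Y. linear_on (dsmul C) (smul D) (cocycles C X Y 0) \<Phi>m" by (rule e[THEN conjunct1])
  note e = e[THEN conjunct2]
  show "\<forall>X Y. \<Phi>m ` cocycles C X Y 0 = Hom D (\<Phi>o X) (\<Phi>o Y)" by (rule e[THEN conjunct1])
  note e = e[THEN conjunct2]
  show "\<forall>X Y. \<forall>f\<in>cocycles C X Y 0. \<Phi>m f = 0 \<longleftrightarrow> f \<in> coboundaries C X Y 0"
    by (rule e[THEN conjunct1])
  note e = e[THEN conjunct2, THEN conjunct2]
  show "\<forall>X Y Z. \<forall>f\<in>cocycles C X Y 0. \<forall>g\<in>cocycles C Y Z 0. \<Phi>m (g \<odot>\<^bsub>C\<^esub> f) = \<Phi>m g \<cdot> \<Phi>m f"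
    by (rule e[THEN conjunct1])
  note e = e[THEN conjunct2]
  show "\<forall>E. \<exists>X. isomorphic D (\<Phi>o X) E" by (rule e[THEN conjunct1])
  from e[THEN conjunct2]
  show "\<exists>\<theta>. \<forall>X X' s. dg_shift C X X' s \<longrightarrow> is_iso_mor D (\<Phi>o X') (sho D 1 (\<Phi>o X)) (\<theta> X X' s)"
    by (elim exE conjE) (rule exI)
qed

lemma \<Phi>_mem: "f \<in> cocycles C X Y 0 \<Longrightarrow> \<Phi>m f \<in> Hom D (\<Phi>o X) (\<Phi>o Y)"
  using enhancement_facts(3) by blast

lemma \<Phi>_lift:
  assumes "f \<in> Hom D (\<Phi>o X) (\<Phi>o Y)"
  obtains \<phi> where "\<phi> \<in> cocycles C X Y 0" "\<Phi>m \<phi> = f"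
proof -
  have "f \<in> \<Phi>m ` cocycles C X Y 0" using assms enhancement_facts(3) by simp
  then show thesis using that by blast
qed

lemma \<Phi>_eq_0: "f \<in> cocycles C X Y 0 \<Longrightarrow> \<Phi>m f = 0 \<longleftrightarrow> f \<in> coboundaries C X Y 0"
  using enhancement_facts(4) by blast

lemma \<Phi>_compose:
  "f \<in> cocycles C X Y 0 \<Longrightarrow> g \<in> cocycles C Y Z 0 \<Longrightarrow> \<Phi>m (g \<odot>\<^bsub>C\<^esub> f) = \<Phi>m g \<cdot> \<Phi>m f"
  using enhancement_facts(5) by blast

lemma \<Phi>_surj: obtains X where "isomorphic D (\<Phi>o X) E"
  using enhancement_facts(6) by blast

lemma subspace_cocycles: "dg.subspace (cocycles C X Y i)"
  unfolding dg.subspace_def cocycles_def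
  using linear_onD[OF ddiff_linear] by (auto intro: dHom_add dHom_scale)

lemma \<Phi>_diff:
  assumes "f \<in> cocycles C X Y 0" "g \<in> cocycles C X Y 0"
  shows "\<Phi>m (f - g) = \<Phi>m f - \<Phi>m g"
  by (rule linear_on_diff[OF enhancement_facts(2)[rule_format] vector_space_dsmul subspace_cocycles assms])

lemma dg_shift_isomorphic: "dg_shift C X X' s \<Longrightarrow> isomorphic D (\<Phi>o X') (sho D 1 (\<Phi>o X))"
  using enhancement_facts(7) unfolding isomorphic_def by blast

text \<open>Exhibits \<open>X'\<close> as the shift X[i] inside \<open>C\<close> for an arbitrary
  integer i, extending \<open>dg_shift\<close>. It trades cocycles of any degree for cocycles of
  degree 0, where \<open>\<Phi>m\<close> has meaning.\<close>

definition inverse_cocycles where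
  "inverse_cocycles X X' i s t \<longleftrightarrow> s \<in> cocycles C X X' (- i) \<and> t \<in> cocycles C X' X i \<and>
    t \<odot>\<^bsub>C\<^esub> s = dident C X \<and> s \<odot>\<^bsub>C\<^esub> t = dident C X'"

lemma inverse_cocycles_compose:
  assumes "inverse_cocycles X X' i s t" "inverse_cocycles X' X'' j s' t'"
  shows "inverse_cocycles X X'' (i + j) (s' \<odot>\<^bsub>C\<^esub> s) (t \<odot>\<^bsub>C\<^esub> t')"
proof -
  have 1: "s \<in> cocycles C X X' (- i)" "t \<in> cocycles C X' X i"
      "t \<odot>\<^bsub>C\<^esub> s = dident C X" "s \<odot>\<^bsub>C\<^esub> t = dident C X'"
    and 2: "s' \<in> cocycles C X' X'' (- j)" "t' \<in> cocycles C X'' X' j"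
      "t' \<odot>\<^bsub>C\<^esub> s' = dident C X'" "s' \<odot>\<^bsub>C\<^esub> t' = dident C X''"
    using assms unfolding inverse_cocycles_def by auto
  have m: "s \<in> dHom C X X' (- i)" "t \<in> dHom C X' X i" "s' \<in> dHom C X' X'' (- j)" "t' \<in> dHom C X'' X' j"
    using 1(1,2) 2(1,2) by (auto simp: cocycles_def)
  have "(t \<odot>\<^bsub>C\<^esub> t') \<odot>\<^bsub>C\<^esub> (s' \<odot>\<^bsub>C\<^esub> s) = t \<odot>\<^bsub>C\<^esub> ((t' \<odot>\<^bsub>C\<^esub> s') \<odot>\<^bsub>C\<^esub> s)"
    using dcompose_assoc[OF dcompose_closed[OF m(1,3)] m(4,2)] dcompose_assoc[OF m(1,3,4)] by simp
  also have "\<dots> = dident C X" using 1(3) 2(3) dident_left[OF m(1)] by simp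
  finally have "(t \<odot>\<^bsub>C\<^esub> t') \<odot>\<^bsub>C\<^esub> (s' \<odot>\<^bsub>C\<^esub> s) = dident C X" .
  moreover have "(s' \<odot>\<^bsub>C\<^esub> s) \<odot>\<^bsub>C\<^esub> (t \<odot>\<^bsub>C\<^esub> t') = s' \<odot>\<^bsub>C\<^esub> ((s \<odot>\<^bsub>C\<^esub> t) \<odot>\<^bsub>C\<^esub> t')"
    using dcompose_assoc[OF dcompose_closed[OF m(4,2)] m(1,3)] dcompose_assoc[OF m(4,2,1)] by simp
  moreover have "\<dots> = dident C X''" using 1(4) 2(4) dident_left[OF m(4)] by simp
  ultimately show ?thesis
    unfolding inverse_cocycles_def
    using cocycles_compose[OF 1(1) 2(1)] cocycles_compose[OF 2(2) 1(2)] by (simp add: add.commute)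
qed

lemma inverse_cocycles_sym: "inverse_cocycles X X' i s t \<Longrightarrow> inverse_cocycles X' X (- i) t s"
  unfolding inverse_cocycles_def by simp

lemma shift_exists:
  "\<exists>X' s t. inverse_cocycles X X' i s t \<and> isomorphic D (\<Phi>o X') (sho D i (\<Phi>o X))"
proof (induction i rule: int_induct[where k = 0])
  case base
  have "inverse_cocycles X X 0 (dident C X) (dident C X)"
    unfolding inverse_cocycles_def using dident_cocycle dident_left[OF dident_closed] by simp
  then show ?case using isomorphic_refl by (metis sho_0)
next
  case (step1 i)
  then obtain X' s t where X': "inverse_cocycles X X' i s t" "isomorphic D (\<Phi>o X') (sho D i (\<Phi>o X))" by blast
  obtain X'' s' where sh: "dg_shift C X' X'' s'"
    using enhancement_facts(1) unfolding pretriangulated_def by blast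
  then obtain t' where "inverse_cocycles X' X'' 1 s' t'"
    unfolding dg_shift_def inverse_cocycles_def by auto
  then have "inverse_cocycles X X'' (i + 1) (s' \<odot>\<^bsub>C\<^esub> s) (t \<odot>\<^bsub>C\<^esub> t')"
    by (rule inverse_cocycles_compose[OF X'(1)])
  moreover have "isomorphic D (\<Phi>o X'') (sho D (i + 1) (\<Phi>o X))"
    using isomorphic_trans[OF dg_shift_isomorphic[OF sh] isomorphic_shift[OF X'(2), of 1]]
    by (simp add: sho_add add.commute)
  ultimately show ?case by blast
next
  case (step2 i)
  then obtain X' s t where X': "inverse_cocycles X X' i s t" "isomorphic D (\<Phi>o X') (sho D i (\<Phi>o X))" by blast
  obtain X'' s' where sh: "dg_shift C X'' X' s'"
    using enhancement_facts(1) unfolding pretriangulated_def by blast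
  then obtain t' where "inverse_cocycles X'' X' 1 s' t'"
    unfolding dg_shift_def inverse_cocycles_def by auto
  from inverse_cocycles_compose[OF X'(1) inverse_cocycles_sym[OF this]]
  have "inverse_cocycles X X'' (i - 1) (t' \<odot>\<^bsub>C\<^esub> s) (t \<odot>\<^bsub>C\<^esub> s')" by simp
  moreover have "isomorphic D (\<Phi>o X'') (sho D (i - 1) (\<Phi>o X))"
    using isomorphic_shift[OF isomorphic_trans[OF isomorphic_sym[OF dg_shift_isomorphic[OF sh]] X'(2)], of "- 1"]
    by (simp add: sho_add sho_0)
  ultimately show ?case by blast
qed

text \<open>The enhancement sees only degree 0, so \<open>b\<close> is composed with the invertible
  cocycle \<open>t\<close> from the shift \<open>B'\<close> of \<open>B\<close>. The ghost kills the
  result in \<open>D\<close>, hence it is a coboundary, and composing with \<open>s\<close> recovers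
  the claim for \<open>b\<close>.\<close>

lemma ghost_cohomology_zero:
  assumes "ghost S (\<Phi>o Y) (\<Phi>o Y') (\<Phi>m \<phi>)" "\<Phi>o B \<in> S" and \<phi>: "\<phi> \<in> cocycles C Y Y' 0"
    and b: "b \<in> cocycles C B Y j"
  shows "\<phi> \<odot>\<^bsub>C\<^esub> b \<in> coboundaries C B Y' j"
proof -
  obtain B' s t where "inverse_cocycles B B' (- j) s t" and iso: "isomorphic D (\<Phi>o B') (sho D (- j) (\<Phi>o B))"
    using shift_exists by blast
  then have s: "s \<in> cocycles C B B' j" and t: "t \<in> cocycles C B' B (- j)" and ts: "t \<odot>\<^bsub>C\<^esub> s = dident C B"
    unfolding inverse_cocycles_def by auto
  have bt: "b \<odot>\<^bsub>C\<^esub> t \<in> cocycles C B' Y 0" using cocycles_compose[OF t b] by simp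
  obtain f g where fg: "f \<in> Hom D (\<Phi>o B') (sho D (- j) (\<Phi>o B))" "g \<in> Hom D (sho D (- j) (\<Phi>o B)) (\<Phi>o B')"
      "g \<cdot> f = ident D (\<Phi>o B')"
    using isomorphicE[OF iso] by metis
  let ?u = "\<Phi>m (b \<odot>\<^bsub>C\<^esub> t)"
  have u: "?u \<in> Hom D (\<Phi>o B') (\<Phi>o Y)" by (rule \<Phi>_mem[OF bt])
  have "\<Phi>m \<phi> \<cdot> (?u \<cdot> g) = 0"
    using assms(1,2) compose_closed[OF fg(2) u] unfolding ghost_def by blast
  then have "(\<Phi>m \<phi> \<cdot> ?u) \<cdot> g = 0" using compose_assoc[OF fg(2) u \<Phi>_mem[OF \<phi>]] by simp
  then have "((\<Phi>m \<phi> \<cdot> ?u) \<cdot> g) \<cdot> f = 0" using compose_zero_left[OF fg(1)] by simp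
  then have "\<Phi>m \<phi> \<cdot> ?u = 0"
    using compose_assoc[OF fg(1,2) compose_closed[OF u \<Phi>_mem[OF \<phi>]]] fg(3)
      ident_right[OF compose_closed[OF u \<Phi>_mem[OF \<phi>]]] by simp
  then have "\<phi> \<odot>\<^bsub>C\<^esub> (b \<odot>\<^bsub>C\<^esub> t) \<in> coboundaries C B' Y' 0"
    using \<Phi>_eq_0 cocycles_compose[OF bt \<phi>] \<Phi>_compose[OF bt \<phi>] by simp
  from coboundaries_compose[OF s this]
  have "(\<phi> \<odot>\<^bsub>C\<^esub> (b \<odot>\<^bsub>C\<^esub> t)) \<odot>\<^bsub>C\<^esub> s \<in> coboundaries C B Y' j" by simp
  moreover have "(\<phi> \<odot>\<^bsub>C\<^esub> (b \<odot>\<^bsub>C\<^esub> t)) \<odot>\<^bsub>C\<^esub> s = \<phi> \<odot>\<^bsub>C\<^esub> b"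
  proof -
    have m: "s \<in> dHom C B B' j" "t \<in> dHom C B' B (- j)" "b \<in> dHom C B Y j" "\<phi> \<in> dHom C Y Y' 0"
      "b \<odot>\<^bsub>C\<^esub> t \<in> dHom C B' Y 0"
      using s t b \<phi> bt by (auto simp: cocycles_def)
    show ?thesis
      using dcompose_assoc[OF m(1,5,4)] dcompose_assoc[OF m(1-3)] ts dident_right[OF m(3)] by simp
  qed
  ultimately show ?thesis by simp
qed

end

text \<open>The retraction of the diagonal off \<open>P\<close> enters through \<open>p\<close> and,
  for each object, a cocycle of \<open>P\<close> lifting the identity up to a coboundary.\<close>

locale smooth_enhanced_category =
  enhanced_triangulated_category D C \<Phi>o \<Phi>m + semifree_bimodule C P r A B n w
  for D :: "('k::field, 'o, 'm::ab_group_add, 'z) tricat_scheme" (structure)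
    and C :: "('k, 'e, 'c::ab_group_add, 'y) dgcat_scheme" and \<Phi>o :: "'e \<Rightarrow> 'o" and \<Phi>m :: "'c \<Rightarrow> 'm"
    and P :: "('k, 'e, 'c, 'b::ab_group_add, 'x) dgbimod_scheme"
    and r :: nat and A B :: "nat \<Rightarrow> 'e" and n :: "nat \<Rightarrow> int" and w :: "nat \<Rightarrow> 'b" +
  fixes p :: "'b \<Rightarrow> 'c"
  assumes p: "bimodule_map C P (diagonal C) p"
    and ident_lifts: "\<exists>q\<in>bHom P X X 0. bdiff P q = 0 \<and> dident C X - p q \<in> coboundaries C X X 0"
begin

text \<open>Each ghost is worth one filtration step by \<open>ghost_lowers_filtration\<close>.
  Ghosts live in \<open>D\<close> and cocycles in \<open>C\<close>, so \<open>a\<close> and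
  \<open>c\<close> carry both ends of the composite to objects in the image of
  \<open>\<Phi>o\<close>; only the target end varies in the induction.\<close>

lemma ghosts_lower_filtration:
  assumes "ghosts ((\<lambda>k. \<Phi>o (B k)) ` {..<r}) m E E' f" "m \<le> r"
    and "a \<in> Hom D (\<Phi>o Y) E" "c \<in> Hom D E' (\<Phi>o Y')"
    and "\<phi> \<in> cocycles C Y Y' 0" "\<Phi>m \<phi> = c \<cdot> (f \<cdot> a)"
    and q: "q \<in> bHom P X Y 0" "bdiff P q = 0"
  shows "\<exists>q'\<in>bHom P X Y' (- 1). lact P \<phi> q - bdiff P q' \<in> fil (r - m) X Y' 0"
  using assms(1-6)
proof (induction arbitrary: c Y' \<phi> rule: ghosts.induct)
  case (ghosts_0 f E E')
  have "\<phi> \<in> dHom C Y Y' 0" using ghosts_0 by (simp add: cocycles_def)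
  then have "lact P \<phi> q \<in> bHom P X Y' 0" using lact_closed[OF q(1)] by fastforce
  then show ?case by (intro bexI[of _ 0]) (simp_all add: fil_top)
next
  case (ghosts_Suc m E E1 f E2 g)
  note f = ghosts_closed[OF ghosts_Suc(1)] and g = ghost_closed[OF ghosts_Suc(2)]
  note a = ghosts_Suc(5) and c = ghosts_Suc(6)
  \<comment> \<open>\<open>E1\<close> need not be in the image of \<open>\<Phi>o\<close>; inserting
    an isomorphic \<open>\<Phi>o Y1\<close> makes both halves of the composite liftable to
    cocycles.\<close>
  obtain Y1 where "isomorphic D (\<Phi>o Y1) E1" using \<Phi>_surj .
  then obtain d d' where d: "d \<in> Hom D (\<Phi>o Y1) E1" "d' \<in> Hom D E1 (\<Phi>o Y1)" "d \<cdot> d' = ident D E1"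
    using isomorphicE by metis
  note fa = compose_closed[OF a f]
  note gd = compose_closed[OF d(1) g]
  obtain \<phi>1 where \<phi>1: "\<phi>1 \<in> cocycles C Y Y1 0" "\<Phi>m \<phi>1 = d' \<cdot> (f \<cdot> a)"
    using \<Phi>_lift[OF compose_closed[OF fa d(2)]] .
  obtain \<phi>2 where \<phi>2: "\<phi>2 \<in> cocycles C Y1 Y' 0" "\<Phi>m \<phi>2 = c \<cdot> (g \<cdot> d)"
    using \<Phi>_lift[OF compose_closed[OF gd c]] .
  have m: "\<phi> \<in> dHom C Y Y' 0" "\<phi>1 \<in> dHom C Y Y1 0" "\<phi>2 \<in> dHom C Y1 Y' 0" "ddiff C \<phi>1 = 0" "ddiff C \<phi>2 = 0"
    using \<phi>1 \<phi>2 ghosts_Suc.prems by (auto simp: cocycles_def)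
  obtain q1 where q1: "q1 \<in> bHom P X Y1 (- 1)" "lact P \<phi>1 q - bdiff P q1 \<in> fil (r - m) X Y1 0"
    using ghosts_Suc.IH[OF _ a d(2) \<phi>1] ghosts_Suc.prems by auto
  let ?p1 = "lact P \<phi>1 q - bdiff P q1"
  have l1: "lact P \<phi>1 q \<in> bHom P X Y1 0" using lact_closed[OF q(1) m(2)] by simp
  have dq1: "bdiff P q1 \<in> bHom P X Y1 0" using bdiff_closed[OF q1(1)] by simp
  have p1: "?p1 \<in> bHom P X Y1 0" by (rule bHom_diff[OF l1 dq1])
  have "bdiff P ?p1 = 0"
    using bdiff_diff[OF l1 dq1] bdiff_bdiff[OF q1(1)] bdiff_lact_closed[OF q(1) m(2,4)] q(2) lact_zero[OF m(2)]
    by simp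
  moreover have "ghost ((\<lambda>k. \<Phi>o (B k)) ` {..<r}) (\<Phi>o Y1) (\<Phi>o Y') (\<Phi>m \<phi>2)"
    unfolding ghost_def
  proof (intro conjI ballI allI)
    show "\<Phi>m \<phi>2 \<in> Hom D (\<Phi>o Y1) (\<Phi>o Y')" by (rule \<Phi>_mem[OF \<phi>2(1)])
    fix G j u assume *: "G \<in> (\<lambda>k. \<Phi>o (B k)) ` {..<r}" "u \<in> Hom D (sho D j G) (\<Phi>o Y1)"
    then have "g \<cdot> (d \<cdot> u) = 0"
      using ghosts_Suc(2) compose_closed[OF *(2) d(1)] unfolding ghost_def by blast
    then have "c \<cdot> ((g \<cdot> d) \<cdot> u) = 0"
      using compose_assoc[OF *(2) d(1) g] compose_zero_right[OF c] by simp
    then show "\<Phi>m \<phi>2 \<cdot> u = 0" using \<phi>2(2) compose_assoc[OF *(2) gd c] by simp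
  qed
  then have "\<phi>2 \<odot>\<^bsub>C\<^esub> b \<in> coboundaries C (B k) Y' j" if "k < r" "b \<in> cocycles C (B k) Y1 j" for k j b
    by (rule ghost_cohomology_zero) (use that \<phi>2(1) in auto)
  moreover have "r - Suc m < r" "?p1 \<in> fil (Suc (r - Suc m)) X Y1 0"
    using ghosts_Suc.prems(1) q1(2) by (auto simp: Suc_diff_Suc)
  ultimately obtain q2 where q2: "q2 \<in> bHom P X Y' (0 - 1)" "lact P \<phi>2 ?p1 - bdiff P q2 \<in> fil (r - Suc m) X Y' 0"
    using ghost_lowers_filtration[of "r - Suc m" \<phi>2 Y1 Y' ?p1 X 0] m(3,5) by metis
  have \<phi>21: "\<phi>2 \<odot>\<^bsub>C\<^esub> \<phi>1 \<in> cocycles C Y Y' 0" using cocycles_compose[OF \<phi>1(1) \<phi>2(1)] by simp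
  have "\<Phi>m (\<phi>2 \<odot>\<^bsub>C\<^esub> \<phi>1) = (c \<cdot> (g \<cdot> d)) \<cdot> (d' \<cdot> (f \<cdot> a))"
    using \<Phi>_compose[OF \<phi>1(1) \<phi>2(1)] \<phi>1(2) \<phi>2(2) by simp
  also have "\<dots> = c \<cdot> (g \<cdot> ((d \<cdot> d') \<cdot> (f \<cdot> a)))"
    using compose_assoc[OF compose_closed[OF fa d(2)] gd c] compose_assoc[OF compose_closed[OF fa d(2)] d(1) g]
      compose_assoc[OF fa d(2,1)] by simp
  also have "\<dots> = \<Phi>m \<phi>"
    using d(3) ident_left[OF fa] compose_assoc[OF a f g] ghosts_Suc.prems by simp
  \<comment> \<open>\<open>\<phi>\<close> and the composite of the two lifts represent the same
    morphism of \<open>D\<close>, so they differ by the differential of some \<open>e\<close>. On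
    the cocycle \<open>q\<close> this difference contributes just the boundary of
    \<open>lact P e q\<close>.\<close>
  finally have "\<Phi>m (\<phi> - \<phi>2 \<odot>\<^bsub>C\<^esub> \<phi>1) = 0"
    using \<Phi>_diff[OF ghosts_Suc(7) \<phi>21] by simp
  then have "\<phi> - \<phi>2 \<odot>\<^bsub>C\<^esub> \<phi>1 \<in> coboundaries C Y Y' 0"
    using \<Phi>_eq_0 dg.subspace_diff[OF subspace_cocycles ghosts_Suc(7) \<phi>21] by simp
  then obtain e where e: "e \<in> dHom C Y Y' (- 1)" "\<phi> - \<phi>2 \<odot>\<^bsub>C\<^esub> \<phi>1 = ddiff C e"
    by (auto simp: coboundaries_def)
  have eq: "lact P e q \<in> bHom P X Y' (- 1)" using lact_closed[OF q(1) e(1)] by simp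
  have l2: "lact P \<phi>2 q1 \<in> bHom P X Y' (- 1)" using lact_closed[OF q1(1) m(3)] by simp
  have m21: "\<phi>2 \<odot>\<^bsub>C\<^esub> \<phi>1 \<in> dHom C Y Y' 0" using \<phi>21 by (simp add: cocycles_def)
  have "lact P (ddiff C e) q = bdiff P (lact P e q)"
    using bdiff_lact[OF q(1) e(1)] q(2) lact_zero[OF e(1)] by (simp add: koszul_def)
  moreover have "lact P (ddiff C e) q = lact P \<phi> q - lact P \<phi>2 (lact P \<phi>1 q)"
    unfolding e(2)[symmetric] using lact_diff_scalar[OF q(1) m(1) m21] lact_lact[OF q(1) m(2,3)] by simp
  moreover have "lact P \<phi>2 (lact P \<phi>1 q) = lact P \<phi>2 ?p1 + bdiff P (lact P \<phi>2 q1)"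
    using lact_diff[OF m(3) l1 dq1] bdiff_lact_closed[OF q1(1) m(3,5)] by simp
  ultimately have E: "lact P \<phi> q - bdiff P (q2 + (lact P \<phi>2 q1 + lact P e q)) = lact P \<phi>2 ?p1 - bdiff P q2"
    using bdiff_add[OF _ bHom_add[OF l2 eq], of q2] bdiff_add[OF l2 eq] q2(1) by (simp add: algebra_simps)
  show ?case
  proof
    show "lact P \<phi> q - bdiff P (q2 + (lact P \<phi>2 q1 + lact P e q)) \<in> fil (r - Suc m) X Y' 0"
      unfolding E by (rule q2(2))
  qed (use q2(1) bHom_add[OF _ bHom_add[OF l2 eq], of q2] in simp)
qed

text \<open>
  A cocycle lifting the identity to the bimodule \<open>P\<close> is pushed out of the filtration by \<open>r\<close> ghosts.
\<close>

lemma ghosts_zero: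
  assumes f: "ghosts ((\<lambda>k. \<Phi>o (B k)) ` {..<r}) r E E' f"
  shows "f = 0"
proof -
  note fm = ghosts_closed[OF f]
  obtain Y where "isomorphic D (\<Phi>o Y) E" using \<Phi>_surj .
  then obtain a a' where a: "a \<in> Hom D (\<Phi>o Y) E" "a' \<in> Hom D E (\<Phi>o Y)" "a \<cdot> a' = ident D E"
    using isomorphicE by metis
  obtain Y' where "isomorphic D (\<Phi>o Y') E'" using \<Phi>_surj .
  then obtain c' c where c: "c' \<in> Hom D (\<Phi>o Y') E'" "c \<in> Hom D E' (\<Phi>o Y')" "c' \<cdot> c = ident D E'"
    using isomorphicE by metis
  note fa = compose_closed[OF a(1) fm]
  obtain \<phi> where \<phi>: "\<phi> \<in> cocycles C Y Y' 0" "\<Phi>m \<phi> = c \<cdot> (f \<cdot> a)"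
    using \<Phi>_lift[OF compose_closed[OF fa c(2)]] .
  have m: "\<phi> \<in> dHom C Y Y' 0" "ddiff C \<phi> = 0" using \<phi> by (auto simp: cocycles_def)
  obtain q where q: "q \<in> bHom P Y Y 0" "bdiff P q = 0" "dident C Y - p q \<in> coboundaries C Y Y 0"
    using ident_lifts by blast
  obtain q' where q': "q' \<in> bHom P Y Y' (- 1)" "lact P \<phi> q = bdiff P q'"
    using ghosts_lower_filtration[OF f order.refl a(1) c(2) \<phi> q(1,2)] by (auto simp: fil_bottom)
  have pq: "p q \<in> dHom C Y Y 0" and pq': "p q' \<in> dHom C Y Y' (- 1)"
    using p q(1) q'(1) unfolding bimodule_map_def by (auto simp: diagonal_def)
  have "\<phi> \<odot>\<^bsub>C\<^esub> p q = p (lact P \<phi> q)"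
    using p q(1) m(1) unfolding bimodule_map_def by (simp add: diagonal_def)
  also have "\<dots> = ddiff C (p q')"
    using p q' unfolding bimodule_map_def by (simp add: diagonal_def)
  finally have 1: "\<phi> \<odot>\<^bsub>C\<^esub> p q = ddiff C (p q')" .
  obtain e where e: "e \<in> dHom C Y Y (- 1)" "dident C Y - p q = ddiff C e"
    using q(3) by (auto simp: coboundaries_def)
  have 2: "\<phi> \<odot>\<^bsub>C\<^esub> (dident C Y - p q) = \<phi> \<odot>\<^bsub>C\<^esub> dident C Y - \<phi> \<odot>\<^bsub>C\<^esub> p q"
    by (rule linear_on_diff[OF dcompose_linear_right[OF m(1)] vector_space_dsmul subspace_dHom dident_closed pq])
  \<comment> \<open>Split \<phi> as \<phi> (1 - p q) + p (\<phi> q): the first part is a boundary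
    because \<open>q\<close> lifts the identity, the second because \<phi> q has become a boundary
    in \<open>P\<close>.\<close>
  have "\<phi> = ddiff C (\<phi> \<odot>\<^bsub>C\<^esub> e) + ddiff C (p q')"
    using 1 2 e(2) dident_right[OF m(1)] ddiff_dcompose_closed_left[OF e(1) m] by (simp add: algebra_simps)
  also have "\<dots> = ddiff C (\<phi> \<odot>\<^bsub>C\<^esub> e + p q')"
    by (rule linear_onD(1)[OF ddiff_linear, symmetric]) (use dcompose_closed[OF e(1) m(1)] pq' in auto)
  finally have "\<phi> \<in> coboundaries C Y Y' 0"
    using dHom_add[OF _ pq'] dcompose_closed[OF e(1) m(1)] by (auto simp: coboundaries_def)
  then have "c \<cdot> (f \<cdot> a) = 0" using \<Phi>_eq_0[OF \<phi>(1)] \<phi>(2) by simp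
  then have "c' \<cdot> (c \<cdot> (f \<cdot> a)) = 0" using compose_zero_right[OF c(1)] by simp
  then have "f \<cdot> a = 0" using compose_assoc[OF fa c(2,1)] c(3) ident_left[OF fa] by simp
  then have "(f \<cdot> a) \<cdot> a' = 0" using compose_zero_left[OF a(2)] by simp
  then show ?thesis using compose_assoc[OF a(2,1) fm] a(3) ident_right[OF fm] by simp
qed

end

context triangulated_category
begin

text \<open>A composite of as many \<open>{G}\<close>-ghosts as the sum of the bounds for the
  members of \<open>S\<close> is one ghost for all of \<open>S\<close>. Longer composites are cut
  into blocks of that length.\<close>

lemma ghosts_pass_to_generated:
  assumes "\<And>B. B \<in> S \<Longrightarrow> \<exists>m. \<forall>X Y f j u. ghosts {G} m X Y f \<longrightarrow> u \<in> Hom D (sho D j B) X \<longrightarrow> f \<cdot> u = 0"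
    and "finite S"
  obtains M where "\<And>l X Y f. ghosts {G} (l * M) X Y f \<Longrightarrow> ghosts S l X Y f"
proof -
  obtain \<mu> where \<mu>: "\<And>B X Y f j u. B \<in> S \<Longrightarrow> ghosts {G} (\<mu> B) X Y f \<Longrightarrow> u \<in> Hom D (sho D j B) X \<Longrightarrow> f \<cdot> u = 0"
    using assms(1) by metis
  let ?M = "\<Sum>B\<in>S. \<mu> B"
  have 1: "ghost S X Y f" if "ghosts {G} ?M X Y f" for X Y f
    unfolding ghost_def
  proof (intro conjI ballI allI)
    fix B j u assume B: "B \<in> S" and u: "u \<in> Hom D (sho D j B) X"
    have "\<mu> B \<le> ?M" using B assms(2) by (intro member_le_sum) auto
    then show "f \<cdot> u = 0" using \<mu>[OF B _ u] ghosts_mono[OF that] by blast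
  qed (rule ghosts_closed[OF that])
  have "ghosts S l X Y f" if "ghosts {G} (l * ?M) X Y f" for l X Y f
    using that
  proof (induction l arbitrary: Y f)
    case 0
    then show ?case using ghosts_0[OF ghosts_closed[OF 0]] by simp
  next
    case (Suc l)
    then have "ghosts {G} (?M + l * ?M) X Y f" by simp
    then obtain Z g h where "ghosts {G} (l * ?M) X Z g" "ghosts {G} ?M Z Y h" "f = h \<cdot> g"
      by (rule ghosts_split)
    then show ?case using ghosts_Suc[OF Suc.IH 1] by simp
  qed
  then show thesis by (rule that)
qed

end

lemma saturated_ghosts_zero:
  fixes D :: "('k::field, 'o, 'm::ab_group_add, 'z) tricat_scheme"
  assumes "triangulated_category D"
    and "saturated TYPE('e) TYPE('c::ab_group_add) TYPE('b::ab_group_add) D"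
    and "split_generator D G"
  obtains N where "\<And>X Y f. triangulated_category.ghosts D {G} N X Y f \<Longrightarrow> f = 0"
proof -
  interpret triangulated_category D by fact
  obtain C :: "('k, 'e, 'c) dgcat" and \<Phi>o \<Phi>m
    where C: "dg_enhancement C D \<Phi>o \<Phi>m" "dg_smooth TYPE('b) C"
    using assms(2) unfolding saturated_def by blast
  obtain P R :: "('k, 'e, 'c, 'b) dgbimod" and s p where P: "fg_semifree C P" and R: "dg_bimodule C R"
      and s: "bimodule_map C R P s" and p: "bimodule_map C P (diagonal C) p"
      and ps: "bimodule_quasi_iso C R (diagonal C) (p \<circ> s)"
    using C(2) unfolding dg_smooth_def by blast
  interpret enhanced_triangulated_category D C \<Phi>o \<Phi>m
    by unfold_locales (rule C(1))
  obtain r A B n w where sf: "semifree_bimodule C P r A B n w"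
    using fg_semifree_bimodule[OF P] .
  interpret semifree_bimodule C P r A B n w by fact
  interpret smooth_enhanced_category D C \<Phi>o \<Phi>m P r A B n w p
  proof unfold_locales
    show "bimodule_map C P (diagonal C) p" by fact
    fix X
    \<comment> \<open>Surjectivity of \<open>p \<circ> s\<close> on cohomology lifts the identity to
      a cocycle of \<open>R\<close>, and \<open>s\<close> carries it to \<open>P\<close>.\<close>
    have "dident C X \<in> bHom (diagonal C) X X 0" "bdiff (diagonal C) (dident C X) = 0"
      using dident_cocycle[of X] by (auto simp: diagonal_def cocycles_def)
    note ps[unfolded bimodule_quasi_iso_def, THEN conjunct2, THEN spec, THEN spec, THEN spec,
        THEN conjunct2, THEN bspec, THEN mp, OF this]
    then obtain m where m: "m \<in> bHom R X X 0" "bdiff R m = 0"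
        "dident C X - (p \<circ> s) m \<in> ddiff C ` dHom C X X (0 - 1)"
      by (auto simp: diagonal_def)
    interpret R: dg_bimodule C R by fact
    have "bdiff P (s m) = s (bdiff R m)" "s m \<in> bHom P X X 0" "s 0 = 0"
      using s m(1) linear_on_zero[of "bsmul R" "bsmul P" "bHom R X X 0" s] R.bHom_zero
      unfolding bimodule_map_def by metis+
    then show "\<exists>q\<in>bHom P X X 0. bdiff P q = 0 \<and> dident C X - p q \<in> coboundaries C X X 0"
      using m by (auto simp: coboundaries_def)
  qed
  let ?S = "(\<lambda>k. \<Phi>o (B k)) ` {..<r}"
  obtain M where M: "\<And>l X Y f. ghosts {G} (l * M) X Y f \<Longrightarrow> ghosts ?S l X Y f"
  proof (rule ghosts_pass_to_generated[of ?S G])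
    show "\<exists>m. \<forall>X Y f j u. ghosts {G} m X Y f \<longrightarrow> u \<in> Hom D (sho D j E) X \<longrightarrow> f \<cdot>\<^bsub>D\<^esub> u = 0" for E
      by (rule split_generator_ghosts[OF assms(3), of E]) blast
  qed auto
  \<comment> \<open>One block of \<open>M\<close> ghosts for each of the \<open>r\<close> generators
    of the bimodule.\<close>
  then show thesis using that[of "r * M"] ghosts_zero by blast
qed


section \<open>Subadditive sequences\<close>

lemma subadditive_le_multiple:
  fixes u :: "nat \<Rightarrow> real"
  assumes "\<And>m n. u (m + n) \<le> u m + u n"
  shows "u (q * m + s) \<le> real q * u m + u s"
proof (induction q)
  case (Suc q)
  have "u (Suc q * m + s) \<le> u m + u (q * m + s)" using assms[of m "q * m + s"] by (simp add: add.assoc)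
  then show ?case using Suc by (simp add: algebra_simps)
qed simp

text \<open>Adding \<open>C\<close> makes the sequence exactly subadditive. The linear lower bound
  keeps the infimum of the quotients finite, and this infimum is the limit.\<close>

lemma fekete:
  fixes a :: "nat \<Rightarrow> real"
  assumes sub: "\<And>m n. a (m + n) \<le> a m + a n + C" and low: "\<And>n. K + real n * L \<le> a n"
  obtains t where "(\<lambda>n. a n / real n) \<longlonglongrightarrow> t"
proof -
  define u where "u n = a n + C" for n
  have usub: "u (m + n) \<le> u m + u n" for m n using sub[of m n] by (simp add: u_def)
  define t where "t = (INF n\<in>{1..}. u n / real n)"
  have bdd: "bdd_below ((\<lambda>n. u n / real n) ` {1..})"
  proof (rule bdd_belowI2)
    fix n :: nat assume "n \<in> {1..}"
    then have n: "real n \<ge> 1" by simp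
    have "- \<bar>K + C\<bar> * real n \<le> - \<bar>K + C\<bar> * 1" using n by (intro mult_left_mono_neg) auto
    then have "(L - \<bar>K + C\<bar>) * real n \<le> u n" using low[of n] by (simp add: u_def algebra_simps)
    then show "L - \<bar>K + C\<bar> \<le> u n / real n" using n by (simp add: pos_le_divide_eq)
  qed
  have lower: "t \<le> u n / real n" if "n \<ge> 1" for n
    unfolding t_def using that by (intro cINF_lower[OF bdd]) auto
  have "(\<lambda>n. u n / real n) \<longlonglongrightarrow> t"
  proof (rule LIMSEQ_I)
    fix e :: real assume e: "e > 0"
    have "t < t + e / 2" using e by simp
    then have "\<exists>m\<in>{1..}. u m / real m < t + e / 2"
      unfolding t_def by (subst (asm) cINF_less_iff[OF _ bdd]) auto
    then obtain m where m: "m \<ge> 1" "u m / real m < t + e / 2" by auto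
    \<comment> \<open>Writing n = q m + s with s < m, the excess of u n over n (u m / m) is at most
      u s - s (u m / m), and there are finitely many remainders s.\<close>
    define M where "M = (\<Sum>s<m. \<bar>u s - real s * (u m / real m)\<bar>)"
    have upper: "u n / real n \<le> u m / real m + M / real n" if "n \<ge> 1" for n
    proof -
      let ?q = "n div m" and ?s = "n mod m"
      have s: "?s < m" using m(1) by simp
      have n_eq: "n = ?q * m + ?s" by simp
      have rn: "real n = real ?q * real m + real ?s"
        using arg_cong[OF n_eq, of real] by (simp only: of_nat_add of_nat_mult)
      have "real ?q * u m = (real ?q * real m) * (u m / real m)" using m(1) by simp
      also have "\<dots> = (real n - real ?s) * (u m / real m)" using rn by simp
      finally have "u n \<le> (real n - real ?s) * (u m / real m) + u ?s"
        using subadditive_le_multiple[OF usub, of ?q m ?s] n_eq by simp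
      also have "\<dots> = real n * (u m / real m) + (u ?s - real ?s * (u m / real m))"
        by (simp add: algebra_simps)
      also have "u ?s - real ?s * (u m / real m) \<le> M"
      proof -
        have "\<bar>u ?s - real ?s * (u m / real m)\<bar> \<le> M"
          unfolding M_def using s by (intro member_le_sum) auto
        then show ?thesis by linarith
      qed
      finally have "u n \<le> real n * (u m / real m) + M" by simp
      then show ?thesis using that by (simp add: field_simps)
    qed
    obtain n0 :: nat where n0: "M / (e / 2) < real n0" using reals_Archimedean2 by blast
    show "\<exists>no. \<forall>n\<ge>no. norm (u n / real n - t) < e"
    proof (intro exI allI impI)
      fix n assume n: "n \<ge> max 1 n0"
      have "M / (e / 2) < real n" using n0 n by (meson le_max_iff_disj less_le_trans max.boundedE of_nat_le_iff)
      then have "M / real n < e / 2" using n e by (simp add: field_simps)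
      moreover have "u n / real n \<le> u m / real m + M / real n" using upper[of n] n by simp
      ultimately have "u n / real n < t + e" using m(2) by linarith
      then show "norm (u n / real n - t) < e" using lower[of n] n by (simp add: abs_less_iff)
    qed
  qed
  then have "(\<lambda>n. u n / real n - C / real n) \<longlonglongrightarrow> t - 0"
    by (intro tendsto_diff lim_const_over_n)
  then have "(\<lambda>n. a n / real n) \<longlonglongrightarrow> t" by (simp add: u_def add_divide_distrib)
  then show thesis by (rule that)
qed

lemma LIMSEQ_over_n_bounded_diff:
  fixes a b :: "nat \<Rightarrow> real"
  assumes "(\<lambda>n. a n / real n) \<longlonglongrightarrow> t" "\<And>n. \<bar>b n - a n\<bar> \<le> C"
  shows "(\<lambda>n. b n / real n) \<longlonglongrightarrow> t"
proof -
  have "(\<lambda>n. (b n - a n) / real n) \<longlonglongrightarrow> 0"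
  proof (rule tendsto_rabs_zero_cancel, rule tendsto_sandwich[OF _ _ tendsto_const lim_const_over_n])
    show "\<forall>\<^sub>F n in sequentially. \<bar>(b n - a n) / real n\<bar> \<le> C / real n"
      using assms(2) by (intro always_eventually) (auto simp: divide_right_mono)
  qed simp
  from tendsto_add[OF assms(1) this] show ?thesis by (simp add: diff_divide_distrib)
qed

section \<open>Shifting numbers and exact functors\<close>

locale ghost_bounded_generator = triangulated_category D
  for D :: "('k::field, 'o, 'm::ab_group_add, 'z) tricat_scheme" (structure) +
  fixes G :: 'o and N :: nat
  assumes finite_type: "finite_type D"
    and ghosts_zero: "ghosts {G} N X Y f \<Longrightarrow> f = 0"
begin

text \<open>The set whose maximum and minimum are \<open>eps_upper\<close> and
  \<open>eps_lower\<close>, with the shift moved to \<open>G\<close>.\<close>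

definition degrees :: "'o \<Rightarrow> int set" where
  "degrees E = {k. nonzero_Hom (sho D k G) E}"

lemma eps_degrees: "eps_upper D G E = Max (degrees E)" "eps_lower D G E = Min (degrees E)"
  unfolding eps_upper_def eps_lower_def degrees_def nonzero_Hom_shift_left by (simp_all add: nonzero_Hom_def)

lemma finite_degrees: "finite (degrees E)"
  unfolding degrees_def by (rule finite_nonzero_Hom[OF finite_type])

text \<open>Otherwise the identity of \<open>E\<close> would be a ghost, hence a composite of any
  number of ghosts, hence zero. Without this the maximum and minimum of the degrees would be
  unspecified.\<close>

lemma degrees_nonempty:
  assumes "\<not> is_zero_object D E"
  shows "degrees E \<noteq> {}"
proof
  assume "degrees E = {}"
  then have "u = 0" if "u \<in> Hom D (sho D j G) E" for j u
    using that nonzero_HomI unfolding degrees_def by blast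
  then have gh: "ghost {G} E E (ident D E)"
    unfolding ghost_def using ident_closed ident_left by auto
  have "ghosts {G} m E E (ident D E)" for m
  proof (induction m)
    case (Suc m)
    then show ?case using ghosts_Suc[OF Suc gh] ident_left[OF ident_closed] by simp
  qed (rule ghosts_0[OF ident_closed])
  then have "ident D E = 0" using ghosts_zero by blast
  then show False using assms zero_object_iff by simp
qed

lemma degreesD:
  assumes "nonzero_Hom (sho D k G) E"
  shows "eps_lower D G E \<le> k" "k \<le> eps_upper D G E"
  using assms finite_degrees[of E] unfolding eps_degrees by (auto simp: degrees_def)

lemma eps_attained:
  assumes "\<not> is_zero_object D E"
  shows "nonzero_Hom (sho D (eps_upper D G E) G) E" "nonzero_Hom (sho D (eps_lower D G E) G) E"
  using Max_in[OF finite_degrees degrees_nonempty[OF assms]] Min_in[OF finite_degrees degrees_nonempty[OF assms]]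
  unfolding eps_degrees by (auto simp: degrees_def)

lemma eps_lower_le_upper: "\<not> is_zero_object D E \<Longrightarrow> eps_lower D G E \<le> eps_upper D G E"
  using degreesD eps_attained by blast

text \<open>After \<open>N\<close> rounds of attaching cells the map is a composite of
  \<open>N\<close> ghosts, hence zero. As \<open>N\<close> is uniform, so is the margin
  \<open>c\<close>.\<close>

lemma zero_cell_map:
  obtains c :: int where "0 \<le> c"
    and "\<And>E. \<exists>E'. cell_map G {eps_lower D G E - c..eps_upper D G E + c} E E' 0"
proof -
  \<comment> \<open>Bounds the degrees of shifted self-maps of \<open>G\<close>, plus one for the
    passage to a cone; \<open>N\<close> rounds multiply it by \<open>N\<close>.\<close>
  let ?c = "(\<Sum>j\<in>degrees G. \<bar>j\<bar>) + 1"
  have c: "\<bar>j\<bar> + 1 \<le> ?c" if "nonzero_Hom (sho D j G) G" for j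
    using member_le_sum[of j "degrees G" abs] that finite_degrees by (simp add: degrees_def)
  have c0: "0 \<le> ?c" by (simp add: sum_nonneg)
  have "\<exists>E'. cell_map G {eps_lower D G E - int N * ?c..eps_upper D G E + int N * ?c} E E' 0" for E
  proof -
    \<comment> \<open>For a zero object the ends of the interval are unspecified, but then no degree
      has to be covered.\<close>
    have "j \<in> {eps_lower D G E..eps_upper D G E}" if "nonzero_Hom (sho D j G) E" for j
      using degreesD[OF that] by simp
    from ghosts_cell_map_exists[OF finite_type c c0 this, where m = N]
    show ?thesis using ghosts_zero by blast
  qed
  then show thesis using that[of "int N * ?c"] c0 by simp
qed

text \<open>By \<open>cell_map_detects\<close> for the zero cell map, a nonzero map G[k] -> F E
  yields a nonzero map G[k - j] -> F G with j in the widened interval of \<open>E\<close>; take k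
  extremal. That \<open>c\<close> does not depend on the functor allows all powers of one functor at
  once.\<close>

lemma eps_exact_functor:
  obtains c :: int where "0 \<le> c"
    and "\<And>Fo Fm E. exact_functor Fo Fm \<Longrightarrow> \<not> is_zero_object D (Fo E) \<Longrightarrow> \<not> is_zero_object D (Fo G) \<and>
      eps_upper D G (Fo E) \<le> eps_upper D G E + eps_upper D G (Fo G) + c \<and>
      eps_lower D G E + eps_lower D G (Fo G) - c \<le> eps_lower D G (Fo E)"
proof -
  obtain c where c: "0 \<le> c"
      "\<And>E. \<exists>E'. cell_map G {eps_lower D G E - c..eps_upper D G E + c} E E' 0"
    using zero_cell_map by blast
  have "\<not> is_zero_object D (Fo G) \<and>
      eps_upper D G (Fo E) \<le> eps_upper D G E + eps_upper D G (Fo G) + c \<and>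
      eps_lower D G E + eps_lower D G (Fo G) - c \<le> eps_lower D G (Fo E)"
    if F: "exact_functor Fo Fm" and nz: "\<not> is_zero_object D (Fo E)" for Fo Fm E
  proof -
    obtain E' where E': "cell_map G {eps_lower D G E - c..eps_upper D G E + c} E E' 0" using c(2) by blast
    have 0: "Fm 0 = 0" using F linear_functorD(5) unfolding exact_functor_def by blast
    have *: "\<exists>j\<in>{eps_lower D G E - c..eps_upper D G E + c}. nonzero_Hom (sho D (- j) T) (Fo G)"
      if T: "nonzero_Hom T (Fo E)" for T
    proof -
      obtain u where u: "u \<in> Hom D T (Fo E)" "u \<noteq> 0" using nonzero_HomE[OF T] .
      show ?thesis by (rule cell_map_detects[OF F E' u]) (simp add: 0 compose_zero_left[OF u(1)])
    qed
    have **: "\<exists>j\<in>{eps_lower D G E - c..eps_upper D G E + c}. nonzero_Hom (sho D (k - j) G) (Fo G)"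
      if "nonzero_Hom (sho D k G) (Fo E)" for k
      using *[OF that] by (simp add: sho_add)
    have "\<not> is_zero_object D (Fo G)" using *[OF nonzero_objectD[OF nz]] zero_objectD by blast
    moreover have "eps_upper D G (Fo E) \<le> eps_upper D G E + eps_upper D G (Fo G) + c"
      using **[OF eps_attained(1)[OF nz]] degreesD(2) by fastforce
    moreover have "eps_lower D G E + eps_lower D G (Fo G) - c \<le> eps_lower D G (Fo E)"
      using **[OF eps_attained(2)[OF nz]] degreesD(1) by fastforce
    ultimately show ?thesis by blast
  qed
  then show thesis using that c(1) by blast
qed

end

section \<open>Harder--Narasimhan phases\<close>

context stability_condition
begin

lemma slice_shift_int: "X \<in> slice \<sigma> \<psi> \<Longrightarrow> sho D k X \<in> slice \<sigma> (\<psi> + real_of_int k)"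
proof (induction k arbitrary: X \<psi> rule: int_induct[where k = 0])
  case base
  then show ?case by (simp add: sho_0)
next
  case (step1 i)
  have "sho D 1 (sho D i X) \<in> slice \<sigma> ((\<psi> + real_of_int i) + 1)"
    unfolding slice_shift using step1 by blast
  then show ?case by (simp add: sho_add add.commute add.left_commute)
next
  case (step2 i)
  have "X \<in> sho D 1 ` slice \<sigma> (\<psi> - 1)" using step2(3) slice_shift[of "\<psi> - 1"] by simp
  then obtain X' where X': "X = sho D 1 X'" "X' \<in> slice \<sigma> (\<psi> - 1)" by blast
  then show ?case using step2(2)[OF X'(2)] by (simp add: sho_add algebra_simps)
qed

context
  fixes E n Es A \<phi>
  assumes HN: "HN_filtration D \<sigma> E n Es A \<phi>"
begin

lemma HN_triangle: "i < n \<Longrightarrow> \<exists>f g h. triangle D (Es i) (Es (Suc i)) (A (Suc i)) f g h"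
proof -
  assume "i < n"
  then have "Suc i \<in> {1..n}" by simp
  then have "\<exists>f g h. triangle D (Es (Suc i - 1)) (Es (Suc i)) (A (Suc i)) f g h"
    using HN unfolding HN_filtration_def by (elim conjE) (drule bspec, assumption, erule conjunct1)
  then show ?thesis by simp
qed

lemma HN_factor: "i \<in> {1..n} \<Longrightarrow> \<not> is_zero_object D (A i)" "i \<in> {1..n} \<Longrightarrow> A i \<in> slice \<sigma> (\<phi> i)"
  using HN unfolding HN_filtration_def by blast+

lemma HN_ends: "1 \<le> n" "is_zero_object D (Es 0)" "Es n = E"
  using HN unfolding HN_filtration_def by blast+

lemma HN_phases_decreasing:
  assumes "1 \<le> i" "i < j" "j \<le> n"
  shows "\<phi> j < \<phi> i"
  using assms(2,3)
proof (induction j)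
  case (Suc j)
  have "\<phi> (Suc j) < \<phi> j"
    using HN Suc.prems assms(1) unfolding HN_filtration_def by simp
  then show ?case using Suc by (cases "i = j") auto
qed simp

lemma HN_phases_mono: "1 \<le> i \<Longrightarrow> i \<le> j \<Longrightarrow> j \<le> n \<Longrightarrow> \<phi> j \<le> \<phi> i"
  using HN_phases_decreasing[of i j] by (cases "i = j") auto

lemma HN_nonzero_Hom_step: "l \<le> n \<Longrightarrow> nonzero_Hom X (Es l) \<Longrightarrow> \<exists>i\<in>{1..l}. nonzero_Hom X (A i)"
proof (induction l)
  case 0
  then show ?case using HN_ends(2) zero_objectD by blast
next
  case (Suc l)
  then show ?case using HN_triangle[of l] nonzero_Hom_middle by fastforce
qed

lemma HN_nonzero_Hom_step_left: "l \<le> n \<Longrightarrow> nonzero_Hom (Es l) X \<Longrightarrow> \<exists>i\<in>{1..l}. nonzero_Hom (A i) X"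
proof (induction l)
  case 0
  then show ?case using HN_ends(2) zero_objectD by blast
next
  case (Suc l)
  then show ?case using HN_triangle[of l] nonzero_Hom_middle_left by fastforce
qed

lemma HN_nonzero_Hom: "nonzero_Hom X E \<Longrightarrow> \<exists>i\<in>{1..n}. nonzero_Hom X (A i)"
  and HN_nonzero_Hom_left: "nonzero_Hom E X \<Longrightarrow> \<exists>i\<in>{1..n}. nonzero_Hom (A i) X"
  using HN_nonzero_Hom_step[of n] HN_nonzero_Hom_step_left[of n] HN_ends(3) by auto

text \<open>Together with \<open>HN_top\<close> this makes \<open>\<phi> 1\<close> the largest phase
  of a semistable object with a nonzero map to \<open>E\<close>, a description free of the
  filtration. The next lemma and \<open>HN_bottom\<close> do the same for the smallest
  phase.\<close>

lemma HN_Hom_from_semistable: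
  assumes "X \<in> slice \<sigma> \<psi>" "nonzero_Hom X E"
  shows "\<psi> \<le> \<phi> 1"
proof -
  obtain i where i: "i \<in> {1..n}" "nonzero_Hom X (A i)" using HN_nonzero_Hom[OF assms(2)] by blast
  then have "\<psi> \<le> \<phi> i" using slice_Hom[OF assms(1) HN_factor(2)] unfolding nonzero_Hom_def by force
  also have "\<dots> \<le> \<phi> 1" using i(1) by (intro HN_phases_mono) auto
  finally show ?thesis .
qed

lemma HN_Hom_to_semistable:
  assumes "X \<in> slice \<sigma> \<psi>" "nonzero_Hom E X"
  shows "\<phi> n \<le> \<psi>"
proof -
  obtain i where i: "i \<in> {1..n}" "nonzero_Hom (A i) X" using HN_nonzero_Hom_left[OF assms(2)] by blast
  have "\<phi> n \<le> \<phi> i" using i(1) by (intro HN_phases_mono) auto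
  also have "\<dots> \<le> \<psi>" using i slice_Hom[OF HN_factor(2) assms(1)] unfolding nonzero_Hom_def by force
  finally show ?thesis .
qed

text \<open>
  A nonzero map from \<open>A 1\<close> stays nonzero along the filtration because \<open>Hom(A 1, A i[-1]) = 0\<close>.
\<close>

lemma HN_top: "nonzero_Hom (A 1) E"
proof -
  have "nonzero_Hom (A 1) (Es l)" if "1 \<le> l" "l \<le> n" for l
    using that
  proof (induction l rule: dec_induct)
    case base
    obtain f g h where t: "triangle D (Es 0) (Es 1) (A 1) f g h" using HN_triangle[of 0] HN_ends(1) by auto
    have "nonzero_Hom (A 1) (A 1)" using nonzero_objectD HN_factor(1) HN_ends(1) by simp
    then show ?case
      using nonzero_Hom_cone[OF t] zero_objectD HN_ends(2) zero_object_shift by blast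
  next
    case (step l)
    obtain f g h where t: "triangle D (Es l) (Es (Suc l)) (A (Suc l)) f g h" using HN_triangle[of l] step by auto
    obtain u where u: "u \<in> Hom D (A 1) (Es l)" "u \<noteq> 0" using step nonzero_HomE by (metis Suc_leD)
    note H = triangle_Hom[OF t]
    have fu: "f \<cdot> u \<in> Hom D (A 1) (Es (Suc l))" using compose_closed[OF u(1)] H by blast
    show ?case
    proof (rule ccontr)
      assume "\<not> nonzero_Hom (A 1) (Es (Suc l))"
      then have fu0: "f \<cdot> u = 0" using fu nonzero_HomI by blast
      \<comment> \<open>After two rotations \<open>A (Suc l)\<close> is the fibre of the negative of
        f[1], so u[1] lifts to a nonzero map from A 1 [1], of phase \<open>\<phi> 1 + 1\<close>, to
        \<open>A (Suc l)\<close>, of smaller phase.\<close>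
      have "shm D 1 u \<noteq> 0" using u shm_eq_0[OF u(1)] by simp
      moreover have "(- shm D 1 f) \<cdot> shm D 1 u = 0"
        using compose_uminus_left[OF shm_closed[OF u(1)] shm_closed[OF H[THEN conjunct1]]]
          shm_compose[OF u(1) H[THEN conjunct1], of 1] fu0 by simp
      ultimately have "nonzero_Hom (sho D 1 (A 1)) (A (Suc l))"
        using nonzero_Hom_fiber[OF triangle_rotate[OF triangle_rotate[OF t]] shm_closed[OF u(1)]] by blast
      moreover have "sho D 1 (A 1) \<in> slice \<sigma> (\<phi> 1 + 1)"
        using slice_shift_int[OF HN_factor(2), of 1 1] HN_ends(1) by simp
      moreover have "A (Suc l) \<in> slice \<sigma> (\<phi> (Suc l))" using HN_factor(2) step by simp
      moreover have "\<phi> (Suc l) < \<phi> 1 + 1" using HN_phases_mono[of 1 "Suc l"] step by simp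
      ultimately show False using slice_Hom unfolding nonzero_Hom_def by blast
    qed
  qed
  from this[of n] show ?thesis using HN_ends by simp
qed

text \<open>
  If \<open>E \<rightarrow> A n\<close> were zero, \<open>A n\<close> would be a retract of \<open>Es (n - 1)[1]\<close>, whose phases exceed \<open>\<phi> n\<close>.
\<close>

lemma HN_bottom: "nonzero_Hom E (A n)"
proof -
  obtain l where l: "n = Suc l" using HN_ends(1) by (cases n) auto
  obtain f g h where t: "triangle D (Es l) (Es n) (A n) f g h" using HN_triangle[of l] l by auto
  note H = triangle_Hom[OF t]
  show ?thesis
  proof (rule ccontr)
    assume *: "\<not> nonzero_Hom E (A n)"
    then have "g = 0" using H HN_ends(3) nonzero_HomI by blast
    then have "ident D (A n) \<cdot> g = 0" using compose_zero_right[OF ident_closed] by simp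
    then obtain v where v: "v \<in> Hom D (sho D 1 (Es l)) (A n)" "ident D (A n) = v \<cdot> h"
      using exact_contravariant[OF triangle_rotate[OF t] ident_closed] by blast
    have "ident D (A n) \<noteq> 0" using HN_factor(1)[of n] HN_ends(1) zero_object_iff by simp
    then have "v \<noteq> 0" using v compose_zero_left H by metis
    then have "nonzero_Hom (Es l) (sho D (- 1) (A n))"
      using nonzero_HomI[OF v(1)] nonzero_Hom_shift_left by blast
    then obtain i where i: "i \<in> {1..l}" "nonzero_Hom (A i) (sho D (- 1) (A n))"
      using HN_nonzero_Hom_step_left[of l] l by (metis Suc_n_not_le_n nat_le_linear)
    have "A i \<in> slice \<sigma> (\<phi> i)" using HN_factor(2) i(1) l by simp
    moreover have "sho D (- 1) (A n) \<in> slice \<sigma> (\<phi> n - 1)"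
      using slice_shift_int[OF HN_factor(2), of n "- 1"] HN_ends(1) by simp
    moreover have "\<phi> n - 1 < \<phi> i" using HN_phases_mono[of i n] i(1) l by simp
    ultimately show False using slice_Hom i(2) unfolding nonzero_Hom_def by blast
  qed
qed

end

text \<open>Testing the first factor of each of two filtrations against the other gives both
  inequalities, so the definite description is legitimate.\<close>

lemma phi_plus_eq:
  assumes "HN_filtration D \<sigma> E n Es A \<phi>"
  shows "phi_plus D \<sigma> E = \<phi> 1"
  unfolding phi_plus_def
proof (rule the_equality)
  fix x assume "\<exists>n Es A \<phi>. HN_filtration D \<sigma> E n Es A \<phi> \<and> x = \<phi> 1"
  then obtain n' Es' A' \<phi>' where H: "HN_filtration D \<sigma> E n' Es' A' \<phi>'" "x = \<phi>' 1" by blast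
  have "\<phi>' 1 \<le> \<phi> 1"
    using HN_Hom_from_semistable[OF assms HN_factor(2)[OF H(1)] HN_top[OF H(1)]] HN_ends(1)[OF H(1)] by simp
  moreover have "\<phi> 1 \<le> \<phi>' 1"
    using HN_Hom_from_semistable[OF H(1) HN_factor(2)[OF assms] HN_top[OF assms]] HN_ends(1)[OF assms] by simp
  ultimately show "x = \<phi> 1" using H(2) by simp
qed (use assms in blast)

lemma phi_minus_eq:
  assumes "HN_filtration D \<sigma> E n Es A \<phi>"
  shows "phi_minus D \<sigma> E = \<phi> n"
  unfolding phi_minus_def
proof (rule the_equality)
  fix x assume "\<exists>n Es A \<phi>. HN_filtration D \<sigma> E n Es A \<phi> \<and> x = \<phi> n"
  then obtain n' Es' A' \<phi>' where H: "HN_filtration D \<sigma> E n' Es' A' \<phi>'" "x = \<phi>' n'" by blast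
  have "\<phi> n \<le> \<phi>' n'"
    using HN_Hom_to_semistable[OF assms HN_factor(2)[OF H(1)] HN_bottom[OF H(1)]] HN_ends(1)[OF H(1)] by simp
  moreover have "\<phi>' n' \<le> \<phi> n"
    using HN_Hom_to_semistable[OF H(1) HN_factor(2)[OF assms] HN_bottom[OF assms]] HN_ends(1)[OF assms] by simp
  ultimately show "x = \<phi> n" using H(2) by simp
qed (use assms in blast)

lemma phi_plus_attained:
  assumes "\<not> is_zero_object D E"
  obtains X where "X \<in> slice \<sigma> (phi_plus D \<sigma> E)" "nonzero_Hom X E"
  using HN_filtration_exists[OF assms] phi_plus_eq HN_top HN_factor(2) HN_ends(1)
  by (metis atLeastAtMost_iff order.refl)

lemma phi_minus_attained:
  assumes "\<not> is_zero_object D E"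
  obtains X where "X \<in> slice \<sigma> (phi_minus D \<sigma> E)" "nonzero_Hom E X"
  using HN_filtration_exists[OF assms] phi_minus_eq HN_bottom HN_factor(2) HN_ends(1)
  by (metis atLeastAtMost_iff order.refl)

lemma Hom_from_semistable_le_phi_plus:
  assumes "X \<in> slice \<sigma> \<psi>" "nonzero_Hom (sho D k X) E"
  shows "\<psi> + real_of_int k \<le> phi_plus D \<sigma> E"
proof -
  have "\<not> is_zero_object D E" using assms(2) zero_objectD by blast
  then obtain n Es A \<phi> where H: "HN_filtration D \<sigma> E n Es A \<phi>" using HN_filtration_exists by blast
  then show ?thesis
    using HN_Hom_from_semistable[OF H slice_shift_int[OF assms(1)] assms(2)] phi_plus_eq[OF H] by simp
qed

lemma Hom_to_semistable_ge_phi_minus: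
  assumes "X \<in> slice \<sigma> \<psi>" "nonzero_Hom (sho D k E) X"
  shows "phi_minus D \<sigma> E + real_of_int k \<le> \<psi>"
proof -
  have "nonzero_Hom E (sho D (- k) X)" using assms(2) nonzero_Hom_shift_left by blast
  moreover from this have "\<not> is_zero_object D E" using zero_objectD by blast
  then obtain n Es A \<phi> where H: "HN_filtration D \<sigma> E n Es A \<phi>" using HN_filtration_exists by blast
  ultimately show ?thesis
    using HN_Hom_to_semistable[OF H slice_shift_int[OF assms(1)]] phi_minus_eq[OF H] by force
qed

text \<open>A nonzero map into \<open>E'\<close> is detected by a nonzero map to some
  Harder--Narasimhan factor of \<open>E'\<close>, and maps to semistable objects are controlled by
  the lowest phase of the source.\<close>

lemma phi_minus_le_phi_plus:
  assumes "nonzero_Hom (sho D k E) E'"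
  shows "phi_minus D \<sigma> E + real_of_int k \<le> phi_plus D \<sigma> E'"
proof -
  have "\<not> is_zero_object D E'" using assms zero_objectD by blast
  then obtain n Es A \<phi> where H: "HN_filtration D \<sigma> E' n Es A \<phi>" using HN_filtration_exists by blast
  obtain i where i: "i \<in> {1..n}" "nonzero_Hom (sho D k E) (A i)" using HN_nonzero_Hom[OF H assms] by blast
  have "phi_minus D \<sigma> E + real_of_int k \<le> \<phi> i"
    by (rule Hom_to_semistable_ge_phi_minus[OF HN_factor(2)[OF H i(1)] i(2)])
  also have "\<dots> \<le> \<phi> 1" using HN_phases_mono[OF H] i(1) by simp
  finally show ?thesis using phi_plus_eq[OF H] by simp
qed

end

section \<open>Comparison of phases and shifting numbers\<close>

text \<open>If the dual space were zero, every morphism would represent the zero functional, and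
  uniqueness of the representing morphism would force it to be 0.\<close>

lemma (in linear_category) serre_nonzero_Hom:
  assumes "serre_functor D So Sm" "nonzero_Hom X Y"
  shows "nonzero_Hom Y (So X)"
proof (rule ccontr)
  assume "\<not> nonzero_Hom Y (So X)"
  then have 0: "Hom D Y (So X) = {0}" unfolding nonzero_Hom_def by blast
  obtain \<kappa> where
      lin: "\<forall>X Y. \<forall>f\<in>Hom D X Y. linear_on (smul D) (*) (Hom D Y (So X)) (\<kappa> X Y f)"
    and ex1: "\<forall>X Y l. linear_on (smul D) (*) (Hom D Y (So X)) l \<longrightarrow>
           (\<exists>!f. f \<in> Hom D X Y \<and> (\<forall>g\<in>Hom D Y (So X). \<kappa> X Y f g = l g))"
    using assms(1) unfolding serre_functor_def by (elim conjE exE) (rule that)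
  have "\<kappa> X Y f g = 0" if "f \<in> Hom D X Y" "g \<in> Hom D Y (So X)" for f g
    using linear_on_zero[OF lin[rule_format, OF that(1)]] 0 that(2) by simp
  moreover have "linear_on (smul D) (*) (Hom D Y (So X)) (\<lambda>_. 0)" by (simp add: linear_on_def)
  ultimately have "f = 0" if "f \<in> Hom D X Y" for f
    using ex1[rule_format, of Y X "\<lambda>_. 0"] that Hom_zero[of X Y] by blast
  then show False using nonzero_HomE[OF assms(2)] by metis
qed

locale stable_ghost_bounded_generator =
  stability_condition D \<Gamma> cl \<sigma> + ghost_bounded_generator D G N
  for D :: "('k::field, 'o, 'm::ab_group_add, 'z) tricat_scheme" (structure)
    and \<Gamma> :: "'g monoid" and cl :: "('o \<Rightarrow>\<^sub>0 int) set \<Rightarrow> 'g" and \<sigma> :: "('g, 'o) stability"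
    and G :: 'o and N :: nat +
  assumes serre: "\<exists>So Sm. serre_functor D So Sm"
begin

text \<open>Each phase is bounded on both sides. Cell detection handles the two bounds that start
  from a Harder--Narasimhan factor of \<open>E\<close>; the other two start from an extremal map
  G[k] -> E. The constant involves \<open>G\<close>, its Serre dual and the margin \<open>d\<close>,
  but not \<open>E\<close>.\<close>

lemma phase_eps_bound:
  obtains c :: real where
    "\<And>E. \<not> is_zero_object D E \<Longrightarrow> \<bar>phi_plus D \<sigma> E - real_of_int (eps_upper D G E)\<bar> \<le> c \<and>
      \<bar>phi_minus D \<sigma> E - real_of_int (eps_lower D G E)\<bar> \<le> c"
proof -
  obtain So Sm where S: "serre_functor D So Sm" using serre by blast
  obtain d where d: "0 \<le> d" "\<And>E. \<exists>E'. cell_map G {eps_lower D G E - d..eps_upper D G E + d} E E' 0"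
    using zero_cell_map by blast
  let ?c = "\<bar>phi_plus D \<sigma> G\<bar> + \<bar>phi_minus D \<sigma> G\<bar> + \<bar>phi_plus D \<sigma> (So G)\<bar> + real_of_int d"
  have "\<bar>phi_plus D \<sigma> E - real_of_int (eps_upper D G E)\<bar> \<le> ?c \<and>
      \<bar>phi_minus D \<sigma> E - real_of_int (eps_lower D G E)\<bar> \<le> ?c" if nz: "\<not> is_zero_object D E" for E
  proof -
    obtain E' where E': "cell_map G {eps_lower D G E - d..eps_upper D G E + d} E E' 0" using d(2) by blast
    have 1: "phi_minus D \<sigma> G + real_of_int (eps_upper D G E) \<le> phi_plus D \<sigma> E"
      by (rule phi_minus_le_phi_plus[OF eps_attained(1)[OF nz]])
    have 2: "phi_plus D \<sigma> E \<le> phi_plus D \<sigma> G + real_of_int (eps_upper D G E + d)"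
    proof -
      obtain X where X: "X \<in> slice \<sigma> (phi_plus D \<sigma> E)" "nonzero_Hom X E" using phi_plus_attained[OF nz] .
      obtain u where u: "u \<in> Hom D X E" "u \<noteq> 0" using nonzero_HomE[OF X(2)] .
      obtain j where j: "j \<le> eps_upper D G E + d" "nonzero_Hom (sho D (- j) X) G"
        using cell_map_detects[OF exact_functor_id E', of u X] u compose_zero_left[OF u(1)] by auto
      have "phi_plus D \<sigma> E + real_of_int (- j) \<le> phi_plus D \<sigma> G"
        by (rule Hom_from_semistable_le_phi_plus[OF X(1) j(2)])
      moreover have "real_of_int j \<le> real_of_int (eps_upper D G E + d)" using j(1) by (simp only: of_int_le_iff)
      ultimately show ?thesis by simp
    qed
    \<comment> \<open>The extremal map points into \<open>E\<close>, which says nothing about an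
      upper bound for its lowest phase; Serre duality turns it into a map from a shift of
      \<open>E\<close> to \<open>So G\<close>.\<close>
    have 3: "phi_minus D \<sigma> E \<le> phi_plus D \<sigma> (So G) + real_of_int (eps_lower D G E)"
    proof -
      have "nonzero_Hom G (sho D (- eps_lower D G E) E)"
        using eps_attained(2)[OF nz] nonzero_Hom_shift_left by blast
      from phi_minus_le_phi_plus[OF serre_nonzero_Hom[OF S this]] show ?thesis by simp
    qed
    have 4: "phi_minus D \<sigma> G + real_of_int (eps_lower D G E - d) \<le> phi_minus D \<sigma> E"
    proof -
      obtain X where X: "X \<in> slice \<sigma> (phi_minus D \<sigma> E)" "nonzero_Hom E X" using phi_minus_attained[OF nz] .
      obtain v where v: "v \<in> Hom D E X" "v \<noteq> 0" using nonzero_HomE[OF X(2)] .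
      obtain j where j: "eps_lower D G E - d \<le> j" "nonzero_Hom (sho D j G) X"
        using cell_map_detects_left[OF E' v refl] by auto
      have "phi_minus D \<sigma> G + real_of_int j \<le> phi_minus D \<sigma> E"
        by (rule Hom_to_semistable_ge_phi_minus[OF X(1) j(2)])
      moreover have "real_of_int (eps_lower D G E - d) \<le> real_of_int j" using j(1) by (simp only: of_int_le_iff)
      ultimately show ?thesis by simp
    qed
    have "0 \<le> real_of_int d" using d(1) by simp
    then show ?thesis
      using 1 2 3 4 unfolding of_int_add of_int_diff by (intro conjI; linarith)
  qed
  then show thesis by (rule that)
qed

end

section \<open>Existence of the limits and independence of the generator\<close>

theorem mainTheorem2:
  fixes D :: "('k::field, 'o, 'm::ab_group_add) tricat"
    and Fo :: "'o \<Rightarrow> 'o" and Fm :: "'m \<Rightarrow> 'm"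
    and \<Gamma> :: "'g monoid" and cl :: "('o \<Rightarrow>\<^sub>0 int) set \<Rightarrow> 'g" and \<sigma> :: "('g, 'o) stability"
  assumes "triangulated_category D"
    and "finite_type D"
    and "saturated TYPE('e) TYPE('c::ab_group_add) TYPE('b::ab_group_add) D"
    and "\<exists>G. split_generator D G"
    and "triangulated_functor D Fo Fm"
    and "\<not> virtually_zero D Fo"
    and "\<exists>So Sm. serre_functor D So Sm"
    and "free_of_finite_rank \<Gamma>"
    and "cl \<in> hom (K0 D) \<Gamma>"
    and "stability_condition D \<Gamma> cl \<sigma>"
  shows "\<forall>G. split_generator D G \<longrightarrow>
      (\<lambda>n. (phi_plus D \<sigma> ((Fo ^^ n) G) - phi_plus D \<sigma> G) / real n)
         \<longlonglongrightarrow> upper_shifting_number D Fo \<and>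
      (\<lambda>n. (phi_minus D \<sigma> ((Fo ^^ n) G) - phi_minus D \<sigma> G) / real n)
         \<longlonglongrightarrow> lower_shifting_number D Fo"
proof -
  interpret stability_condition D \<Gamma> cl \<sigma> by fact
  define F where "F n = Fo ^^ n" for n
  have exact: "exact_functor (F n) (Fm ^^ n)" for n
    unfolding F_def by (rule exact_functor_power[OF triangulated_functor_exact[OF assms(5)]])
  have generator: "\<exists>N. stable_ghost_bounded_generator D \<Gamma> cl \<sigma> G N" if G: "split_generator D G" for G
  proof -
    obtain N where "\<And>X Y f. ghosts {G} N X Y f \<Longrightarrow> f = 0"
      by (rule saturated_ghosts_zero[OF assms(1,3) G]) blast
    then have "stable_ghost_bounded_generator D \<Gamma> cl \<sigma> G N"
      using assms(2,7) by unfold_locales auto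
    then show ?thesis ..
  qed
  \<comment> \<open>\<open>virtually_zero\<close> concerns only exponents at least 1, so the power n
    + 1 supplies an object on which F^n (F E) is nonzero, also for n = 0. The functor estimate then
    shows that F^n G is nonzero.\<close>
  have nz: "\<not> is_zero_object D (F n G)" if G: "split_generator D G" for n G
  proof -
    obtain N where "stable_ghost_bounded_generator D \<Gamma> cl \<sigma> G N" using generator[OF G] ..
    then interpret stable_ghost_bounded_generator D \<Gamma> cl \<sigma> G N .
    have "\<exists>E. \<not> is_zero_object D (F n (Fo E))"
      using assms(6) unfolding virtually_zero_def F_def
      by (metis funpow_Suc_right comp_apply le_add1 plus_1_eq_Suc)
    then show ?thesis using eps_exact_functor exact by metis
  qed
  have bounds: "\<exists>c. (\<forall>E. \<not> is_zero_object D E \<longrightarrow>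
        \<bar>phi_plus D \<sigma> E - real_of_int (eps_upper D G E)\<bar> \<le> c \<and>
        \<bar>phi_minus D \<sigma> E - real_of_int (eps_lower D G E)\<bar> \<le> c) \<and>
      (\<forall>n E. \<not> is_zero_object D (F n E) \<longrightarrow>
        real_of_int (eps_upper D G (F n E)) \<le>
          real_of_int (eps_upper D G E) + real_of_int (eps_upper D G (F n G)) + c \<and>
        real_of_int (eps_lower D G E) + real_of_int (eps_lower D G (F n G)) - c \<le>
          real_of_int (eps_lower D G (F n E)))"
    if G: "split_generator D G" for G
  proof -
    obtain N where "stable_ghost_bounded_generator D \<Gamma> cl \<sigma> G N" using generator[OF G] ..
    then interpret stable_ghost_bounded_generator D \<Gamma> cl \<sigma> G N .
    obtain c where c: "\<And>E. \<not> is_zero_object D E \<Longrightarrow>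
        \<bar>phi_plus D \<sigma> E - real_of_int (eps_upper D G E)\<bar> \<le> c \<and>
        \<bar>phi_minus D \<sigma> E - real_of_int (eps_lower D G E)\<bar> \<le> c"
      using phase_eps_bound by blast
    obtain d where d: "0 \<le> d" "\<And>Fo Fm E. exact_functor Fo Fm \<Longrightarrow> \<not> is_zero_object D (Fo E) \<Longrightarrow>
        \<not> is_zero_object D (Fo G) \<and>
        eps_upper D G (Fo E) \<le> eps_upper D G E + eps_upper D G (Fo G) + d \<and>
        eps_lower D G E + eps_lower D G (Fo G) - d \<le> eps_lower D G (Fo E)"
      using eps_exact_functor by blast
    have "real_of_int (eps_upper D G (F n E)) \<le>
          real_of_int (eps_upper D G E) + real_of_int (eps_upper D G (F n G)) + real_of_int d \<and>
        real_of_int (eps_lower D G E) + real_of_int (eps_lower D G (F n G)) - real_of_int d \<le>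
          real_of_int (eps_lower D G (F n E))"
      if "\<not> is_zero_object D (F n E)" for n E
      using d(2)[OF exact that] by linarith
    then show ?thesis
      using c by (intro exI[of _ "max c (real_of_int d)"]) (fastforce simp: le_max_iff_disj)
  qed
  \<comment> \<open>The functor estimate for \<open>G\<close> with E = G' compares F^n G' and F^n G
    up to eps(G, G'), uniformly in n. Two copies of \<open>c\<close> pass between phases and eps,
    the third comes from that estimate.\<close>
  have comparison: "\<exists>c. \<forall>n. phi_plus D \<sigma> (F n G') \<le> phi_plus D \<sigma> (F n G) + c \<and>
      phi_minus D \<sigma> (F n G) - c \<le> phi_minus D \<sigma> (F n G')"
    if G: "split_generator D G" and G': "split_generator D G'" for G G'
  proof -
    obtain c where c: "\<And>E. \<not> is_zero_object D E \<Longrightarrow>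
        \<bar>phi_plus D \<sigma> E - real_of_int (eps_upper D G E)\<bar> \<le> c \<and>
        \<bar>phi_minus D \<sigma> E - real_of_int (eps_lower D G E)\<bar> \<le> c"
      "\<And>n E. \<not> is_zero_object D (F n E) \<Longrightarrow>
        real_of_int (eps_upper D G (F n E)) \<le>
          real_of_int (eps_upper D G E) + real_of_int (eps_upper D G (F n G)) + c \<and>
        real_of_int (eps_lower D G E) + real_of_int (eps_lower D G (F n G)) - c \<le>
          real_of_int (eps_lower D G (F n E))"
      using bounds[OF G] by metis
    show ?thesis
    proof (intro exI allI)
      fix n
      show "phi_plus D \<sigma> (F n G') \<le> phi_plus D \<sigma> (F n G) +
            (3 * c + \<bar>real_of_int (eps_upper D G G')\<bar> + \<bar>real_of_int (eps_lower D G G')\<bar>) \<and>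
          phi_minus D \<sigma> (F n G) -
            (3 * c + \<bar>real_of_int (eps_upper D G G')\<bar> + \<bar>real_of_int (eps_lower D G G')\<bar>)
            \<le> phi_minus D \<sigma> (F n G')"
        using c(1)[OF nz[OF G], of n] c(1)[OF nz[OF G'], of n] c(2)[OF nz[OF G'], of n]
        by linarith
    qed
  qed
  have limits: "\<exists>tu tl. (\<lambda>n. phi_plus D \<sigma> (F n G) / real n) \<longlonglongrightarrow> tu \<and>
      (\<lambda>n. phi_minus D \<sigma> (F n G) / real n) \<longlonglongrightarrow> tl"
    if G: "split_generator D G" for G
  proof -
    obtain N where "stable_ghost_bounded_generator D \<Gamma> cl \<sigma> G N" using generator[OF G] ..
    then interpret stable_ghost_bounded_generator D \<Gamma> cl \<sigma> G N .
    obtain c where c: "\<And>E. \<not> is_zero_object D E \<Longrightarrow>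
        \<bar>phi_plus D \<sigma> E - real_of_int (eps_upper D G E)\<bar> \<le> c \<and>
        \<bar>phi_minus D \<sigma> E - real_of_int (eps_lower D G E)\<bar> \<le> c"
      "\<And>n E. \<not> is_zero_object D (F n E) \<Longrightarrow>
        real_of_int (eps_upper D G (F n E)) \<le>
          real_of_int (eps_upper D G E) + real_of_int (eps_upper D G (F n G)) + c \<and>
        real_of_int (eps_lower D G E) + real_of_int (eps_lower D G (F n G)) - c \<le>
          real_of_int (eps_lower D G (F n E))"
      using bounds[OF G] by metis
    define a where "a n = real_of_int (eps_upper D G (F n G))" for n
    define b where "b n = real_of_int (eps_lower D G (F n G))" for n
    have ab: "b n \<le> a n" for n using eps_lower_le_upper[OF nz[OF G]] by (simp add: a_def b_def)
    have F_add: "F (m + n) G = F m (F n G)" for m n by (simp add: F_def funpow_add)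
    have sub: "a (m + n) \<le> a m + a n + c" for m n
      using c(2)[of m "F n G"] nz[OF G, of "m + n"] unfolding a_def F_add by simp
    have sup: "b m + b n - c \<le> b (m + n)" for m n
      using c(2)[of m "F n G"] nz[OF G, of "m + n"] unfolding b_def F_add by simp
    \<comment> \<open>Subadditivity bounds \<open>a\<close> linearly from above, superadditivity
      bounds \<open>b\<close> linearly from below. Since b \<le> a, each bound is the one that
      \<open>fekete\<close> requires for the other sequence.\<close>
    have a_le: "a n \<le> a 0 + real n * (a 1 + c)" for n
    proof (induction n)
      case (Suc n)
      then show ?case using sub[of n 1] by (simp add: algebra_simps)
    qed simp
    have b_ge: "b 0 + real n * (b 1 - c) \<le> b n" for n
    proof (induction n)
      case (Suc n)
      then show ?case using sup[of n 1] by (simp add: algebra_simps)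
    qed simp
    obtain tu where tu: "(\<lambda>n. a n / real n) \<longlonglongrightarrow> tu"
      by (rule fekete[OF sub]) (use b_ge ab order_trans in blast)
    have "- b (m + n) \<le> - b m + - b n + c" for m n using sup[of m n] by simp
    moreover have "- a 0 + real n * (- (a 1 + c)) \<le> - b n" for n using a_le[of n] ab[of n] by (simp add: algebra_simps)
    ultimately obtain tl where "(\<lambda>n. - b n / real n) \<longlonglongrightarrow> tl" by (rule fekete)
    from tendsto_minus[OF this] have tl: "(\<lambda>n. b n / real n) \<longlonglongrightarrow> - tl" by simp
    have "(\<lambda>n. phi_plus D \<sigma> (F n G) / real n) \<longlonglongrightarrow> tu"
      by (rule LIMSEQ_over_n_bounded_diff[OF tu, where C = c]) (use c(1)[OF nz[OF G]] in \<open>simp add: a_def\<close>)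
    moreover have "(\<lambda>n. phi_minus D \<sigma> (F n G) / real n) \<longlonglongrightarrow> - tl"
      by (rule LIMSEQ_over_n_bounded_diff[OF tl, where C = c]) (use c(1)[OF nz[OF G]] in \<open>simp add: b_def\<close>)
    ultimately show ?thesis by blast
  qed
  obtain G0 where G0: "split_generator D G0" using assms(4) ..
  obtain tu tl where t0: "(\<lambda>n. phi_plus D \<sigma> (F n G0) / real n) \<longlonglongrightarrow> tu"
      "(\<lambda>n. phi_minus D \<sigma> (F n G0) / real n) \<longlonglongrightarrow> tl"
    using limits[OF G0] by blast
  have phases: "(\<lambda>n. phi_plus D \<sigma> (F n G) / real n) \<longlonglongrightarrow> tu"
      "(\<lambda>n. phi_minus D \<sigma> (F n G) / real n) \<longlonglongrightarrow> tl"
    if G: "split_generator D G" for G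
  proof -
    obtain c c' where c: "\<And>n. phi_plus D \<sigma> (F n G) \<le> phi_plus D \<sigma> (F n G0) + c \<and>
        phi_minus D \<sigma> (F n G0) - c \<le> phi_minus D \<sigma> (F n G)"
      "\<And>n. phi_plus D \<sigma> (F n G0) \<le> phi_plus D \<sigma> (F n G) + c' \<and>
        phi_minus D \<sigma> (F n G) - c' \<le> phi_minus D \<sigma> (F n G0)"
      using comparison[OF G0 G] comparison[OF G G0] by blast
    show "(\<lambda>n. phi_plus D \<sigma> (F n G) / real n) \<longlonglongrightarrow> tu"
    proof (rule LIMSEQ_over_n_bounded_diff[OF t0(1)])
      show "\<bar>phi_plus D \<sigma> (F n G) - phi_plus D \<sigma> (F n G0)\<bar> \<le> \<bar>c\<bar> + \<bar>c'\<bar>" for n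
        using c(1)[of n] c(2)[of n] by linarith
    qed
    show "(\<lambda>n. phi_minus D \<sigma> (F n G) / real n) \<longlonglongrightarrow> tl"
    proof (rule LIMSEQ_over_n_bounded_diff[OF t0(2)])
      show "\<bar>phi_minus D \<sigma> (F n G) - phi_minus D \<sigma> (F n G0)\<bar> \<le> \<bar>c\<bar> + \<bar>c'\<bar>" for n
        using c(1)[of n] c(2)[of n] by linarith
    qed
  qed
  \<comment> \<open>In eps(G, F^n G) the generator occurs twice, in the phases of F^n G only once.
    Independence is therefore settled for the phases and transferred to eps by the bounded
    difference.\<close>
  have eps: "(\<lambda>n. real_of_int (eps_upper D G (F n G)) / real n) \<longlonglongrightarrow> tu"
      "(\<lambda>n. real_of_int (eps_lower D G (F n G)) / real n) \<longlonglongrightarrow> tl"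
    if G: "split_generator D G" for G
  proof -
    obtain c where c: "\<And>E. \<not> is_zero_object D E \<Longrightarrow>
        \<bar>phi_plus D \<sigma> E - real_of_int (eps_upper D G E)\<bar> \<le> c \<and>
        \<bar>phi_minus D \<sigma> E - real_of_int (eps_lower D G E)\<bar> \<le> c"
      using bounds[OF G] by metis
    show "(\<lambda>n. real_of_int (eps_upper D G (F n G)) / real n) \<longlonglongrightarrow> tu"
      by (rule LIMSEQ_over_n_bounded_diff[OF phases(1)[OF G], where C = c])
        (use c[OF nz[OF G]] in \<open>simp add: abs_minus_commute\<close>)
    show "(\<lambda>n. real_of_int (eps_lower D G (F n G)) / real n) \<longlonglongrightarrow> tl"
      by (rule LIMSEQ_over_n_bounded_diff[OF phases(2)[OF G], where C = c])
        (use c[OF nz[OF G]] in \<open>simp add: abs_minus_commute\<close>)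
  qed
  have "upper_shifting_number D Fo = tu"
    unfolding upper_shifting_number_def
  proof (rule the_equality)
    show "t = tu" if "\<forall>G. split_generator D G \<longrightarrow>
        (\<lambda>n. real_of_int (eps_upper D G ((Fo ^^ n) G)) / real n) \<longlonglongrightarrow> t" for t
      using that G0 eps(1)[OF G0] LIMSEQ_unique unfolding F_def by blast
  qed (use eps(1) in \<open>simp add: F_def\<close>)
  moreover have "lower_shifting_number D Fo = tl"
    unfolding lower_shifting_number_def
  proof (rule the_equality)
    show "t = tl" if "\<forall>G. split_generator D G \<longrightarrow>
        (\<lambda>n. real_of_int (eps_lower D G ((Fo ^^ n) G)) / real n) \<longlonglongrightarrow> t" for t
      using that G0 eps(2)[OF G0] LIMSEQ_unique unfolding F_def by blast
  qed (use eps(2) in \<open>simp add: F_def\<close>)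
  moreover have "(\<lambda>n. (phi_plus D \<sigma> ((Fo ^^ n) G) - phi_plus D \<sigma> G) / real n) \<longlonglongrightarrow> tu"
    if G: "split_generator D G" for G
    by (rule LIMSEQ_over_n_bounded_diff[OF phases(1)[OF G], where C = "\<bar>phi_plus D \<sigma> G\<bar>"]) (simp add: F_def)
  moreover have "(\<lambda>n. (phi_minus D \<sigma> ((Fo ^^ n) G) - phi_minus D \<sigma> G) / real n) \<longlonglongrightarrow> tl"
    if G: "split_generator D G" for G
    by (rule LIMSEQ_over_n_bounded_diff[OF phases(2)[OF G], where C = "\<bar>phi_minus D \<sigma> G\<bar>"]) (simp add: F_def)
  ultimately show ?thesis by simp
qed

end
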